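(* Let $n$ and $r$ be positive integers, and let $\gamma\in F_r$ be an element of the free group of rank $r$ with fixed generators $x_1,\dots,x_r$. Then, as symmetric functions, $$\frac{1}{n!}\sum_{u_1,\dots,u_r\in S_n} p_{\rho(\gamma(u_1,\dots,u_r))} = \sum_{\lambda\vdash n} a^{\gamma}_{\chi^\lambda}\, s_\lambda .$$
   Context: $S_n$ is the symmetric group on an $n$-element set. For a group $G$ and $g_1,\dots,g_r\in G$, $\gamma(g_1,\dots,g_r)\in G$ denotes the image of $\gamma$ under the homomorphism $F_r\to G$ sending the $i$th generator $x_i$ to $g_i$. For a finite group $G$, $f_\gamma=f_{\gamma,G}$ is the class function $f_\gamma(w)=|\{(g_1,\dots,g_r)\in G^r:\gamma(g_1,\dots,g_r)=w\}|$, and the coefficients $a_\chi^\gamma\in\mathbb{C}$ are defined by the expansion $f_\gamma=\sum_\chi a_\chi^\gamma\chi$ over the irreducible complex characters $\chi$ of $G$; here they are taken with $G=S_n$. For a partition $\lambda\vdash n$, $p_\lambda$ and $s_\lambda$ are the power sum and Schur symmetric functions (over $\mathbb{C}$), and $\chi^\lambda$ is the irreducible character of $S_n$ afforded by the Specht module $S^\lambda$. For $w\in S_n$, $\rho(w)$ is the partition of $n$ given by the cycle type of $w$. *)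

theory Defs
  imports
    "HOL-Algebra.Sym_Groups"
    "HOL-Combinatorics.Orbits"
    "HOL-Library.Multiset"
    "HOL-Library.Poly_Mapping"
    "Jordan_Normal_Form.VS_Connect"
begin

section \<open>Free groups and word maps\<close>

text \<open>The letter \<open>(i, True)\<close> stands for the generator \<open>x\<^sub>i\<close> and \<open>(i, False)\<close> for its inverse.\<close>

type_synonym letter = "nat \<times> bool"

definition flip :: "letter \<Rightarrow> letter" where
  "flip l = (fst l, \<not> snd l)"

definition reduced :: "letter list \<Rightarrow> bool" where
  "reduced = successively (\<lambda>l m. m \<noteq> flip l)"

definition push :: "letter \<Rightarrow> letter list \<Rightarrow> letter list" where
  "push l w = (case w of [] \<Rightarrow> [l] | m # w' \<Rightarrow> if m = flip l then w' else l # w)"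

definition free_group :: "nat \<Rightarrow> letter list monoid" where
  "free_group r =
    \<lparr> carrier = {w. set w \<subseteq> {1..r} \<times> UNIV \<and> reduced w},
      mult = foldr push,
      one = [] \<rparr>"

definition letter_eval :: "('a, 'b) monoid_scheme \<Rightarrow> (nat \<Rightarrow> 'a) \<Rightarrow> letter \<Rightarrow> 'a" where
  "letter_eval G g l = (if snd l then g (fst l) else inv\<^bsub>G\<^esub> g (fst l))"

definition word_eval :: "('a, 'b) monoid_scheme \<Rightarrow> (nat \<Rightarrow> 'a) \<Rightarrow> letter list \<Rightarrow> 'a" where
  "word_eval G g w = foldr (\<lambda>l a. letter_eval G g l \<otimes>\<^bsub>G\<^esub> a) w \<one>\<^bsub>G\<^esub>"

lemma flip_flip [simp]: "flip (flip l) = l"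
  by (simp add: flip_def)

lemma fst_flip [simp]: "fst (flip l) = fst l"
  by (simp add: flip_def)

lemma flip_neq [simp]: "flip l \<noteq> l" "l \<noteq> flip l"
  by (auto simp: flip_def prod_eq_iff)

lemma reduced_Nil [simp]: "reduced []"
  by (simp add: reduced_def)

lemma reduced_Cons:
  "reduced (l # w) \<longleftrightarrow> reduced w \<and> (case w of [] \<Rightarrow> True | m # _ \<Rightarrow> m \<noteq> flip l)"
  by (auto simp: reduced_def successively_Cons split: list.splits)

lemma reduced_push: "reduced w \<Longrightarrow> reduced (push l w)"
  by (cases w) (simp_all add: push_def reduced_Cons)

lemma push_reduced: "reduced (l # w) \<Longrightarrow> push l w = l # w"
  by (cases w) (simp_all add: push_def reduced_Cons)

lemma push_flip_push: "reduced w \<Longrightarrow> push (flip l) (push l w) = w"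
  by (cases w; cases "tl w"; simp add: push_def reduced_Cons; metis flip_flip)

lemma reduced_foldr_push: "reduced v \<Longrightarrow> reduced (foldr push u v)"
  by (induction u) (auto simp: reduced_push)

lemma set_push: "set (push l w) \<subseteq> insert l (set w)"
  by (cases w) (auto simp: push_def)

lemma set_foldr_push: "set (foldr push u v) \<subseteq> set u \<union> set v"
proof (induction u)
  case (Cons l u)
  then show ?case using set_push[of l "foldr push u v"] by auto
qed simp

lemma foldr_push_push:
  assumes "reduced v"
  shows "foldr push (push l u) v = push l (foldr push u v)"
proof (cases u)
  case (Cons m u')
  show ?thesis
  proof (cases "m = flip l")
    case True
    have "push (flip m) (push m (foldr push u' v)) = foldr push u' v"
      using assms by (intro push_flip_push reduced_foldr_push)
    with True Cons show ?thesis by (simp add: push_def)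
  qed (use Cons in \<open>simp add: push_def\<close>)
qed (simp add: push_def)

lemma foldr_push_assoc:
  "reduced v \<Longrightarrow> reduced w \<Longrightarrow>
    foldr push (foldr push u v) w = foldr push u (foldr push v w)"
  by (induction u) (simp_all add: foldr_push_push)

lemma foldr_push_Nil: "reduced w \<Longrightarrow> foldr push w [] = w"
  by (induction w) (auto simp: push_reduced reduced_Cons)

lemma group_free_group: "group (free_group r)"
proof (rule groupI, goal_cases)
  case (1 u v)
  then show ?case
    using set_foldr_push[of u v] by (auto simp: free_group_def intro: reduced_foldr_push)
next
  case (3 u v w)
  then show ?case by (simp add: free_group_def foldr_push_assoc)
next
  case (5 u)
  then have "set u \<subseteq> {1..r} \<times> UNIV" "reduced u" by (auto simp: free_group_def)
  then have "\<exists>v. set v \<subseteq> {1..r} \<times> UNIV \<and> reduced v \<and> foldr push v u = []"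
  proof (induction u)
    case Nil
    then show ?case by (intro exI[of _ "[]"]) auto
  next
    case (Cons l u)
    then obtain v where v: "set v \<subseteq> {1..r} \<times> UNIV" "reduced v" "foldr push v u = []"
      by (auto simp: reduced_Cons)
    have l: "set [flip l] \<subseteq> {1..r} \<times> UNIV" "reduced [flip l]"
      using Cons.prems by (auto simp: reduced_Cons flip_def)
    have "foldr push (foldr push v [flip l]) (l # u) = foldr push v (push (flip l) (l # u))"
      using Cons.prems l by (subst foldr_push_assoc) auto
    also have "push (flip l) (l # u) = u" by (simp add: push_def)
    finally have "foldr push (foldr push v [flip l]) (l # u) = []" using v by simp
    moreover have "set (foldr push v [flip l]) \<subseteq> {1..r} \<times> UNIV"
      using set_foldr_push[of v "[flip l]"] v l by blast
    moreover have "reduced (foldr push v [flip l])"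
      using l by (intro reduced_foldr_push)
    ultimately show ?case by blast
  qed
  then show ?case by (auto simp: free_group_def)
qed (auto simp: free_group_def)

context group
begin

lemma letter_eval_closed:
  "g \<in> {1..r} \<rightarrow> carrier G \<Longrightarrow> l \<in> {1..r} \<times> UNIV \<Longrightarrow> letter_eval G g l \<in> carrier G"
  by (auto simp: letter_eval_def)

lemma word_eval_closed:
  "g \<in> {1..r} \<rightarrow> carrier G \<Longrightarrow> set w \<subseteq> {1..r} \<times> UNIV \<Longrightarrow> word_eval G g w \<in> carrier G"
  by (induction w) (auto simp: word_eval_def letter_eval_closed)

lemma word_eval_push:
  assumes g: "g \<in> {1..r} \<rightarrow> carrier G"
    and "l \<in> {1..r} \<times> UNIV" "set w \<subseteq> {1..r} \<times> UNIV"
  shows "word_eval G g (push l w) = letter_eval G g l \<otimes> word_eval G g w"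
proof (cases w)
  case (Cons m w')
  have cl: "word_eval G g w' \<in> carrier G" "letter_eval G g l \<in> carrier G"
    using assms Cons word_eval_closed letter_eval_closed by auto
  have gl: "g (fst l) \<in> carrier G" using assms by auto
  have "letter_eval G g l \<otimes> letter_eval G g (flip l) = \<one>"
    using gl by (auto simp: letter_eval_def flip_def)
  then have "letter_eval G g l \<otimes> (letter_eval G g (flip l) \<otimes> word_eval G g w') = word_eval G g w'"
    using cl gl by (simp add: m_assoc[symmetric] letter_eval_def flip_def)
  with Cons show ?thesis by (auto simp: push_def word_eval_def)
qed (simp add: push_def word_eval_def)

lemma word_eval_foldr_push:
  assumes g: "g \<in> {1..r} \<rightarrow> carrier G"
  shows "set u \<subseteq> {1..r} \<times> UNIV \<Longrightarrow> set v \<subseteq> {1..r} \<times> UNIV \<Longrightarrow>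
    word_eval G g (foldr push u v) = word_eval G g u \<otimes> word_eval G g v"
proof (induction u)
  case Nil
  then show ?case using word_eval_closed[OF g] by (simp add: word_eval_def)
next
  case (Cons l u)
  have "set (foldr push u v) \<subseteq> {1..r} \<times> UNIV"
    using set_foldr_push[of u v] Cons.prems by auto
  then have "word_eval G g (foldr push (l # u) v)
      = letter_eval G g l \<otimes> (word_eval G g u \<otimes> word_eval G g v)"
    using Cons word_eval_push[OF g] by simp
  also have "\<dots> = letter_eval G g l \<otimes> word_eval G g u \<otimes> word_eval G g v"
    using Cons.prems word_eval_closed[OF g] letter_eval_closed[OF g] by (simp add: m_assoc)
  finally show ?case by (simp add: word_eval_def)
qed

lemma word_eval_hom:
  "g \<in> {1..r} \<rightarrow> carrier G \<Longrightarrow> word_eval G g \<in> hom (free_group r) G"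
  by (rule homI) (auto simp: free_group_def word_eval_closed word_eval_foldr_push)

lemma word_eval_generator:
  "g \<in> {1..r} \<rightarrow> carrier G \<Longrightarrow> i \<in> {1..r} \<Longrightarrow> word_eval G g [(i, True)] = g i"
  by (auto simp: word_eval_def letter_eval_def Pi_iff)

lemma word_eval_unique:
  assumes h: "h \<in> hom (free_group r) G"
    and gen: "\<And>i. i \<in> {1..r} \<Longrightarrow> h [(i, True)] = g i"
    and w: "w \<in> carrier (free_group r)"
  shows "h w = word_eval G g w"
proof -
  interpret F: group "free_group r" by (rule group_free_group)
  interpret h: group_hom "free_group r" G h
    using h by unfold_locales
  have let_h: "h [l] = letter_eval G g l" if "l \<in> {1..r} \<times> UNIV" for l
  proof -
    obtain i b where l: "l = (i, b)" by (cases l)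
    have i: "[(i, True)] \<in> carrier (free_group r)" "[(i, False)] \<in> carrier (free_group r)"
      using that l by (auto simp: free_group_def reduced_Cons)
    have "inv\<^bsub>free_group r\<^esub> [(i, True)] = [(i, False)]"
      using i by (intro F.inv_equality) (auto simp: free_group_def push_def flip_def)
    then show ?thesis
      using l that gen h.hom_inv[OF i(1)] by (cases b) (auto simp: letter_eval_def)
  qed
  from w have "set w \<subseteq> {1..r} \<times> UNIV" "reduced w" by (auto simp: free_group_def)
  then show ?thesis
  proof (induction w)
    case Nil
    then show ?case using h.hom_one by (simp add: free_group_def word_eval_def)
  next
    case (Cons l w)
    have lw: "[l] \<in> carrier (free_group r)" "w \<in> carrier (free_group r)"
      using Cons.prems by (auto simp: free_group_def reduced_Cons)
    have "[l] \<otimes>\<^bsub>free_group r\<^esub> w = l # w"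
      using Cons.prems by (simp add: free_group_def push_reduced)
    then have "h (l # w) = h [l] \<otimes> h w" using h.hom_mult[OF lw] by simp
    with Cons let_h show ?case by (simp add: word_eval_def reduced_Cons)
  qed
qed

end


section \<open>Irreducible characters and the expansion of the word-solution counts\<close>

definition trace :: "'a::comm_monoid_add mat \<Rightarrow> 'a" where
  "trace A = (\<Sum>i<dim_row A. A $$ (i, i))"

definition matrix_rep :: "('a, 'b) monoid_scheme \<Rightarrow> nat \<Rightarrow> ('a \<Rightarrow> complex mat) \<Rightarrow> bool" where
  "matrix_rep G d \<rho> \<longleftrightarrow> \<rho> \<in> hom G (units_of (ring_mat TYPE(complex) d ()))"

definition irreducible_rep :: "('a, 'b) monoid_scheme \<Rightarrow> nat \<Rightarrow> ('a \<Rightarrow> complex mat) \<Rightarrow> bool" where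
  "irreducible_rep G d \<rho> \<longleftrightarrow> matrix_rep G d \<rho> \<and> 0 < d \<and>
    (\<forall>W. VectorSpace.subspace class_ring W (module_vec TYPE(complex) d) \<and>
         (\<forall>g\<in>carrier G. \<forall>v\<in>W. \<rho> g *\<^sub>v v \<in> W) \<longrightarrow>
       W = {0\<^sub>v d} \<or> W = carrier_vec d)"

text \<open>Characters are \<^const>\<open>undefined\<close> off the carrier, so that equality of characters
  is equality of HOL functions.\<close>

definition character :: "('a, 'b) monoid_scheme \<Rightarrow> ('a \<Rightarrow> complex mat) \<Rightarrow> 'a \<Rightarrow> complex" where
  "character G \<rho> = (\<lambda>g\<in>carrier G. trace (\<rho> g))"

definition irr_chars :: "('a, 'b) monoid_scheme \<Rightarrow> ('a \<Rightarrow> complex) set" where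
  "irr_chars G = {character G \<rho> | d \<rho>. irreducible_rep G d \<rho>}"

definition char_coeffs ::
    "('a, 'b) monoid_scheme \<Rightarrow> ('a \<Rightarrow> complex) \<Rightarrow> ('a \<Rightarrow> complex) \<Rightarrow> complex" where
  "char_coeffs G f = (THE a. a \<in> extensional (irr_chars G) \<and>
     (\<forall>w\<in>carrier G. f w = (\<Sum>\<chi>\<in>irr_chars G. a \<chi> * \<chi> w)))"

definition word_count ::
    "('a, 'b) monoid_scheme \<Rightarrow> nat \<Rightarrow> letter list \<Rightarrow> 'a \<Rightarrow> nat" where
  "word_count G r \<gamma> w = card {g \<in> {1..r} \<rightarrow>\<^sub>E carrier G. word_eval G g \<gamma> = w}"

definition word_coeff ::
    "('a, 'b) monoid_scheme \<Rightarrow> nat \<Rightarrow> letter list \<Rightarrow> ('a \<Rightarrow> complex) \<Rightarrow> complex" where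
  "word_coeff G r \<gamma> = char_coeffs G (\<lambda>w. of_nat (word_count G r \<gamma> w))"


section \<open>Partitions, cycle type and Specht modules\<close>

definition partitions_of :: "nat \<Rightarrow> nat list set" where
  "partitions_of n = {\<mu>. sorted_wrt (\<ge>) \<mu> \<and> 0 \<notin> set \<mu> \<and> sum_list \<mu> = n}"

definition cycle_type :: "nat \<Rightarrow> (nat \<Rightarrow> nat) \<Rightarrow> nat list" where
  "cycle_type n w = rev (sorted_list_of_multiset (image_mset card (mset_set (orbit w ` {1..n}))))"

definition diagram :: "nat list \<Rightarrow> (nat \<times> nat) set" where
  "diagram \<mu> = {(i, j). i < length \<mu> \<and> j < \<mu> ! i}"

definition tableaux :: "nat list \<Rightarrow> (nat \<times> nat \<Rightarrow> nat) set" where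
  "tableaux \<mu> = {t \<in> extensional (diagram \<mu>). bij_betw t (diagram \<mu>) {1..sum_list \<mu>}}"

text \<open>Two tableaux of the same shape are row equivalent iff their rows agree as sets, so a tabloid
  is encoded as its list of row sets.\<close>

type_synonym tabloid = "nat set list"

definition tabloid_of :: "nat list \<Rightarrow> (nat \<times> nat \<Rightarrow> nat) \<Rightarrow> tabloid" where
  "tabloid_of \<mu> t = map (\<lambda>i. {t (i, j) | j. j < \<mu> ! i}) [0..<length \<mu>]"

definition perm_tabloid :: "(nat \<Rightarrow> nat) \<Rightarrow> tabloid \<Rightarrow> tabloid" where
  "perm_tabloid w = map (image w)"

definition column_stabilizer :: "nat list \<Rightarrow> (nat \<times> nat \<Rightarrow> nat) \<Rightarrow> (nat \<Rightarrow> nat) set" where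
  "column_stabilizer \<mu> t = {\<pi>. \<pi> permutes {1..sum_list \<mu>} \<and>
     (\<forall>j. let C = {t (i, j) | i. (i, j) \<in> diagram \<mu>} in \<pi> ` C = C)}"

text \<open>The type \<^typ>\<open>tabloid \<Rightarrow>\<^sub>0 complex\<close> is the complex vector space of formal linear combinations
  of tabloids.\<close>

definition fscale :: "complex \<Rightarrow> ('t \<Rightarrow>\<^sub>0 complex) \<Rightarrow> 't \<Rightarrow>\<^sub>0 complex" where
  "fscale c = Poly_Mapping.map ((*) c)"

lemma lookup_fscale [simp]: "Poly_Mapping.lookup (fscale c v) x = c * Poly_Mapping.lookup v x"
  by (simp add: fscale_def Poly_Mapping.map.rep_eq when_def)

global_interpretation fvs: vector_space fscale
  by unfold_locales (auto intro!: poly_mapping_eqI simp: lookup_add algebra_simps)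

definition act :: "(nat \<Rightarrow> nat) \<Rightarrow> (tabloid \<Rightarrow>\<^sub>0 complex) \<Rightarrow> tabloid \<Rightarrow>\<^sub>0 complex" where
  "act w v = (\<Sum>T\<in>Poly_Mapping.keys v. Poly_Mapping.single (perm_tabloid w T) (Poly_Mapping.lookup v T))"

definition polytabloid :: "nat list \<Rightarrow> (nat \<times> nat \<Rightarrow> nat) \<Rightarrow> tabloid \<Rightarrow>\<^sub>0 complex" where
  "polytabloid \<mu> t =
    (\<Sum>\<pi>\<in>column_stabilizer \<mu> t.
       Poly_Mapping.single (perm_tabloid \<pi> (tabloid_of \<mu> t)) (of_int (sign \<pi>)))"

definition specht :: "nat list \<Rightarrow> (tabloid \<Rightarrow>\<^sub>0 complex) set" where
  "specht \<mu> = fvs.span (polytabloid \<mu> ` tableaux \<mu>)"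

text \<open>The matrix of \<^term>\<open>act w\<close> on the Specht module with respect to an arbitrary ordered basis;
  its trace does not depend on the choice of the basis.\<close>

definition specht_basis :: "nat list \<Rightarrow> (tabloid \<Rightarrow>\<^sub>0 complex) list" where
  "specht_basis \<mu> =
    (SOME bs. distinct bs \<and> fvs.independent (set bs) \<and> fvs.span (set bs) = specht \<mu>)"

definition specht_rep :: "nat list \<Rightarrow> (nat \<Rightarrow> nat) \<Rightarrow> complex mat" where
  "specht_rep \<mu> w = (let bs = specht_basis \<mu> in
     mat (length bs) (length bs)
       (\<lambda>(i, j). fvs.representation (set bs) (act w (bs ! j)) (bs ! i)))"

definition specht_char :: "nat list \<Rightarrow> (nat \<Rightarrow> nat) \<Rightarrow> complex" where
  "specht_char \<mu> = character (sym_group (sum_list \<mu>)) (specht_rep \<mu>)"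


section \<open>Symmetric functions\<close>

text \<open>Formal power series in the variables \<open>x\<^sub>i\<close> (\<open>i\<close> a natural number). The monomial
  \<open>x\<^sub>a x\<^sub>b \<cdots> x\<^sub>z\<close> is the multiset \<open>{#a, b, \<dots>, z#}\<close>. The ring of symmetric functions is a
  subring, so identities of symmetric functions are identities in this ring.\<close>

typedef 'a mfps = "UNIV :: (nat multiset \<Rightarrow> 'a) set"
  morphisms mfps_coeff Abs_mfps ..

setup_lifting type_definition_mfps

lemma mfps_eqI: "(\<And>m. mfps_coeff f m = mfps_coeff g m) \<Longrightarrow> f = g"
  by (simp add: mfps_coeff_inject[symmetric] fun_eq_iff)

definition msplits :: "nat multiset \<Rightarrow> (nat multiset \<times> nat multiset) set" where
  "msplits m = {(a, b). a + b = m}"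

lemma finite_msplits [simp]: "finite (msplits m)"
proof -
  let ?A = "mset ` {xs. set xs \<subseteq> set_mset m \<and> length xs \<le> size m}"
  have "x \<in> ?A" if "x \<subseteq># m" for x
  proof -
    obtain xs where "mset xs = x" using ex_mset by blast
    with that show ?thesis
      by (intro image_eqI[of _ _ xs])
        (auto dest: mset_subset_eqD size_mset_mono)
  qed
  then have "msplits m \<subseteq> ?A \<times> ?A"
    by (auto simp: msplits_def)
  moreover have "finite (?A \<times> ?A)"
    using finite_lists_length_le[of "set_mset m" "size m"] by simp
  ultimately show ?thesis by (rule finite_subset)
qed

instantiation mfps :: (comm_ring_1) comm_ring_1
begin

lift_definition zero_mfps :: "'a mfps" is "\<lambda>_. 0" .
lift_definition one_mfps :: "'a mfps" is "\<lambda>m. if m = {#} then 1 else 0" .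
lift_definition plus_mfps :: "'a mfps \<Rightarrow> 'a mfps \<Rightarrow> 'a mfps" is "\<lambda>f g m. f m + g m" .
lift_definition minus_mfps :: "'a mfps \<Rightarrow> 'a mfps \<Rightarrow> 'a mfps" is "\<lambda>f g m. f m - g m" .
lift_definition uminus_mfps :: "'a mfps \<Rightarrow> 'a mfps" is "\<lambda>f m. - f m" .
lift_definition times_mfps :: "'a mfps \<Rightarrow> 'a mfps \<Rightarrow> 'a mfps" is
  "\<lambda>f g m. \<Sum>(a, b)\<in>msplits m. f a * g b" .

instance
proof
  fix f g h :: "'a mfps"
  show "f * g * h = f * (g * h)"
  proof (rule mfps_eqI)
    fix m
    let ?F = "mfps_coeff f" and ?G = "mfps_coeff g" and ?H = "mfps_coeff h"
    have "mfps_coeff (f * g * h) m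
        = (\<Sum>(p, c)\<in>msplits m. \<Sum>(a, b)\<in>msplits p. ?F a * ?G b * ?H c)"
      by (simp add: times_mfps.rep_eq sum_distrib_right case_prod_unfold)
    also have "\<dots> = (\<Sum>((p, c), (a, b))\<in>(SIGMA x:msplits m. msplits (fst x)). ?F a * ?G b * ?H c)"
      by (simp add: sum.Sigma case_prod_unfold)
    also have "\<dots> = (\<Sum>((a, q), (b, c))\<in>(SIGMA x:msplits m. msplits (snd x)). ?F a * ?G b * ?H c)"
      by (rule sum.reindex_bij_witness
          [of _ "\<lambda>((a, q), (b, c)). ((a + b, c), (a, b))" "\<lambda>((p, c), (a, b)). ((a, b + c), (b, c))"])
        (auto simp: msplits_def add.assoc)
    also have "\<dots> = (\<Sum>(a, q)\<in>msplits m. \<Sum>(b, c)\<in>msplits q. ?F a * (?G b * ?H c))"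
      by (simp add: sum.Sigma case_prod_unfold mult.assoc)
    also have "\<dots> = mfps_coeff (f * (g * h)) m"
      by (simp add: times_mfps.rep_eq sum_distrib_left case_prod_unfold)
    finally show "mfps_coeff (f * g * h) m = mfps_coeff (f * (g * h)) m" .
  qed
  show "f * g = g * f"
  proof (rule mfps_eqI)
    fix m
    show "mfps_coeff (f * g) m = mfps_coeff (g * f) m"
      unfolding times_mfps.rep_eq
      by (rule sum.reindex_bij_witness[of _ prod.swap prod.swap])
        (auto simp: msplits_def add.commute mult.commute)
  qed
  show "1 * f = f"
  proof (rule mfps_eqI)
    fix m
    have "mfps_coeff (1 * f) m
        = (\<Sum>x\<in>msplits m. if x = ({#}, m) then mfps_coeff f m else 0)"
      unfolding times_mfps.rep_eq one_mfps.rep_eq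
      by (rule sum.cong) (auto simp: msplits_def split: if_splits)
    moreover have "({#}, m) \<in> msplits m" by (simp add: msplits_def)
    ultimately show "mfps_coeff (1 * f) m = mfps_coeff f m"
      by simp
  qed
  show "(f + g) * h = f * h + g * h"
    by (rule mfps_eqI)
      (simp add: times_mfps.rep_eq plus_mfps.rep_eq algebra_simps sum.distrib case_prod_unfold)
  show "(0 :: 'a mfps) \<noteq> 1"
    by (metis zero_mfps.rep_eq one_mfps.rep_eq zero_neq_one)
qed (transfer; simp add: fun_eq_iff algebra_simps)+

end

lift_definition mfps_const :: "'a::zero \<Rightarrow> 'a mfps" is "\<lambda>c m. if m = {#} then c else 0" .

text \<open>\<open>p\<^sub>k = \<Sum>\<^sub>i x\<^sub>i\<^sup>k\<close> for \<open>k > 0\<close>\<close>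

lift_definition power_sum1 :: "nat \<Rightarrow> complex mfps" is
  "\<lambda>k m. if \<exists>i. m = replicate_mset k i then 1 else 0" .

definition power_sum :: "nat list \<Rightarrow> complex mfps" where
  "power_sum \<mu> = prod_list (map power_sum1 \<mu>)"

definition ssyt :: "nat list \<Rightarrow> (nat \<times> nat \<Rightarrow> nat) set" where
  "ssyt \<mu> = {T \<in> extensional (diagram \<mu>).
     (\<forall>i j j'. j < j' \<and> (i, j') \<in> diagram \<mu> \<longrightarrow> T (i, j) \<le> T (i, j')) \<and>
     (\<forall>i i' j. i < i' \<and> (i', j) \<in> diagram \<mu> \<longrightarrow> T (i, j) < T (i', j))}"

lift_definition schur :: "nat list \<Rightarrow> complex mfps" is
  "\<lambda>\<mu> m. of_nat (card {T \<in> ssyt \<mu>. image_mset T (mset_set (diagram \<mu>)) = m})" .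

end

theory Submission
  imports Defs "Jordan_Normal_Form.Spectral_Radius"
begin

text \<open>
  Since \<open>f\<^sub>\<gamma>\<close> is a class function, both sides agree as soon as
  \<open>p\<^bsub>\<rho>(w)\<^esub> = \<Sum> \<chi>\<^sup>\<lambda>(w) s\<^sub>\<lambda>\<close> (Frobenius) and the \<open>\<chi>\<^sup>\<lambda>\<close> are exactly the irreducible characters, with
  \<open>\<langle>\<chi>\<^sup>\<lambda>, \<chi>\<^sup>\<mu>\<rangle> = \<delta>\<close>. The coefficient of the monomial \<open>x\<^sup>m\<close> in \<open>p\<^bsub>\<rho>(w)\<^esub>\<close> is the number of colourings of
  \<open>{1..n}\<close> with content \<open>m\<close> that are fixed by \<open>w\<close>, so Frobenius' formula is Young's rule: the multiplicity
  \<open>a\<^bsub>\<lambda>,m\<^esub>\<close> of \<open>\<chi>\<^sup>\<lambda>\<close> in this permutation character is the Kostka number \<open>K\<^bsub>\<lambda>,m\<^esub>\<close>. James' straightening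
  argument for polytabloids shows that the matrix \<open>a\<close> is unitriangular, and so is \<open>K\<close>. Burnside's lemma and
  the (numerical) RSK correspondence give \<open>a\<^sup>T a = K\<^sup>T K\<close>, the matrix counting contingency tables, and a
  unitriangular matrix is determined by its Gram matrix.
\<close>

section \<open>Schur orthogonality\<close>

text \<open>The coefficients are a definite description over all of \<open>irr_chars\<close>, so the
  Specht characters must be known to be the complete, finite list before one coefficient can be read
  off. Completeness is obtained by counting: permutations of equal cycle type are conjugate, so
  there are at most as many classes as partitions, and an orthonormal family indexed by partitions
  already spans the class functions; a further irreducible character would lie in that span and be
  orthogonal to it. The pairing is \<chi>(g) \<psi>(g^-1); a permutation is conjugate to its
  inverse, so here it is a plain symmetric bilinear form. The order behind unitriangularity compares
  the numbers \<Sum> i * \<mu>_i, with rows counted from 0. In a column-strict filling every entry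
  is at least its row index, so a filling of minimal total is constant on rows; this one remark
  serves both Kostka numbers and straightening. For the RSK identity, a local bijection between
  horizontal strips yields Pieri's rule by induction on the largest letter, and peeling one row off
  a contingency table gives the same recursion.\<close>

lemma subspace_module_vec_iff:
  "VectorSpace.subspace class_ring W (module_vec TYPE(complex) d) \<longleftrightarrow>
    W \<subseteq> carrier_vec d \<and> 0\<^sub>v d \<in> W \<and> (\<forall>v\<in>W. \<forall>w\<in>W. v + w \<in> W) \<and>
    (\<forall>c. \<forall>v\<in>W. c \<cdot>\<^sub>v v \<in> W)"
  (is "?L \<longleftrightarrow> ?R")
proof -
  interpret vec_space "TYPE(complex)" d .
  show ?thesis
    using vectorspace_axioms module_axioms
    by (auto simp: VectorSpace.subspace_def submodule_def module_vec_simps class_ring_simps)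
qed

lemma trace_carrier_mat: "A \<in> carrier_mat d e \<Longrightarrow> trace A = (\<Sum>i<d. A $$ (i, i))"
  by (auto simp: trace_def)

lemma index_mult_mat_sum:
  "A \<in> carrier_mat a b \<Longrightarrow> B \<in> carrier_mat b c \<Longrightarrow> i < a \<Longrightarrow> j < c \<Longrightarrow>
    (A * B) $$ (i, j) = (\<Sum>k<b. A $$ (i, k) * B $$ (k, j))"
  by (auto simp: scalar_prod_def lessThan_atLeast0 intro!: sum.cong)

lemma index_mult_mat_unit_vec:
  fixes A :: "'a :: semiring_1 mat"
  shows "A \<in> carrier_mat a b \<Longrightarrow> i < a \<Longrightarrow> j < b \<Longrightarrow> (A *\<^sub>v unit_vec b j) $ i = A $$ (i, j)"
  by auto

text \<open>Stated for rectangular factors because an intertwiner goes between representations whose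
  degrees \<open>d\<close> and \<open>e\<close> are not known to agree.\<close>

lemma trace_mult_commute:
  fixes A :: "'a :: comm_semiring_0 mat"
  assumes A: "A \<in> carrier_mat d e" and B: "B \<in> carrier_mat e d"
  shows "trace (A * B) = trace (B * A)"
proof -
  have "trace (A * B) = (\<Sum>i<d. \<Sum>k<e. A $$ (i, k) * B $$ (k, i))"
    using A B by (simp add: trace_carrier_mat[OF mult_carrier_mat[OF A B]] index_mult_mat_sum[OF A B]
        del: index_mult_mat(1))
  also have "\<dots> = (\<Sum>k<e. \<Sum>i<d. B $$ (k, i) * A $$ (i, k))"
    by (subst sum.swap) (simp add: mult.commute)
  also have "\<dots> = trace (B * A)"
    using A B by (simp add: trace_carrier_mat[OF mult_carrier_mat[OF B A]] index_mult_mat_sum[OF B A]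
        del: index_mult_mat(1))
  finally show ?thesis .
qed

lemma matrix_rep_carrier:
  "matrix_rep G d \<rho> \<Longrightarrow> g \<in> carrier G \<Longrightarrow> \<rho> g \<in> carrier_mat d d"
  unfolding matrix_rep_def hom_def units_of_def Units_def ring_mat_simps by (auto simp: ring_mat_simps)

lemma matrix_rep_mult:
  "matrix_rep G d \<rho> \<Longrightarrow> g \<in> carrier G \<Longrightarrow> h \<in> carrier G \<Longrightarrow> \<rho> (g \<otimes>\<^bsub>G\<^esub> h) = \<rho> g * \<rho> h"
  unfolding matrix_rep_def hom_def units_of_def by (auto simp: ring_mat_simps)

lemma matrix_rep_one:
  assumes "group G" "matrix_rep G d \<rho>"
  shows "\<rho> \<one>\<^bsub>G\<^esub> = 1\<^sub>m d"
proof -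
  interpret R: ring "ring_mat TYPE(complex) d ()" by (rule ring_mat)
  interpret group_hom G "units_of (ring_mat TYPE(complex) d ())" \<rho>
    using assms R.units_group by (simp add: group_hom_def group_hom_axioms_def matrix_rep_def)
  show ?thesis using hom_one by (simp add: units_of_def ring_mat_simps)
qed

text \<open>Each value is a unit because the value at the inverse group element is its two-sided
  inverse.\<close>

lemma matrix_repI:
  assumes "group G"
    and c: "\<And>g. g \<in> carrier G \<Longrightarrow> \<rho> g \<in> carrier_mat d d"
    and m: "\<And>g h. g \<in> carrier G \<Longrightarrow> h \<in> carrier G \<Longrightarrow> \<rho> (g \<otimes>\<^bsub>G\<^esub> h) = \<rho> g * \<rho> h"
    and o: "\<rho> \<one>\<^bsub>G\<^esub> = 1\<^sub>m d"
  shows "matrix_rep G d \<rho>"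
proof -
  interpret G: group G by fact
  have "\<rho> g \<in> Units (ring_mat TYPE(complex) d ())" if g: "g \<in> carrier G" for g
  proof -
    have "\<rho> g * \<rho> (inv\<^bsub>G\<^esub> g) = 1\<^sub>m d" "\<rho> (inv\<^bsub>G\<^esub> g) * \<rho> g = 1\<^sub>m d"
      using m[of g "inv\<^bsub>G\<^esub> g"] m[of "inv\<^bsub>G\<^esub> g" g] g o by simp_all
    then show ?thesis using c[OF g] c[of "inv\<^bsub>G\<^esub> g"] g by (auto simp: Units_def ring_mat_simps)
  qed
  then show ?thesis using m
    by (auto simp: matrix_rep_def hom_def units_of_def ring_mat_simps)
qed

lemma character_conj:
  assumes "group G" "matrix_rep G d \<rho>" and g: "g \<in> carrier G" and h: "h \<in> carrier G"
  shows "character G \<rho> (h \<otimes>\<^bsub>G\<^esub> g \<otimes>\<^bsub>G\<^esub> inv\<^bsub>G\<^esub> h) = character G \<rho> g"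
proof -
  interpret G: group G by fact
  note c = matrix_rep_carrier[OF assms(2)] and m = matrix_rep_mult[OF assms(2)]
  have "trace (\<rho> (h \<otimes>\<^bsub>G\<^esub> g \<otimes>\<^bsub>G\<^esub> inv\<^bsub>G\<^esub> h)) = trace (\<rho> h * (\<rho> g * \<rho> (inv\<^bsub>G\<^esub> h)))"
    using g h by (simp add: m[symmetric] G.m_assoc)
  also have "\<dots> = trace ((\<rho> g * \<rho> (inv\<^bsub>G\<^esub> h)) * \<rho> h)"
    using c[OF h] mult_carrier_mat[OF c[OF g] c[OF G.inv_closed[OF h]]] by (rule trace_mult_commute)
  also have "\<dots> = trace (\<rho> g)"
    using g h by (simp add: m[symmetric] G.m_assoc)
  finally show ?thesis using g h by (simp add: character_def)
qed

text \<open>Schur's lemma: kernel and image of an intertwiner are invariant subspaces.\<close>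

lemma intertwiner_zero_or_invertible:
  assumes \<rho>: "irreducible_rep G d \<rho>" and \<sigma>: "irreducible_rep G e \<sigma>"
    and A: "A \<in> carrier_mat d e"
    and comm: "\<And>g. g \<in> carrier G \<Longrightarrow> \<rho> g * A = A * \<sigma> g"
    and nz: "A \<noteq> 0\<^sub>m d e"
  shows "\<exists>B\<in>carrier_mat e d. A * B = 1\<^sub>m d \<and> B * A = 1\<^sub>m e"
proof -
  note cr = matrix_rep_carrier[of G d \<rho>] and cs = matrix_rep_carrier[of G e \<sigma>]
  have rr: "matrix_rep G d \<rho>" "matrix_rep G e \<sigma>"
    using \<rho> \<sigma> by (auto simp: irreducible_rep_def)
  have cv: "\<rho> g *\<^sub>v (A *\<^sub>v v) = A *\<^sub>v (\<sigma> g *\<^sub>v v)" if "g \<in> carrier G" "v \<in> carrier_vec e" for g v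
    using that comm[OF that(1)] A cr[OF rr(1) that(1)] cs[OF rr(2) that(1)]
    by (metis assoc_mult_mat_vec)
  let ?K = "{v \<in> carrier_vec e. A *\<^sub>v v = 0\<^sub>v d}"
  let ?I = "(\<lambda>v. A *\<^sub>v v) ` carrier_vec e"
  have Av: "\<exists>v\<in>carrier_vec e. A *\<^sub>v v \<noteq> 0\<^sub>v d"
  proof (rule ccontr)
    assume *: "\<not> ?thesis"
    have "A = 0\<^sub>m d e"
    proof (rule eq_matI)
      fix i j assume ij: "i < dim_row (0\<^sub>m d e)" "j < dim_col (0\<^sub>m d e)"
      then have "(A *\<^sub>v unit_vec e j) $ i = 0" using * by auto
      then show "A $$ (i, j) = 0\<^sub>m d e $$ (i, j)" using ij A by auto
    qed (use A in auto)
    with nz show False by blast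
  qed
  have "VectorSpace.subspace class_ring ?K (module_vec TYPE(complex) e)"
    unfolding subspace_module_vec_iff using A
    by (auto simp: mult_add_distrib_mat_vec[OF A] mult_mat_vec[OF A])
  moreover have "\<forall>g\<in>carrier G. \<forall>v\<in>?K. \<sigma> g *\<^sub>v v \<in> ?K"
  proof (intro ballI)
    fix g v assume g: "g \<in> carrier G" and v: "v \<in> ?K"
    have "A *\<^sub>v (\<sigma> g *\<^sub>v v) = \<rho> g *\<^sub>v 0\<^sub>v d" using cv[OF g, of v] v by auto
    also have "\<dots> = 0\<^sub>v d" using cr[OF rr(1) g] by auto
    finally show "\<sigma> g *\<^sub>v v \<in> ?K" using cs[OF rr(2) g] v by auto
  qed
  ultimately have "?K = {0\<^sub>v e} \<or> ?K = carrier_vec e"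
    using \<sigma> unfolding irreducible_rep_def by blast
  then have K: "?K = {0\<^sub>v e}" using Av by auto
  have "VectorSpace.subspace class_ring ?I (module_vec TYPE(complex) d)"
    unfolding subspace_module_vec_iff
  proof (intro conjI ballI allI)
    show "?I \<subseteq> carrier_vec d" using A by auto
    show "0\<^sub>v d \<in> ?I" using A by (intro image_eqI[of _ _ "0\<^sub>v e"]) auto
    fix v assume v: "v \<in> ?I"
    then obtain v' where v': "v' \<in> carrier_vec e" "v = A *\<^sub>v v'" by auto
    show "v + w \<in> ?I" if w: "w \<in> ?I" for w
    proof -
      obtain w' where "w' \<in> carrier_vec e" "w = A *\<^sub>v w'" using w by blast
      then show ?thesis using v' A
        by (intro image_eqI[of _ _ "v' + w'"]) (auto simp: mult_add_distrib_mat_vec[OF A])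
    qed
    show "c \<cdot>\<^sub>v v \<in> ?I" for c
      using v' A by (intro image_eqI[of _ _ "c \<cdot>\<^sub>v v'"]) (auto simp: mult_mat_vec[OF A])
  qed
  moreover have "\<forall>g\<in>carrier G. \<forall>v\<in>?I. \<rho> g *\<^sub>v v \<in> ?I"
    using cv cs[OF rr(2)] by (force intro: mult_mat_vec_carrier)
  ultimately have "?I = {0\<^sub>v d} \<or> ?I = carrier_vec d"
    using \<rho> unfolding irreducible_rep_def by blast
  then have I: "?I = carrier_vec d" using Av by blast
  \<comment> \<open>By surjectivity every unit vector has a preimage; these preimages become the
    columns of the right inverse \<open>B\<close>.\<close>
  have "\<exists>b\<in>carrier_vec e. A *\<^sub>v b = unit_vec d j" for j
    using I by (metis (no_types, lifting) imageE unit_vec_carrier)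
  then obtain b where b: "\<And>j. b j \<in> carrier_vec e" "\<And>j. A *\<^sub>v b j = unit_vec d j"
    by metis
  define B where "B = mat e d (\<lambda>(i, j). b j $ i)"
  have B: "B \<in> carrier_mat e d" by (simp add: B_def)
  have colB: "col B j = b j" if "j < d" for j
    using that b(1)[of j] by (intro eq_vecI) (auto simp: B_def)
  have AB: "A * B = 1\<^sub>m d"
  proof (rule eq_matI)
    fix i j assume ij: "i < dim_row (1\<^sub>m d)" "j < dim_col (1\<^sub>m d)"
    then have "(A * B) $$ (i, j) = (A *\<^sub>v b j) $ i"
      using A B colB[of j] by auto
    then show "(A * B) $$ (i, j) = 1\<^sub>m d $$ (i, j)" using ij b(2)[of j] by auto
  qed (use A B in auto)
  have "B * A = 1\<^sub>m e"
  proof (rule eq_matI)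
    fix i j assume ij: "i < dim_row (1\<^sub>m e)" "j < dim_col (1\<^sub>m e)"
    let ?u = "unit_vec e j :: complex vec"
    \<comment> \<open>\<open>A * B = 1\<close> puts B(A u) - u into the kernel of \<open>A\<close>,
      which is trivial; hence \<open>B\<close> is a left inverse too.\<close>
    let ?v = "B *\<^sub>v (A *\<^sub>v ?u) + (- 1) \<cdot>\<^sub>v ?u"
    have "A *\<^sub>v ?v = A *\<^sub>v (B *\<^sub>v (A *\<^sub>v ?u)) + (- 1) \<cdot>\<^sub>v (A *\<^sub>v ?u)"
      using A B by (simp add: mult_add_distrib_mat_vec[OF A] mult_mat_vec[OF A])
    also have "A *\<^sub>v (B *\<^sub>v (A *\<^sub>v ?u)) = A *\<^sub>v ?u"
      using A B unfolding assoc_mult_mat_vec[OF A B mult_mat_vec_carrier[OF A unit_vec_carrier], symmetric] AB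
      by simp
    finally have "A *\<^sub>v ?v = 0\<^sub>v d" using A by auto
    then have "?v \<in> ?K" using A B by auto
    then have "?v $ i = 0" using K ij by auto
    then have "(B *\<^sub>v (A *\<^sub>v ?u)) $ i = ?u $ i" using A B ij by auto
    moreover have "B *\<^sub>v (A *\<^sub>v ?u) = (B * A) *\<^sub>v ?u"
      using A B by (intro assoc_mult_mat_vec[symmetric]) auto
    moreover have "((B * A) *\<^sub>v ?u) $ i = (B * A) $$ (i, j)"
      using mult_carrier_mat[OF B A] ij by (intro index_mult_mat_unit_vec) auto
    ultimately show "(B * A) $$ (i, j) = 1\<^sub>m e $$ (i, j)" using ij by auto
  qed (use A B in auto)
  with B AB show ?thesis by blast
qed

text \<open>A nonzero intertwiner is invertible and conjugates one representation into the other;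
  cyclicity of the trace then removes it.\<close>

lemma intertwiner_character_eq:
  assumes \<rho>: "irreducible_rep G d \<rho>" and \<sigma>: "irreducible_rep G e \<sigma>"
    and A: "A \<in> carrier_mat d e"
    and comm: "\<And>g. g \<in> carrier G \<Longrightarrow> \<rho> g * A = A * \<sigma> g"
    and nz: "A \<noteq> 0\<^sub>m d e"
  shows "character G \<rho> = character G \<sigma>"
proof -
  obtain B where B: "B \<in> carrier_mat e d" "A * B = 1\<^sub>m d" "B * A = 1\<^sub>m e"
    using intertwiner_zero_or_invertible[OF assms] by blast
  have "trace (\<rho> g) = trace (\<sigma> g)" if g: "g \<in> carrier G" for g
  proof -
    have r: "\<rho> g \<in> carrier_mat d d" "\<sigma> g \<in> carrier_mat e e"
      using g \<rho> \<sigma> matrix_rep_carrier by (auto simp: irreducible_rep_def)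
    have "trace (\<rho> g) = trace ((\<rho> g * A) * B)" using r A B by simp
    also have "\<dots> = trace (B * (\<rho> g * A))"
      using r A B by (intro trace_mult_commute) auto
    also have "B * (\<rho> g * A) = (B * A) * \<sigma> g"
      unfolding comm[OF g] using r A B by (intro assoc_mult_mat[symmetric]) auto
    also have "\<dots> = \<sigma> g" using r B by simp
    finally show ?thesis .
  qed
  then show ?thesis by (auto simp: character_def restrict_def)
qed

text \<open>Algebraic closedness of the complex numbers enters as the existence of an eigenvalue
  \<open>c\<close>: A - c is again an intertwiner but not injective, so it is zero.\<close>

lemma intertwiner_scalar:
  assumes \<rho>: "irreducible_rep G d \<rho>" and A: "A \<in> carrier_mat d d"
    and comm: "\<And>g. g \<in> carrier G \<Longrightarrow> \<rho> g * A = A * \<rho> g"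
  shows "\<exists>c. A = c \<cdot>\<^sub>m 1\<^sub>m d"
proof -
  have "spectrum A \<noteq> {}"
    using A \<rho> by (intro spectrum_non_empty[of _ d]) (auto simp: irreducible_rep_def)
  then obtain c v where v: "v \<in> carrier_vec d" "v \<noteq> 0\<^sub>v d" "A *\<^sub>v v = c \<cdot>\<^sub>v v"
    using A by (auto simp: spectrum_def eigenvalue_def eigenvector_def)
  let ?A = "A + (- c) \<cdot>\<^sub>m 1\<^sub>m d"
  have cA: "?A \<in> carrier_mat d d" using A by simp
  have Av: "?A *\<^sub>v v = 0\<^sub>v d"
    using A v by (auto simp: add_mult_distrib_mat_vec[of A d d])
  have "\<rho> g * ?A = ?A * \<rho> g" if g: "g \<in> carrier G" for g
  proof -
    have r: "\<rho> g \<in> carrier_mat d d"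
      using g \<rho> matrix_rep_carrier by (auto simp: irreducible_rep_def)
    show ?thesis using r A comm[OF g]
      by (simp add: mult_add_distrib_mat[OF r] add_mult_distrib_mat[OF A _ r]
          mult_smult_distrib[OF r one_carrier_mat] mult_smult_assoc_mat[OF one_carrier_mat r])
  qed
  note * = intertwiner_zero_or_invertible[OF \<rho> \<rho> cA this]
  have "?A = 0\<^sub>m d d"
  proof (rule ccontr)
    assume "?A \<noteq> 0\<^sub>m d d"
    with * obtain B where B: "B \<in> carrier_mat d d" "B * ?A = 1\<^sub>m d" by blast
    have "v = (B * ?A) *\<^sub>v v" unfolding B(2) using v by simp
    also have "\<dots> = B *\<^sub>v (?A *\<^sub>v v)" using B(1) cA v(1) by (rule assoc_mult_mat_vec)
    also have "\<dots> = 0\<^sub>v d" using Av B by auto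
    finally show False using v by blast
  qed
  have "A = c \<cdot>\<^sub>m 1\<^sub>m d"
  proof (rule eq_matI)
    fix i j assume "i < dim_row (c \<cdot>\<^sub>m 1\<^sub>m d)" "j < dim_col (c \<cdot>\<^sub>m 1\<^sub>m d)"
    moreover from this have "?A $$ (i, j) = 0" using \<open>?A = 0\<^sub>m d d\<close> by auto
    ultimately show "A $$ (i, j) = (c \<cdot>\<^sub>m 1\<^sub>m d) $$ (i, j)" using A by auto
  qed (use A in auto)
  then show ?thesis by blast
qed

section \<open>Averaging over the group and the orthogonality relations\<close>

lemma sum_group_reindex_left:
  assumes "group G" "h \<in> carrier G"
  shows "(\<Sum>g\<in>carrier G. f (h \<otimes>\<^bsub>G\<^esub> g)) = (\<Sum>g\<in>carrier G. f g)"
proof -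
  interpret G: group G by fact
  show ?thesis
    by (rule sum.reindex_bij_witness
        [of _ "\<lambda>g. inv\<^bsub>G\<^esub> h \<otimes>\<^bsub>G\<^esub> g" "\<lambda>g. h \<otimes>\<^bsub>G\<^esub> g"])
      (use assms in \<open>auto simp: G.m_assoc[symmetric]\<close>)
qed

text \<open>\<open>A\<close> is the sum of \<rho>(g) E \<sigma>(g^-1) over the group, where E is the
  elementary matrix with its entry at \<open>(j, k)\<close>. Shifting the summation variable by
  \<open>h\<close> shows that such a sum intertwines.\<close>

lemma coeff_intertwines:
  fixes \<rho> \<sigma> :: "'g \<Rightarrow> complex mat"
  assumes "group G" and \<rho>: "matrix_rep G d \<rho>" and \<sigma>: "matrix_rep G e \<sigma>"
    and jk: "j < d" "k < e" and h: "h \<in> carrier G"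
  defines "A \<equiv> mat d e (\<lambda>(i, l). \<Sum>g\<in>carrier G. \<rho> g $$ (i, j) * \<sigma> (inv\<^bsub>G\<^esub> g) $$ (k, l))"
  shows "\<rho> h * A = A * \<sigma> h"
proof -
  interpret G: group G by fact
  note c\<rho> = matrix_rep_carrier[OF \<rho>] and c\<sigma> = matrix_rep_carrier[OF \<sigma>]
  have A: "A \<in> carrier_mat d e" by (simp add: A_def)
  show ?thesis
  proof (rule eq_matI)
    fix i l assume il: "i < dim_row (A * \<sigma> h)" "l < dim_col (A * \<sigma> h)"
    then have i: "i < d" and l: "l < e" using A c\<sigma>[OF h] by auto
    have "(\<rho> h * A) $$ (i, l)
        = (\<Sum>p<d. \<Sum>g\<in>carrier G. \<rho> h $$ (i, p) * (\<rho> g $$ (p, j) * \<sigma> (inv\<^bsub>G\<^esub> g) $$ (k, l)))"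
      unfolding index_mult_mat_sum[OF c\<rho>[OF h] A i l]
      using l by (simp add: A_def sum_distrib_left)
    also have "\<dots> = (\<Sum>g\<in>carrier G. (\<rho> h * \<rho> g) $$ (i, j) * \<sigma> (inv\<^bsub>G\<^esub> g) $$ (k, l))"
      by (subst sum.swap, rule sum.cong)
        (simp_all add: index_mult_mat_sum[OF c\<rho>[OF h] c\<rho> i jk(1)] sum_distrib_right mult.assoc
          del: index_mult_mat(1))
    \<comment> \<open>Writing g^-1 as (h g)^-1 h makes g occur only through h g, so that the sum can
      be shifted.\<close>
    also have "\<dots> = (\<Sum>g\<in>carrier G. \<rho> (h \<otimes>\<^bsub>G\<^esub> g) $$ (i, j)
        * \<sigma> (inv\<^bsub>G\<^esub> (h \<otimes>\<^bsub>G\<^esub> g) \<otimes>\<^bsub>G\<^esub> h) $$ (k, l))"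
      using h by (intro sum.cong) (simp_all add: matrix_rep_mult[OF \<rho>] G.inv_mult_group G.m_assoc)
    also have "\<dots> = (\<Sum>g\<in>carrier G. \<rho> g $$ (i, j) * \<sigma> (inv\<^bsub>G\<^esub> g \<otimes>\<^bsub>G\<^esub> h) $$ (k, l))"
      using assms(1) h by (rule sum_group_reindex_left)
    also have "\<dots> = (\<Sum>g\<in>carrier G. \<Sum>p<e. \<rho> g $$ (i, j) * (\<sigma> (inv\<^bsub>G\<^esub> g) $$ (k, p) * \<sigma> h $$ (p, l)))"
      by (rule sum.cong)
        (simp_all add: matrix_rep_mult[OF \<sigma> _ h] index_mult_mat_sum[OF c\<sigma> c\<sigma>[OF h] jk(2) l]
          sum_distrib_left del: index_mult_mat(1))
    also have "\<dots> = (A * \<sigma> h) $$ (i, l)"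
      unfolding index_mult_mat_sum[OF A c\<sigma>[OF h] i l]
      using i by (subst sum.swap) (simp add: A_def sum_distrib_right mult.assoc)
    finally show "(\<rho> h * A) $$ (i, l) = (A * \<sigma> h) $$ (i, l)" .
  qed (use A c\<rho>[OF h] c\<sigma>[OF h] in auto)
qed

lemma sum_character_prod:
  assumes "group G" and \<rho>: "matrix_rep G d \<rho>" and \<sigma>: "matrix_rep G e \<sigma>"
  shows "(\<Sum>g\<in>carrier G. character G \<rho> g * character G \<sigma> (inv\<^bsub>G\<^esub> g))
    = (\<Sum>i<d. \<Sum>k<e. \<Sum>g\<in>carrier G. \<rho> g $$ (i, i) * \<sigma> (inv\<^bsub>G\<^esub> g) $$ (k, k))"
proof -
  interpret G: group G by fact
  have "(\<Sum>g\<in>carrier G. character G \<rho> g * character G \<sigma> (inv\<^bsub>G\<^esub> g))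
    = (\<Sum>g\<in>carrier G. \<Sum>i<d. \<Sum>k<e. \<rho> g $$ (i, i) * \<sigma> (inv\<^bsub>G\<^esub> g) $$ (k, k))"
    by (rule sum.cong)
      (simp_all add: character_def trace_carrier_mat[OF matrix_rep_carrier[OF \<rho>]]
        trace_carrier_mat[OF matrix_rep_carrier[OF \<sigma>]] sum_product)
  also have "\<dots> = (\<Sum>i<d. \<Sum>g\<in>carrier G. \<Sum>k<e. \<rho> g $$ (i, i) * \<sigma> (inv\<^bsub>G\<^esub> g) $$ (k, k))"
    by (rule sum.swap)
  also have "\<dots> = (\<Sum>i<d. \<Sum>k<e. \<Sum>g\<in>carrier G. \<rho> g $$ (i, i) * \<sigma> (inv\<^bsub>G\<^esub> g) $$ (k, k))"
    by (rule sum.cong[OF refl sum.swap])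
  finally show ?thesis .
qed

text \<open>By Schur's lemma every averaged elementary matrix vanishes. The character sum collects,
  for the elementary matrix at \<open>(i, k)\<close>, the entry at \<open>(i, k)\<close>.\<close>

lemma character_orthogonal_distinct:
  assumes "group G" and \<rho>: "irreducible_rep G d \<rho>" and \<sigma>: "irreducible_rep G e \<sigma>"
    and ne: "character G \<rho> \<noteq> character G \<sigma>"
  shows "(\<Sum>g\<in>carrier G. character G \<rho> g * character G \<sigma> (inv\<^bsub>G\<^esub> g)) = 0"
proof -
  have r: "matrix_rep G d \<rho>" "matrix_rep G e \<sigma>" using \<rho> \<sigma> by (auto simp: irreducible_rep_def)
  have "(\<Sum>g\<in>carrier G. \<rho> g $$ (i, i) * \<sigma> (inv\<^bsub>G\<^esub> g) $$ (k, k)) = 0" if "i < d" "k < e" for i k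
  proof -
    let ?A = "mat d e (\<lambda>(i', l). \<Sum>g\<in>carrier G. \<rho> g $$ (i', i) * \<sigma> (inv\<^bsub>G\<^esub> g) $$ (k, l))"
    have "?A = 0\<^sub>m d e"
    proof (rule ccontr)
      assume "?A \<noteq> 0\<^sub>m d e"
      then have "character G \<rho> = character G \<sigma>"
        using coeff_intertwines[OF assms(1) r that] by (intro intertwiner_character_eq[OF \<rho> \<sigma>]) auto
      with ne show False by blast
    qed
    then have "?A $$ (i, k) = 0" using that by simp
    then show ?thesis using that by simp
  qed
  then show ?thesis unfolding sum_character_prod[OF assms(1) r] by simp
qed

text \<open>The averaged elementary matrix is now a scalar \<open>a\<close>. Its trace, computed
  through \<rho>(g^-1) \<rho>(g) = 1, shows that \<open>a * d\<close> is the group order or 0; the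
  \<open>d\<close> diagonal terms then add up to the group order.\<close>

lemma character_orthogonal_same:
  assumes "group G" and \<rho>: "irreducible_rep G d \<rho>"
  shows "(\<Sum>g\<in>carrier G. character G \<rho> g * character G \<rho> (inv\<^bsub>G\<^esub> g)) = of_nat (card (carrier G))"
proof -
  interpret G: group G by fact
  have r: "matrix_rep G d \<rho>" and d: "0 < d" using \<rho> by (auto simp: irreducible_rep_def)
  note c = matrix_rep_carrier[OF r]
  have "(\<Sum>g\<in>carrier G. \<rho> g $$ (i, i) * \<rho> (inv\<^bsub>G\<^esub> g) $$ (k, k))
      = (if i = k then of_nat (card (carrier G)) / of_nat d else 0)" if ik: "i < d" "k < d" for i k
  proof -
    let ?A = "mat d d (\<lambda>(i', l). \<Sum>g\<in>carrier G. \<rho> g $$ (i', i) * \<rho> (inv\<^bsub>G\<^esub> g) $$ (k, l))"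
    obtain a where a: "?A = a \<cdot>\<^sub>m 1\<^sub>m d"
      using intertwiner_scalar[OF \<rho>, of ?A] coeff_intertwines[OF assms(1) r r ik] by auto
    have "a * of_nat d = trace ?A"
      unfolding a by (simp add: trace_def)
    also have "\<dots> = (\<Sum>g\<in>carrier G. \<Sum>p<d. \<rho> g $$ (p, i) * \<rho> (inv\<^bsub>G\<^esub> g) $$ (k, p))"
      by (subst sum.swap) (simp add: trace_def)
    also have "\<dots> = (\<Sum>g\<in>carrier G. (\<rho> (inv\<^bsub>G\<^esub> g) * \<rho> g) $$ (k, i))"
      by (rule sum.cong)
        (simp_all add: index_mult_mat_sum[OF c c that(2,1)] mult.commute del: index_mult_mat(1))
    also have "\<dots> = (\<Sum>g\<in>carrier G. 1\<^sub>m d $$ (k, i))"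
      by (rule sum.cong)
        (simp_all add: matrix_rep_mult[OF r, symmetric] matrix_rep_one[OF assms(1) r])
    also have "\<dots> = (if i = k then of_nat (card (carrier G)) else 0)"
      using that by simp
    finally have "a = (if i = k then of_nat (card (carrier G)) / of_nat d else 0)"
      using d by (simp add: field_simps split: if_splits)
    moreover have "?A $$ (i, k) = (a \<cdot>\<^sub>m 1\<^sub>m d) $$ (i, k)" using a by simp
    ultimately show ?thesis using that by simp
  qed
  then have "(\<Sum>g\<in>carrier G. character G \<rho> g * character G \<rho> (inv\<^bsub>G\<^esub> g))
      = (\<Sum>i<d. \<Sum>k<d. if i = k then of_nat (card (carrier G)) / of_nat d else 0)"
    unfolding sum_character_prod[OF assms(1) r r] by simp
  also have "\<dots> = of_nat (card (carrier G))" using d by simp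
  finally show ?thesis .
qed

lemma irr_chars_orthogonal:
  assumes "group G" "\<chi> \<in> irr_chars G" "\<psi> \<in> irr_chars G"
  shows "(\<Sum>g\<in>carrier G. \<chi> g * \<psi> (inv\<^bsub>G\<^esub> g)) = (if \<chi> = \<psi> then of_nat (card (carrier G)) else 0)"
proof -
  obtain d \<rho> e \<sigma> where *: "irreducible_rep G d \<rho>" "\<chi> = character G \<rho>"
    "irreducible_rep G e \<sigma>" "\<psi> = character G \<sigma>"
    using assms(2,3) by (auto simp: irr_chars_def)
  show ?thesis
    using character_orthogonal_distinct[OF assms(1) *(1,3)] character_orthogonal_same[OF assms(1) *(1)]
    unfolding *(2,4) by auto
qed

section \<open>Class functions, completeness of a list of irreducible characters,
  coefficients\<close>

definition class_function :: "('a, 'b) monoid_scheme \<Rightarrow> ('a \<Rightarrow> 'c) \<Rightarrow> bool" where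
  "class_function G f \<longleftrightarrow>
    (\<forall>g\<in>carrier G. \<forall>h\<in>carrier G. f (h \<otimes>\<^bsub>G\<^esub> g \<otimes>\<^bsub>G\<^esub> inv\<^bsub>G\<^esub> h) = f g)"

lemma class_function_irr_chars: "group G \<Longrightarrow> \<chi> \<in> irr_chars G \<Longrightarrow> class_function G \<chi>"
  by (auto simp: irr_chars_def class_function_def irreducible_rep_def intro!: character_conj)

text \<open>An irreducible \<psi> outside \<open>X\<close> would be a combination of members of
  \<open>X\<close> and orthogonal to each of them, so its pairing with itself would be 0 instead of
  the group order.\<close>

lemma irr_chars_eqI:
  assumes "group G" "finite (carrier G)" and X: "X \<subseteq> irr_chars G" "finite X"
    and span: "\<And>f. class_function G f \<Longrightarrow>
      \<exists>a. \<forall>w\<in>carrier G. f w = (\<Sum>\<chi>\<in>X. a \<chi> * \<chi> w)"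
  shows "irr_chars G = X"
proof (rule ccontr)
  interpret G: group G by fact
  assume "irr_chars G \<noteq> X"
  then obtain \<psi> where \<psi>: "\<psi> \<in> irr_chars G" "\<psi> \<notin> X" using X by blast
  obtain a where a: "\<forall>w\<in>carrier G. \<psi> w = (\<Sum>\<chi>\<in>X. a \<chi> * \<chi> w)"
    using span[OF class_function_irr_chars[OF assms(1) \<psi>(1)]] by blast
  have "of_nat (card (carrier G)) = (\<Sum>g\<in>carrier G. \<psi> g * \<psi> (inv\<^bsub>G\<^esub> g))"
    using irr_chars_orthogonal[OF assms(1) \<psi>(1) \<psi>(1)] by simp
  also have "\<dots> = (\<Sum>g\<in>carrier G. \<Sum>\<chi>\<in>X. a \<chi> * (\<chi> g * \<psi> (inv\<^bsub>G\<^esub> g)))"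
    using a by (simp add: sum_distrib_right mult.assoc)
  also have "\<dots> = (\<Sum>\<chi>\<in>X. a \<chi> * (\<Sum>g\<in>carrier G. \<chi> g * \<psi> (inv\<^bsub>G\<^esub> g)))"
    by (subst sum.swap) (simp add: sum_distrib_left)
  also have "\<dots> = 0"
  proof (intro sum.neutral ballI)
    fix \<chi> assume "\<chi> \<in> X"
    then have "\<chi> \<in> irr_chars G" "\<chi> \<noteq> \<psi>" using X \<psi> by auto
    then show "a \<chi> * (\<Sum>g\<in>carrier G. \<chi> g * \<psi> (inv\<^bsub>G\<^esub> g)) = 0"
      using irr_chars_orthogonal[OF assms(1) _ \<psi>(1)] by simp
  qed
  finally have "card (carrier G) = 0" by simp
  then show False using assms(2) G.one_closed by auto
qed

text \<open>Resolves the definite description in \<open>char_coeffs\<close>: \<open>ex\<close>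
  provides an expansion, pairing any expansion with \<psi> isolates its coefficient at \<psi>, and
  \<open>extensional\<close> fixes the values outside \<open>irr_chars G\<close>.\<close>

lemma char_coeffs_eq:
  assumes "group G" "finite (carrier G)" "finite (irr_chars G)"
    and ex: "\<exists>a. \<forall>w\<in>carrier G. f w = (\<Sum>\<chi>\<in>irr_chars G. a \<chi> * \<chi> w)"
    and \<chi>: "\<chi> \<in> irr_chars G"
  shows "char_coeffs G f \<chi>
    = (\<Sum>g\<in>carrier G. f g * \<chi> (inv\<^bsub>G\<^esub> g)) / of_nat (card (carrier G))"
proof -
  interpret G: group G by fact
  have nz: "card (carrier G) \<noteq> 0" using assms(2) G.one_closed by auto
  define b where "b = (\<lambda>\<chi>\<in>irr_chars G.
    (\<Sum>g\<in>carrier G. f g * \<chi> (inv\<^bsub>G\<^esub> g)) / of_nat (card (carrier G)))"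
  have b_ext: "b \<in> extensional (irr_chars G)" by (simp add: b_def)
  have uniq: "a \<psi> = b \<psi>"
    if a: "\<forall>w\<in>carrier G. f w = (\<Sum>\<chi>\<in>irr_chars G. a \<chi> * \<chi> w)" and \<psi>: "\<psi> \<in> irr_chars G" for a \<psi>
  proof -
    have "(\<Sum>g\<in>carrier G. f g * \<psi> (inv\<^bsub>G\<^esub> g))
        = (\<Sum>g\<in>carrier G. \<Sum>\<chi>\<in>irr_chars G. a \<chi> * (\<chi> g * \<psi> (inv\<^bsub>G\<^esub> g)))"
      using a by (simp add: sum_distrib_right mult.assoc)
    also have "\<dots> = (\<Sum>\<chi>\<in>irr_chars G. a \<chi> * (\<Sum>g\<in>carrier G. \<chi> g * \<psi> (inv\<^bsub>G\<^esub> g)))"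
      by (subst sum.swap) (simp add: sum_distrib_left)
    also have "\<dots> = (\<Sum>\<chi>\<in>irr_chars G. if \<chi> = \<psi> then a \<psi> * of_nat (card (carrier G)) else 0)"
      using \<psi> irr_chars_orthogonal[OF assms(1) _ \<psi>] by (intro sum.cong) auto
    also have "\<dots> = a \<psi> * of_nat (card (carrier G))"
      using \<psi> assms(3) by simp
    finally show ?thesis using nz \<psi> by (simp add: b_def)
  qed
  obtain a where a: "\<forall>w\<in>carrier G. f w = (\<Sum>\<chi>\<in>irr_chars G. a \<chi> * \<chi> w)" using ex by blast
  have "char_coeffs G f = b"
    unfolding char_coeffs_def
  proof (rule the_equality)
    have "\<forall>w\<in>carrier G. f w = (\<Sum>\<chi>\<in>irr_chars G. b \<chi> * \<chi> w)"
      using a uniq[OF a] by simp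
    then show "b \<in> extensional (irr_chars G) \<and>
        (\<forall>w\<in>carrier G. f w = (\<Sum>\<chi>\<in>irr_chars G. b \<chi> * \<chi> w))"
      using b_ext by blast
  next
    fix a assume "a \<in> extensional (irr_chars G) \<and>
        (\<forall>w\<in>carrier G. f w = (\<Sum>\<chi>\<in>irr_chars G. a \<chi> * \<chi> w))"
    then show "a = b" using uniq b_ext
      by (intro extensionalityI[of a "irr_chars G" b]) blast+
  qed
  then show ?thesis using \<chi> by (simp add: b_def)
qed

lemma word_eval_conj:
  assumes "group G" and g: "g \<in> {1..r} \<rightarrow> carrier G" and h: "h \<in> carrier G"
    and w: "set w \<subseteq> {1..r} \<times> UNIV"
    and g': "\<And>i. i \<in> {1..r} \<Longrightarrow> g' i = h \<otimes>\<^bsub>G\<^esub> g i \<otimes>\<^bsub>G\<^esub> inv\<^bsub>G\<^esub> h"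
  shows "word_eval G g' w = h \<otimes>\<^bsub>G\<^esub> word_eval G g w \<otimes>\<^bsub>G\<^esub> inv\<^bsub>G\<^esub> h"
proof -
  interpret G: group G by fact
  from w show ?thesis
  proof (induction w)
    case Nil
    then show ?case using h by (simp add: word_eval_def)
  next
    case (Cons l w)
    have l: "fst l \<in> {1..r}" and wc: "word_eval G g w \<in> carrier G"
      using Cons.prems G.word_eval_closed[OF g] by (auto simp: mem_Times_iff)
    have gl: "g (fst l) \<in> carrier G" using g l by auto
    have cancel: "inv\<^bsub>G\<^esub> h \<otimes>\<^bsub>G\<^esub> (h \<otimes>\<^bsub>G\<^esub> x) = x" if "x \<in> carrier G" for x
      using that h by (simp add: G.m_assoc[symmetric])
    have le: "letter_eval G g' l = h \<otimes>\<^bsub>G\<^esub> letter_eval G g l \<otimes>\<^bsub>G\<^esub> inv\<^bsub>G\<^esub> h"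
      using g'[OF l] gl h by (simp add: letter_eval_def G.inv_mult_group G.m_assoc)
    have lc: "letter_eval G g l \<in> carrier G" using gl by (simp add: letter_eval_def)
    have "word_eval G g' (l # w) = letter_eval G g' l \<otimes>\<^bsub>G\<^esub> word_eval G g' w"
      by (simp add: word_eval_def)
    also have "\<dots> = h \<otimes>\<^bsub>G\<^esub> (letter_eval G g l \<otimes>\<^bsub>G\<^esub> word_eval G g w) \<otimes>\<^bsub>G\<^esub> inv\<^bsub>G\<^esub> h"
      using Cons lc wc h by (simp add: le G.m_assoc cancel)
    finally show ?case by (simp add: word_eval_def)
  qed
qed

text \<open>Conjugating all entries of a tuple by \<open>h\<close> maps the solutions for the value
  x onto those for h x h^-1; conjugation by the inverse of \<open>h\<close> undoes it.\<close>

lemma class_function_word_count: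
  assumes "group G" and w: "set \<gamma> \<subseteq> {1..r} \<times> UNIV"
  shows "class_function G (word_count G r \<gamma>)"
  unfolding class_function_def
proof (intro ballI)
  interpret G: group G by fact
  fix x h assume x: "x \<in> carrier G" and h: "h \<in> carrier G"
  \<comment> \<open>The restriction keeps conjugated tuples extensional, as the tuples in
    \<open>word_count\<close> are.\<close>
  let ?c = "\<lambda>h g. (\<lambda>i\<in>{1..r}. h \<otimes>\<^bsub>G\<^esub> g i \<otimes>\<^bsub>G\<^esub> inv\<^bsub>G\<^esub> h)"
  let ?S = "\<lambda>x. {g \<in> {1..r} \<rightarrow>\<^sub>E carrier G. word_eval G g \<gamma> = x}"
  have cl: "?c h g \<in> ?S (h \<otimes>\<^bsub>G\<^esub> x \<otimes>\<^bsub>G\<^esub> inv\<^bsub>G\<^esub> h)"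
    if h: "h \<in> carrier G" and g: "g \<in> ?S x" for h g x
  proof -
    have "word_eval G (?c h g) \<gamma> = h \<otimes>\<^bsub>G\<^esub> word_eval G g \<gamma> \<otimes>\<^bsub>G\<^esub> inv\<^bsub>G\<^esub> h"
      by (rule word_eval_conj[OF assms(1) _ h w]) (use g in auto)
    then show ?thesis using g h by (auto simp: PiE_iff)
  qed
  have cc: "?c h (?c (inv\<^bsub>G\<^esub> h) g) = g" "?c (inv\<^bsub>G\<^esub> h) (?c h g) = g"
    if h: "h \<in> carrier G" and g: "g \<in> {1..r} \<rightarrow>\<^sub>E carrier G" for h g
  proof -
    have cancel: "inv\<^bsub>G\<^esub> h \<otimes>\<^bsub>G\<^esub> (h \<otimes>\<^bsub>G\<^esub> x) = x" "h \<otimes>\<^bsub>G\<^esub> (inv\<^bsub>G\<^esub> h \<otimes>\<^bsub>G\<^esub> x) = x"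
      if "x \<in> carrier G" for x
      using that h by (simp_all add: G.m_assoc[symmetric])
    show "?c h (?c (inv\<^bsub>G\<^esub> h) g) = g" "?c (inv\<^bsub>G\<^esub> h) (?c h g) = g"
      using g h by (auto simp: fun_eq_iff PiE_iff extensional_def G.m_assoc cancel)
  qed
  have "bij_betw (?c h) (?S x) (?S (h \<otimes>\<^bsub>G\<^esub> x \<otimes>\<^bsub>G\<^esub> inv\<^bsub>G\<^esub> h))"
  proof (rule bij_betw_byWitness[of _ "?c (inv\<^bsub>G\<^esub> h)"])
    show "\<forall>g\<in>?S x. ?c (inv\<^bsub>G\<^esub> h) (?c h g) = g" using cc[OF h] by auto
    show "\<forall>g\<in>?S (h \<otimes>\<^bsub>G\<^esub> x \<otimes>\<^bsub>G\<^esub> inv\<^bsub>G\<^esub> h). ?c h (?c (inv\<^bsub>G\<^esub> h) g) = g" using cc[OF h] by auto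
    show "?c h ` ?S x \<subseteq> ?S (h \<otimes>\<^bsub>G\<^esub> x \<otimes>\<^bsub>G\<^esub> inv\<^bsub>G\<^esub> h)" using cl[OF h] by blast
    have "inv\<^bsub>G\<^esub> h \<otimes>\<^bsub>G\<^esub> (h \<otimes>\<^bsub>G\<^esub> x \<otimes>\<^bsub>G\<^esub> inv\<^bsub>G\<^esub> h) \<otimes>\<^bsub>G\<^esub> inv\<^bsub>G\<^esub> (inv\<^bsub>G\<^esub> h) = x"
      using x h by (simp add: G.m_assoc[symmetric]) (simp add: G.m_assoc)
    then show "?c (inv\<^bsub>G\<^esub> h) ` ?S (h \<otimes>\<^bsub>G\<^esub> x \<otimes>\<^bsub>G\<^esub> inv\<^bsub>G\<^esub> h) \<subseteq> ?S x"
      using cl[OF G.inv_closed[OF h], of _ "h \<otimes>\<^bsub>G\<^esub> x \<otimes>\<^bsub>G\<^esub> inv\<^bsub>G\<^esub> h"] by (simp only:) blast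
  qed
  then show "word_count G r \<gamma> (h \<otimes>\<^bsub>G\<^esub> x \<otimes>\<^bsub>G\<^esub> inv\<^bsub>G\<^esub> h) = word_count G r \<gamma> x"
    unfolding word_count_def by (rule bij_betw_same_card[symmetric])
qed

section \<open>Conjugacy classes of the symmetric group\<close>

text \<open>The orbit is a single cycle whose length is its cardinality. The criterion depends on
  that size alone, so coincidences between iterates can be carried to an equally long orbit of
  another permutation.\<close>

lemma funpow_eq_iff_mod_card_orbit:
  assumes "x \<in> orbit f x"
  shows "(f ^^ a) x = (f ^^ b) x \<longleftrightarrow> a mod card (orbit f x) = b mod card (orbit f x)"
proof -
  let ?p = "funpow_dist1 f x x"
  have inj: "inj_on (\<lambda>n. (f ^^ n) x) {0..<?p}" by (rule inj_on_funpow_dist1[OF assms])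
  have p: "card (orbit f x) = ?p"
    unfolding orbit_conv_funpow_dist1[OF assms] using card_image[OF inj] by simp
  have "(f ^^ (m mod ?p)) x = (f ^^ m) x" for m
    by (rule funpow_mod_eq[OF funpow_dist1_prop[OF assms]])
  then have "(f ^^ a) x = (f ^^ b) x \<longleftrightarrow> (f ^^ (a mod ?p)) x = (f ^^ (b mod ?p)) x" by simp
  also have "\<dots> \<longleftrightarrow> a mod ?p = b mod ?p"
    using inj by (intro inj_on_eq_iff[OF inj]) auto
  finally show ?thesis unfolding p .
qed

text \<open>Any bijection between the two sets reduces the claim to one set, where functions with
  equal image multisets differ by a permutation.\<close>

lemma image_mset_eq_obtain_bij:
  assumes "finite A" "finite B" and eq: "image_mset f (mset_set A) = image_mset g (mset_set B)"
  obtains h where "bij_betw h A B" "\<And>x. x \<in> A \<Longrightarrow> g (h x) = f x"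
proof -
  have "card A = card B" using arg_cong[OF eq, of size] by simp
  then obtain b where b: "bij_betw b A B" using finite_same_card_bij assms(1,2) by blast
  have "mset_set B = image_mset b (mset_set A)"
    using image_mset_mset_set[OF bij_betw_imp_inj_on[OF b]] bij_betw_imp_surj_on[OF b] by simp
  then have "image_mset f (mset_set A) = image_mset (\<lambda>x. g (b x)) (mset_set A)"
    by (simp add: eq multiset.map_comp comp_def)
  then obtain p where p: "p permutes A" "\<forall>x\<in>A. f x = g (b (p x))"
    using image_mset_eq_implies_permutes[OF assms(1)] by metis
  show ?thesis
    by (rule that[of "\<lambda>x. b (p x)"])
      (use bij_betw_trans[OF permutes_imp_bij[OF p(1)] b] p(2) in \<open>auto simp: comp_def\<close>)
qed

text \<open>Orbits of equal size are matched, a base point is chosen in each, and \<open>u\<close>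
  sends the k-th iterate of a base point under \<open>w\<close> to the k-th iterate of the matched
  base point under \<open>w'\<close>.\<close>

lemma card_orbits_eq_imp_conj:
  assumes "finite S" and w: "w permutes S" and w': "w' permutes S"
    and eq: "image_mset card (mset_set (orbit w ` S)) = image_mset card (mset_set (orbit w' ` S))"
  shows "\<exists>u. u permutes S \<and> w' = u \<circ> w \<circ> inv' u"
proof -
  have perm: "permutation w" "permutation w'"
    using assms by (auto simp: permutation_permutes)
  have self: "x \<in> orbit w x" "x \<in> orbit w' x" for x
    using perm by (auto intro: permutation_self_in_orbit)
  have orb_eq: "orbit w y = orbit w x" if "y \<in> orbit w x" for x y
    using cyclic_on_orbit'[OF perm(1), of x] that orbit_cyclic_eq3 by metis
  have orb_eq': "orbit w' y = orbit w' x" if "y \<in> orbit w' x" for x y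
    using cyclic_on_orbit'[OF perm(2), of x] that orbit_cyclic_eq3 by metis
  obtain h where h: "bij_betw h (orbit w ` S) (orbit w' ` S)"
    "\<And>A. A \<in> orbit w ` S \<Longrightarrow> card (h A) = card A"
    using image_mset_eq_obtain_bij[OF _ _ eq] assms(1) by blast
  \<comment> \<open>The base point is chosen from the orbit as a set, so that all points of one
    orbit share the values \<open>r\<close> and \<open>r'\<close>.\<close>
  define rep where "rep A = (SOME y. y \<in> A)" for A :: "'a set"
  define r where "r x = rep (orbit w x)" for x
  define r' where "r' x = rep (h (orbit w x))" for x
  have r: "r x \<in> orbit w x" for x unfolding r_def rep_def using self(1)[of x] by (rule someI)
  then have r_orb: "orbit w (r x) = orbit w x" for x by (rule orb_eq)
  have hS: "\<exists>y\<in>S. h (orbit w x) = orbit w' y" if "x \<in> S" for x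
    using bij_betwE[OF h(1)] that by blast
  have r'_orb: "orbit w' (r' x) = h (orbit w x)" and r'S: "r' x \<in> S" if x: "x \<in> S" for x
  proof -
    obtain y where y: "y \<in> S" "h (orbit w x) = orbit w' y" using hS[OF x] by blast
    have "r' x \<in> orbit w' y" unfolding r'_def rep_def y(2) using self(2)[of y] by (rule someI)
    then show "orbit w' (r' x) = h (orbit w x)" "r' x \<in> S"
      using orb_eq' y permutes_orbit_subset[OF w' y(1)] by auto
  qed
  have card_eq: "card (orbit w' (r' x)) = card (orbit w (r x))" if "x \<in> S" for x
    using that by (simp add: r'_orb r_orb h(2))
  have transfer: "(w' ^^ a) (r' x) = (w' ^^ b) (r' x) \<longleftrightarrow> (w ^^ a) (r x) = (w ^^ b) (r x)"
    if "x \<in> S" for x a b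
    using that by (simp add: funpow_eq_iff_mod_card_orbit self card_eq)
  \<comment> \<open>This exponent matters only modulo the orbit length; \<open>transfer\<close>
    makes the image of \<open>x\<close> independent of its choice.\<close>
  define k where "k x = funpow_dist w (r x) x" for x
  have k: "(w ^^ k x) (r x) = x" for x
    unfolding k_def by (rule funpow_dist_prop) (simp add: r_orb self)
  define u where "u x = (if x \<in> S then (w' ^^ k x) (r' x) else x)" for x
  have uS: "u x \<in> S" if "x \<in> S" for x
  proof -
    have "(w' ^^ k x) (r' x) \<in> orbit w' (r' x)" by (rule funpow_in_orbit[OF self(2)])
    then show ?thesis
      using permutes_orbit_subset[OF w' r'S[OF that]] that by (auto simp: u_def)
  qed
  have u_orb: "orbit w' (u x) = h (orbit w x)" if "x \<in> S" for x
    using that orb_eq'[OF funpow_in_orbit[OF self(2)]] r'_orb[OF that] by (simp add: u_def)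
  have "inj_on u S"
  proof (rule inj_onI)
    fix x y assume xy: "x \<in> S" "y \<in> S" "u x = u y"
    then have "h (orbit w x) = h (orbit w y)" using u_orb by metis
    then have o: "orbit w x = orbit w y"
      using bij_betw_imp_inj_on[OF h(1)] xy by (auto dest: inj_onD)
    then have "r x = r y" "r' x = r' y" by (simp_all add: r_def r'_def)
    moreover have "(w' ^^ k x) (r' x) = (w' ^^ k y) (r' y)" using xy by (simp add: u_def)
    ultimately have "(w ^^ k x) (r x) = (w ^^ k y) (r y)" using transfer[OF xy(1)] by simp
    then show "x = y" by (simp add: k)
  qed
  moreover have "u ` S \<subseteq> S" using uS by blast
  ultimately have "bij_betw u S S"
    using assms(1) by (simp add: bij_betw_def endo_inj_surj)
  then have u: "u permutes S" by (rule bij_imp_permutes) (simp add: u_def)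
  have step: "u (w x) = w' (u x)" for x
  proof (cases "x \<in> S")
    case True
    then have wx: "w x \<in> S" using permutes_in_image[OF w] by simp
    have o: "orbit w (w x) = orbit w x" by (rule permutation_orbit_step[OF perm(1)])
    then have rr: "r (w x) = r x" "r' (w x) = r' x" by (simp_all add: r_def r'_def)
    have "(w ^^ k (w x)) (r x) = (w ^^ Suc (k x)) (r x)"
      using k[of "w x"] k[of x] rr by simp
    then have "(w' ^^ k (w x)) (r' x) = (w' ^^ Suc (k x)) (r' x)"
      using transfer[OF True] by blast
    then show ?thesis using True wx rr by (simp add: u_def)
  next
    case False
    then show ?thesis using w w' by (simp add: u_def permutes_not_in)
  qed
  have "w' = u \<circ> w \<circ> inv' u"
  proof
    fix x
    show "w' x = (u \<circ> w \<circ> inv' u) x"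
      using step[of "inv' u x"] permutes_inverses(1)[OF u] by simp
  qed
  with u show ?thesis by blast
qed

lemma mset_cycle_type: "mset (cycle_type n w) = image_mset card (mset_set (orbit w ` {1..n}))"
  by (simp add: cycle_type_def)

lemma cycle_type_eq_imp_conj:
  assumes "w permutes {1..n}" "w' permutes {1..n}" "cycle_type n w = cycle_type n w'"
  shows "\<exists>u. u permutes {1..n} \<and> w' = u \<circ> w \<circ> inv' u"
  using assms by (intro card_orbits_eq_imp_conj) (simp_all only: mset_cycle_type[symmetric] finite_atLeastAtMost)

text \<open>A permutation and its inverse have the same orbits. They are therefore conjugate, which
  removes the inverse from the orthogonality relations.\<close>

lemma cycle_type_inv:
  assumes "w permutes {1..n}"
  shows "cycle_type n (inv' w) = cycle_type n w"
proof -
  have "permutation w" using assms by (auto simp: permutation_permutes)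
  then show ?thesis by (simp add: cycle_type_def orbit_inv_eq)
qed

lemma orbits_partition:
  assumes "w permutes S" "finite S"
  shows "\<Union> (orbit w ` S) = S" "disjoint (orbit w ` S)"
proof -
  have perm: "permutation w" using assms by (auto simp: permutation_permutes)
  show "\<Union> (orbit w ` S) = S"
    using permutes_orbit_subset[OF assms(1)] permutation_self_in_orbit[OF perm] by blast
  have "orbit w x = orbit w y" if "z \<in> orbit w x" "z \<in> orbit w y" for x y z
    using that cyclic_on_orbit'[OF perm] orbit_cyclic_eq3 by metis
  then show "disjoint (orbit w ` S)"
    unfolding disjoint_def by blast
qed

lemma cycle_type_in_partitions_of:
  assumes w: "w permutes {1..n}"
  shows "cycle_type n w \<in> partitions_of n"
proof -
  let ?O = "orbit w ` {1..n}"
  have perm: "permutation w" using w by (auto simp: permutation_permutes)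
  have fin: "finite A" "A \<noteq> {}" if "A \<in> ?O" for A
    using that permutation_self_in_orbit[OF perm] by (auto intro: finite_orbit)
  have "sum_list (cycle_type n w) = sum_mset (mset (cycle_type n w))"
    by (rule sum_mset_sum_list[symmetric])
  also have "\<dots> = (\<Sum>A\<in>?O. card A)"
    by (simp add: mset_cycle_type sum_unfold_sum_mset)
  also have "\<dots> = card (\<Union> ?O)"
    using orbits_partition[OF w] fin by (intro card_Union_disjoint[symmetric]) (auto simp: disjoint_def)
  also have "\<dots> = n" using orbits_partition[OF w] by simp
  finally have s: "sum_list (cycle_type n w) = n" .
  have "set (cycle_type n w) = set_mset (mset (cycle_type n w))" by simp
  also have "\<dots> = card ` ?O" by (simp add: mset_cycle_type)
  finally have "0 \<notin> set (cycle_type n w)" using fin by auto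
  moreover have "sorted_wrt (\<ge>) (cycle_type n w)"
    by (simp add: cycle_type_def sorted_wrt_rev)
  ultimately show ?thesis using s by (simp add: partitions_of_def)
qed

lemma finite_partitions_of [simp]: "finite (partitions_of n)"
proof (rule finite_subset)
  have "length \<mu> \<le> sum_list \<mu>" if "0 \<notin> set \<mu>" for \<mu> :: "nat list"
    using that by (induction \<mu>) (auto simp: Suc_le_eq)
  then show "partitions_of n \<subseteq> {xs. set xs \<subseteq> {..n} \<and> length xs \<le> n}"
    by (auto simp: partitions_of_def member_le_sum_list)
  show "finite {xs. set xs \<subseteq> {..n} \<and> length xs \<le> n}"
    by (rule finite_lists_length_le) simp
qed

section \<open>Expansion of class functions of the symmetric group\<close>

text \<open>Numbering the finite index set turns both families into square matrices, whose one-sided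
  inverses are two-sided. This converts row orthogonality of a table of values into column
  orthogonality.\<close>

lemma left_inverse_imp_right_inverse_on:
  fixes A B :: "'i \<Rightarrow> 'i \<Rightarrow> 'k :: field"
  assumes I: "finite I"
    and AB: "\<And>i j. i \<in> I \<Longrightarrow> j \<in> I \<Longrightarrow> (\<Sum>k\<in>I. A i k * B k j) = (if i = j then 1 else 0)"
    and ij: "i \<in> I" "j \<in> I"
  shows "(\<Sum>k\<in>I. B i k * A k j) = (if i = j then 1 else 0)"
proof -
  obtain e where e: "bij_betw e {..<card I} I"
    using ex_bij_betw_nat_finite[OF I] by (auto simp: lessThan_atLeast0)
  let ?n = "card I"
  let ?A = "mat ?n ?n (\<lambda>(i, j). A (e i) (e j))" and ?B = "mat ?n ?n (\<lambda>(i, j). B (e i) (e j))"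
  have eI: "e i \<in> I" if "i < ?n" for i using bij_betwE[OF e] that by auto
  have ee: "e i = e j \<longleftrightarrow> i = j" if "i < ?n" "j < ?n" for i j
    using bij_betw_imp_inj_on[OF e] that by (auto dest: inj_onD)
  have prod: "(mat ?n ?n (\<lambda>(i, j). X (e i) (e j)) * mat ?n ?n (\<lambda>(i, j). Y (e i) (e j))) $$ (i, j)
      = (\<Sum>k\<in>I. X (e i) k * Y k (e j))" if "i < ?n" "j < ?n" for X Y :: "'i \<Rightarrow> 'i \<Rightarrow> 'k" and i j
    using that sum.reindex_bij_betw[OF e, of "\<lambda>k. X (e i) k * Y k (e j)"]
    by (subst index_mult_mat_sum[of _ ?n ?n _ ?n]) auto
  have "?A * ?B = 1\<^sub>m ?n"
    by (rule eq_matI) (simp_all add: prod AB eI ee del: index_mult_mat(1))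
  then have "?B * ?A = 1\<^sub>m ?n"
    by (rule mat_mult_left_right_inverse[rotated 2]) auto
  moreover obtain i' j' where "i' < ?n" "j' < ?n" "i = e i'" "j = e j'"
    using ij bij_betw_imp_surj_on[OF e] by (metis imageE lessThan_iff)
  ultimately show ?thesis using prod[of i' j' B A] ee[of i' j'] by simp
qed

lemma sym_group_simps:
  "carrier (sym_group n) = {p. p permutes {1..n}}" "mult (sym_group n) = (\<circ>)" "one (sym_group n) = id"
  by (auto simp: sym_group_def)

lemma card_sym_group: "card (carrier (sym_group n)) = fact n"
  by (simp add: sym_group_simps card_permutations)

lemma finite_sym_group [simp]: "finite (carrier (sym_group n))"
  by (simp add: sym_group_simps finite_permutations)

lemma class_function_sym_group_cong:
  assumes f: "class_function (sym_group n) f" and w: "w \<in> carrier (sym_group n)"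
    "w' \<in> carrier (sym_group n)" "cycle_type n w = cycle_type n w'"
  shows "f w = f w'"
proof -
  obtain u where u: "u permutes {1..n}" "w' = u \<circ> w \<circ> inv' u"
    using cycle_type_eq_imp_conj[of w n w'] w unfolding sym_group_simps by blast
  then have "u \<in> carrier (sym_group n)" by (simp add: sym_group_simps)
  moreover from this have "inv\<^bsub>sym_group n\<^esub> u = inv' u" by (rule sym_group_inv_equality)
  ultimately show ?thesis using f w u unfolding class_function_def sym_group_mult by metis
qed

lemma class_function_inv:
  assumes f: "class_function (sym_group n) f" and w: "w \<in> carrier (sym_group n)"
  shows "f (inv\<^bsub>sym_group n\<^esub> w) = f w"
  using w by (intro class_function_sym_group_cong[OF f])
    (simp_all add: cycle_type_inv sym_group_simps permutes_inv)

text \<open>There are at most as many classes as partitions, so an orthonormal family of class functions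
  indexed by the partitions has a square, hence two-sided invertible, matrix of values.\<close>

lemma class_function_expansion:
  fixes \<chi> :: "nat list \<Rightarrow> (nat \<Rightarrow> nat) \<Rightarrow> complex"
  assumes cf: "\<And>\<mu>. \<mu> \<in> partitions_of n \<Longrightarrow> class_function (sym_group n) (\<chi> \<mu>)"
    and orth: "\<And>\<mu> \<nu>. \<mu> \<in> partitions_of n \<Longrightarrow> \<nu> \<in> partitions_of n \<Longrightarrow>
      (\<Sum>w\<in>carrier (sym_group n). \<chi> \<mu> w * \<chi> \<nu> w) = (if \<mu> = \<nu> then fact n else 0)"
    and f: "class_function (sym_group n) f" and w: "w \<in> carrier (sym_group n)"
  shows "f w = (\<Sum>\<mu>\<in>partitions_of n.
    (\<Sum>v\<in>carrier (sym_group n). f v * \<chi> \<mu> v) / fact n * \<chi> \<mu> w)"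
proof -
  let ?G = "carrier (sym_group n)" and ?I = "partitions_of n" and ?c = "cycle_type n"
  have cI: "?c v \<in> ?I" if "v \<in> ?G" for v
    using that by (auto simp: sym_group_simps intro: cycle_type_in_partitions_of)
  \<comment> \<open>If no permutation had cycle type \<rho>, \<open>v \<rho>\<close> would be
    arbitrary, but \<open>B \<rho> \<mu>\<close> would then be an empty sum, so \<open>group\<close>
    holds in any case.\<close>
  define v where "v \<rho> = (SOME v. v \<in> ?G \<and> ?c v = \<rho>)" for \<rho>
  have v: "v (?c g) \<in> ?G" "?c (v (?c g)) = ?c g" if "g \<in> ?G" for g
    using someI[of "\<lambda>v. v \<in> ?G \<and> ?c v = ?c g" g] that by (auto simp: v_def)
  have at_rep: "h (v (?c g)) = h g" if "class_function (sym_group n) h" "g \<in> ?G" for h :: "_ \<Rightarrow> complex" and g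
    using class_function_sym_group_cong[OF that(1) v(1)[OF that(2)] that(2) v(2)[OF that(2)]] .
  define A where "A \<mu> \<rho> = \<chi> \<mu> (v \<rho>)" for \<mu> \<rho>
  define B where "B \<rho> \<mu> = (\<Sum>g | g \<in> ?G \<and> ?c g = \<rho>. \<chi> \<mu> g / fact n)" for \<rho> \<mu>
  have group: "(\<Sum>\<rho>\<in>?I. h (v \<rho>) * B \<rho> \<mu>) = (\<Sum>g\<in>?G. h g * \<chi> \<mu> g) / fact n"
    if h: "class_function (sym_group n) h" for h \<mu>
  proof -
    have "(\<Sum>\<rho>\<in>?I. h (v \<rho>) * B \<rho> \<mu>)
        = (\<Sum>\<rho>\<in>?I. \<Sum>g | g \<in> ?G \<and> ?c g = \<rho>. h g * \<chi> \<mu> g / fact n)"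
      unfolding B_def sum_distrib_left
      by (intro sum.cong refl) (use at_rep[OF h] in auto)
    also have "\<dots> = (\<Sum>g\<in>?G. h g * \<chi> \<mu> g / fact n)"
      by (rule sum.group) (use cI in auto)
    finally show ?thesis by (simp add: sum_divide_distrib)
  qed
  have AB: "(\<Sum>\<rho>\<in>?I. A \<mu> \<rho> * B \<rho> \<nu>) = (if \<mu> = \<nu> then 1 else 0)" if "\<mu> \<in> ?I" "\<nu> \<in> ?I" for \<mu> \<nu>
    unfolding A_def using group[OF cf[OF that(1)], of \<nu>] orth[OF that] by simp
  \<comment> \<open>Orthonormality makes \<open>B\<close> a right inverse of \<open>A\<close>.
    Recovering \<open>f\<close> from its coefficients needs it as a left inverse, which it is
    because rows and columns are both indexed by partitions.\<close>
  have BA: "(\<Sum>\<mu>\<in>?I. B \<rho> \<mu> * A \<mu> \<sigma>) = (if \<rho> = \<sigma> then 1 else 0)" if "\<rho> \<in> ?I" "\<sigma> \<in> ?I" for \<rho> \<sigma>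
    using finite_partitions_of AB that by (rule left_inverse_imp_right_inverse_on)
  have "(\<Sum>\<mu>\<in>?I. (\<Sum>v\<in>?G. f v * \<chi> \<mu> v) / fact n * \<chi> \<mu> w)
      = (\<Sum>\<mu>\<in>?I. \<Sum>\<rho>\<in>?I. f (v \<rho>) * (B \<rho> \<mu> * A \<mu> (?c w)))"
  proof (rule sum.cong[OF refl])
    fix \<mu> assume \<mu>: "\<mu> \<in> ?I"
    have "(\<Sum>v\<in>?G. f v * \<chi> \<mu> v) / fact n * \<chi> \<mu> w
        = (\<Sum>\<rho>\<in>?I. f (v \<rho>) * B \<rho> \<mu>) * A \<mu> (?c w)"
      unfolding group[OF f] A_def at_rep[OF cf[OF \<mu>] w] ..
    then show "(\<Sum>v\<in>?G. f v * \<chi> \<mu> v) / fact n * \<chi> \<mu> w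
        = (\<Sum>\<rho>\<in>?I. f (v \<rho>) * (B \<rho> \<mu> * A \<mu> (?c w)))"
      by (simp only: sum_distrib_right mult.assoc)
  qed
  also have "\<dots> = (\<Sum>\<rho>\<in>?I. f (v \<rho>) * (\<Sum>\<mu>\<in>?I. B \<rho> \<mu> * A \<mu> (?c w)))"
    by (subst sum.swap) (simp add: sum_distrib_left)
  also have "\<dots> = (\<Sum>\<rho>\<in>?I. if \<rho> = ?c w then f (v \<rho>) else 0)"
    using BA cI[OF w] by (intro sum.cong refl) simp
  also have "\<dots> = f w"
    using cI[OF w] at_rep[OF f w] by simp
  finally show ?thesis ..
qed

section \<open>Colourings and power sums\<close>

lemma bij_betw_inverses:
  assumes "\<And>x. x \<in> A \<Longrightarrow> f x \<in> B \<and> g (f x) = x" "\<And>y. y \<in> B \<Longrightarrow> g y \<in> A \<and> f (g y) = y"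
  shows "bij_betw f A B"
  by (rule bij_betw_byWitness[of _ g]) (use assms in auto)

text \<open>A colour stands for the index of a variable, and \<open>m\<close> for the monomial
  formed by the colours of all points.\<close>

definition colorings :: "'x set \<Rightarrow> 'c multiset \<Rightarrow> ('x \<Rightarrow> 'c) set" where
  "colorings S m = {c \<in> S \<rightarrow>\<^sub>E UNIV. image_mset c (mset_set S) = m}"

definition fixed_colorings :: "'x set \<Rightarrow> 'c multiset \<Rightarrow> ('x \<Rightarrow> 'x) \<Rightarrow> ('x \<Rightarrow> 'c) set" where
  "fixed_colorings S m w = {c \<in> colorings S m. \<forall>x\<in>S. c (w x) = c x}"

lemma finite_colorings [simp]: "finite S \<Longrightarrow> finite (colorings S m)"
proof -
  assume S: "finite S"
  have "colorings S m \<subseteq> S \<rightarrow>\<^sub>E set_mset m"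
    using S by (auto simp: colorings_def)
  from finite_subset[OF this] S show ?thesis by (simp add: finite_PiE)
qed

lemma finite_fixed_colorings [simp]: "finite S \<Longrightarrow> finite (fixed_colorings S m w)"
  by (rule finite_subset[of _ "colorings S m"]) (auto simp: fixed_colorings_def)

lemma colorings_size: "finite S \<Longrightarrow> c \<in> colorings S m \<Longrightarrow> size m = card S"
  by (auto simp: colorings_def)

lemma ex_coloring: "finite S \<Longrightarrow> size m = card S \<Longrightarrow> \<exists>c. c \<in> colorings S m"
proof (induction S arbitrary: m rule: finite_induct)
  case (insert x S)
  then obtain a m' where m: "m = add_mset a m'" by (cases m) auto
  then have "size m' = card S" using insert by simp
  then obtain c where c: "c \<in> colorings S m'" using insert by blast
  have "image_mset (c(x := a)) (mset_set S) = image_mset c (mset_set S)"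
    using insert.hyps by (intro image_mset_cong) auto
  then have "c(x := a) \<in> colorings (insert x S) m"
    using c insert.hyps m by (auto simp: colorings_def PiE_iff extensional_def)
  then show ?case by blast
qed (auto simp: colorings_def)

lemma image_mset_conv_sum: "finite S \<Longrightarrow> image_mset f (mset_set S) = (\<Sum>x\<in>S. {#f x#})"
  by (induction S rule: finite_induct) simp_all

lemma sum_single_mset_const: "(\<Sum>x\<in>A. {#a#}) = replicate_mset (card A) a"
  by (induction A rule: infinite_finite_induct) auto

text \<open>A term in the expanded product of the power sums \<open>power_sum1 (card A)\<close> over
  the blocks \<open>A\<close>: each factor contributes a power of one chosen variable, and
  \<open>m\<close> is the resulting monomial.\<close>

definition block_colorings :: "'x set set \<Rightarrow> 'c multiset \<Rightarrow> ('x set \<Rightarrow> 'c) set" where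
  "block_colorings P m = {f \<in> P \<rightarrow>\<^sub>E UNIV. (\<Sum>A\<in>P. replicate_mset (card A) (f A)) = m}"

lemma finite_block_colorings:
  assumes "finite P" "\<And>A. A \<in> P \<Longrightarrow> card A > 0"
  shows "finite (block_colorings P m)"
proof -
  have "f A \<in># m" if "f \<in> block_colorings P m" "A \<in> P" for f A
  proof -
    have "f A \<in># replicate_mset (card A) (f A)" using assms(2)[OF that(2)] by simp
    moreover have "(\<Sum>A\<in>P. replicate_mset (card A) (f A))
        = replicate_mset (card A) (f A) + (\<Sum>A\<in>P - {A}. replicate_mset (card A) (f A))"
      using assms(1) that(2) by (rule sum.remove)
    ultimately show ?thesis using that(1) unfolding block_colorings_def by (metis (mono_tags, lifting) mem_Collect_eq union_iff)
  qed
  then have "block_colorings P m \<subseteq> P \<rightarrow>\<^sub>E set_mset m"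
    by (auto simp: block_colorings_def)
  from finite_subset[OF this] assms(1) show ?thesis by (simp add: finite_PiE)
qed

text \<open>Induction over the blocks: a split of \<open>m\<close> contributes exactly if its first
  part consists of \<open>card A\<close> copies of one variable, the colour of the new block
  \<open>A\<close>.\<close>

lemma mfps_coeff_prod_power_sum1:
  assumes "finite P" "\<And>A. A \<in> P \<Longrightarrow> card A > 0"
  shows "mfps_coeff (\<Prod>A\<in>P. power_sum1 (card A)) m = of_nat (card (block_colorings P m))"
  using assms
proof (induction P arbitrary: m rule: finite_induct)
  case empty
  have *: "block_colorings {} m = (if m = {#} then {\<lambda>_. undefined} else {})"
    by (auto simp: block_colorings_def)
  show ?case unfolding * by (simp add: one_mfps.rep_eq)
next
  case (insert A P)
  have A: "card A > 0" and P: "\<And>B. B \<in> P \<Longrightarrow> card B > 0" using insert.prems by auto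
  let ?k = "card A"
  let ?S = "SIGMA x : msplits m. if \<exists>i. fst x = replicate_mset ?k i then block_colorings P (snd x) else {}"
  \<comment> \<open>A nonempty block can be given back its colour from its monomial, so the
    \<open>THE\<close> in \<open>F\<close> is well defined.\<close>
  have rep_inj: "replicate_mset ?k i = replicate_mset ?k j \<longleftrightarrow> i = j" for i j :: nat
    using A by (simp add: replicate_mset_eq_iff)
  have "mfps_coeff (\<Prod>A\<in>insert A P. power_sum1 (card A)) m
      = (\<Sum>x\<in>msplits m. of_nat (card (if \<exists>i. fst x = replicate_mset ?k i
          then block_colorings P (snd x) else {})))"
    using insert.hyps insert.IH[OF P]
    by (simp add: times_mfps.rep_eq power_sum1.rep_eq case_prod_unfold)
       (rule sum.cong, auto)
  also have "\<dots> = of_nat (card ?S)"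
    using finite_block_colorings[OF insert.hyps(1) P] by (subst card_SigmaI) auto
  also have "card ?S = card (block_colorings (insert A P) m)"
  proof (rule bij_betw_same_card)
    define F where "F x = (snd x)(A := (THE i. fst (fst x) = replicate_mset ?k i))"
      for x :: "(nat multiset \<times> nat multiset) \<times> ('a set \<Rightarrow> nat)"
    define H where "H f = ((replicate_mset ?k (f A), \<Sum>B\<in>P. replicate_mset (card B) (f B)), restrict f P)"
      for f :: "'a set \<Rightarrow> nat"
    have upd: "(\<Sum>B\<in>P. replicate_mset (card B) ((g(A := i)) B)) = (\<Sum>B\<in>P. replicate_mset (card B) (g B))"
      for g and i :: nat
      using insert.hyps by (intro sum.cong) auto
    have FH: "F x \<in> block_colorings (insert A P) m \<and> H (F x) = x" if "x \<in> ?S" for x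
    proof -
      obtain a b g where abg: "x = ((a, b), g)" by (metis surj_pair)
      obtain i where i: "a = replicate_mset ?k i" "g \<in> block_colorings P b" "a + b = m"
        using \<open>x \<in> ?S\<close> by (auto simp: msplits_def abg split: if_splits)
      have F: "F x = g(A := i)" by (simp add: F_def abg i rep_inj)
      have g: "g \<in> P \<rightarrow>\<^sub>E UNIV" "(\<Sum>B\<in>P. replicate_mset (card B) (g B)) = b"
        using i(2) by (auto simp: block_colorings_def)
      have "(\<Sum>B\<in>insert A P. replicate_mset (card B) ((g(A := i)) B)) = m"
        unfolding sum.insert[OF insert.hyps] upd g(2) using i(1,3) by simp
      moreover have "g(A := i) \<in> insert A P \<rightarrow>\<^sub>E UNIV"
        using g(1) by (auto simp: PiE_iff extensional_def)
      moreover have "restrict (g(A := i)) P = g"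
        using g(1) insert.hyps by (auto simp: fun_eq_iff PiE_iff extensional_def)
      ultimately show ?thesis
        unfolding F H_def upd g(2) by (simp add: block_colorings_def abg i(1))
    qed
    have HF: "H f \<in> ?S \<and> F (H f) = f" if "f \<in> block_colorings (insert A P) m" for f
    proof
      show "H f \<in> ?S" using that insert.hyps
        by (auto simp: block_colorings_def msplits_def H_def cong: sum.cong)
      show "F (H f) = f" using that
        by (auto simp: F_def H_def rep_inj block_colorings_def PiE_iff extensional_def fun_eq_iff)
    qed
    show "bij_betw F ?S (block_colorings (insert A P) m)"
      using FH HF by (rule bij_betw_inverses)
  qed
  finally show ?case .
qed

lemma fixed_coloring_orbit:
  assumes w: "w permutes S" and c: "\<forall>x\<in>S. c (w x) = c x" and x: "x \<in> S" and y: "y \<in> orbit w x"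
  shows "c y = c x"
  using y
proof (induction rule: orbit.induct)
  case (step y)
  then have "y \<in> S" using permutes_orbit_subset[OF w x] by blast
  with step c show ?case by simp
qed (use x c in auto)

text \<open>A colouring is fixed by \<open>w\<close> iff it is constant on orbits, so it amounts to
  one colour per orbit, counted with the size of the orbit.\<close>

lemma card_fixed_colorings_blocks:
  assumes w: "w permutes S" and S: "finite S"
  shows "card (fixed_colorings S m w) = card (block_colorings (orbit w ` S) m)"
proof (rule bij_betw_same_card)
  have perm: "permutation w" using assms by (auto simp: permutation_permutes)
  have self: "x \<in> orbit w x" for x using perm by (rule permutation_self_in_orbit)
  have orb_eq: "orbit w y = orbit w x" if "y \<in> orbit w x" for x y
    using cyclic_on_orbit'[OF perm, of x] that orbit_cyclic_eq3 by metis
  let ?P = "orbit w ` S"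
  have block: "{x \<in> S. orbit w x = A} = A" if "A \<in> ?P" for A
    using that orb_eq self permutes_orbit_subset[OF w] by fast
  have content: "image_mset c (mset_set S) = (\<Sum>A\<in>?P. replicate_mset (card A) (f A))"
    if "\<And>x. x \<in> S \<Longrightarrow> c x = f (orbit w x)" for c :: "'a \<Rightarrow> 'b" and f
  proof -
    have "image_mset c (mset_set S) = (\<Sum>x\<in>S. {#f (orbit w x)#})"
      using S that by (simp add: image_mset_conv_sum)
    also have "\<dots> = (\<Sum>A\<in>?P. \<Sum>x | x \<in> S \<and> orbit w x = A. {#f (orbit w x)#})"
      using S by (intro sum.group[symmetric]) auto
    also have "\<dots> = (\<Sum>A\<in>?P. \<Sum>x | x \<in> S \<and> orbit w x = A. {#f A#})"
      by (intro sum.cong) auto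
    also have "\<dots> = (\<Sum>A\<in>?P. \<Sum>x\<in>A. {#f A#})"
      by (intro sum.cong refl block)
    also have "\<dots> = (\<Sum>A\<in>?P. replicate_mset (card A) (f A))"
      by (simp add: sum_single_mset_const)
    finally show ?thesis .
  qed
  define F where "F c = (\<lambda>A\<in>?P. c (SOME y. y \<in> A))" for c :: "'a \<Rightarrow> 'b"
  define H where "H f = (\<lambda>x\<in>S. f (orbit w x))" for f :: "'a set \<Rightarrow> 'b"
  have some: "(SOME y. y \<in> orbit w x) \<in> orbit w x" for x using self[of x] by (rule someI)
  have FH: "F c \<in> block_colorings ?P m \<and> H (F c) = c" if c: "c \<in> fixed_colorings S m w" for c
  proof
    have F: "F c (orbit w x) = c x" if "x \<in> S" for x
    proof -
      have "\<forall>x\<in>S. c (w x) = c x" using c by (simp add: fixed_colorings_def)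
      from fixed_coloring_orbit[OF w this that some] show ?thesis using that by (simp add: F_def)
    qed
    have "m = image_mset c (mset_set S)" using c by (simp add: fixed_colorings_def colorings_def)
    also have "\<dots> = (\<Sum>A\<in>?P. replicate_mset (card A) (F c A))"
      using F by (intro content) simp
    finally show "F c \<in> block_colorings ?P m" by (simp add: block_colorings_def F_def)
    have "c \<in> extensional S" using c by (simp add: fixed_colorings_def colorings_def PiE_def)
    then show "H (F c) = c" using F by (auto simp: H_def fun_eq_iff extensional_def)
  qed
  have HF: "H f \<in> fixed_colorings S m w \<and> F (H f) = f" if f: "f \<in> block_colorings ?P m" for f
  proof
    have "image_mset (H f) (mset_set S) = (\<Sum>A\<in>?P. replicate_mset (card A) (f A))"
      by (rule content) (simp add: H_def)
    then show "H f \<in> fixed_colorings S m w"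
      using f permutation_orbit_step[OF perm] permutes_in_image[OF w]
      by (simp add: fixed_colorings_def colorings_def block_colorings_def H_def)
    show "F (H f) = f"
    proof
      fix A
      show "F (H f) A = f A"
      proof (cases "A \<in> ?P")
        case True
        then obtain x where x: "x \<in> S" "A = orbit w x" by blast
        have "(SOME y. y \<in> A) \<in> S" "orbit w (SOME y. y \<in> A) = A"
          using some[of x] orb_eq permutes_orbit_subset[OF w x(1)] x by auto
        then show ?thesis using True by (simp add: F_def H_def)
      next
        case False
        moreover have "f \<in> extensional ?P" using f by (simp add: block_colorings_def PiE_def)
        ultimately show ?thesis by (simp add: F_def extensional_def)
      qed
    qed
  qed
  show "bij_betw F (fixed_colorings S m w) (block_colorings ?P m)"
    using FH HF by (rule bij_betw_inverses)
qed

text \<open>Each coefficient becomes, as a function of \<open>w\<close>, a permutation character,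
  which representation theory can decompose.\<close>

lemma mfps_coeff_power_sum_cycle_type:
  assumes w: "w permutes {1..n}"
  shows "mfps_coeff (power_sum (cycle_type n w)) m = of_nat (card (fixed_colorings {1..n} m w))"
proof -
  let ?P = "orbit w ` {1..n}"
  have perm: "permutation w" using w by (auto simp: permutation_permutes)
  have pos: "card A > 0" if "A \<in> ?P" for A
    using that permutation_self_in_orbit[OF perm] by (auto simp: card_gt_0_iff intro: finite_orbit)
  have "power_sum (cycle_type n w) = prod_mset (mset (map power_sum1 (cycle_type n w)))"
    unfolding power_sum_def by (rule prod_mset_prod_list[symmetric])
  also have "\<dots> = (\<Prod>A\<in>?P. power_sum1 (card A))"
    by (simp add: cycle_type_def prod_unfold_prod_mset multiset.map_comp comp_def)
  finally show ?thesis
    using mfps_coeff_prod_power_sum1[of ?P m] pos card_fixed_colorings_blocks[OF w, of m] by simp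
qed

section \<open>Orbit counting on colourings and pairs of colourings\<close>

text \<open>Burnside's lemma for a transitive action: the colourings with content \<open>m\<close>
  form a single orbit, so the numbers of fixed colourings add up to the group order.\<close>

lemma sum_card_fixed_colorings:
  assumes S: "finite S" and m: "size m = card S"
  shows "(\<Sum>w | w permutes S. card (fixed_colorings S m w)) = fact (card S)"
proof -
  let ?Pm = "{w. w permutes S}"
  have fin: "finite ?Pm" using S by (rule finite_permutations)
  obtain d where d: "d \<in> colorings S m" using ex_coloring[OF S m] by blast
  \<comment> \<open>The permutations carrying \<open>c\<close> to \<open>c'\<close>. With
    \<open>d\<close> fixed, the sets \<open>stab d c\<close> partition the group, and each is a
    coset as large as the stabilizer \<open>stab c c\<close>.\<close>
  define stab where "stab c c' = {w \<in> ?Pm. \<forall>x\<in>S. c (w x) = c' x}" for c c' :: "'a \<Rightarrow> 'b"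
  have eq: "card (stab c c) = card (stab d c)" if c: "c \<in> colorings S m" for c
  proof -
    have "image_mset c (mset_set S) = image_mset d (mset_set S)"
      using c d by (simp add: colorings_def)
    then obtain p where p: "p permutes S" "\<forall>x\<in>S. c x = d (p x)"
      using image_mset_eq_implies_permutes[OF S] by metis
    note p' = permutes_inv[OF p(1)]
    have "\<forall>x\<in>S. d x = c (inv_into UNIV p x)"
      using p(2) permutes_in_image[OF p'] permutes_inverses(1)[OF p(1)] by auto
    note d' = this
    show ?thesis
    proof (rule bij_betw_same_card)
      have 1: "p \<circ> w \<in> stab d c \<and> inv_into UNIV p \<circ> (p \<circ> w) = w" if w: "w \<in> stab c c" for w
      proof
        have "d (p (w x)) = c x" if "x \<in> S" for x
          using w that p(2) permutes_in_image[of w S x] by (auto simp: stab_def)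
        then show "p \<circ> w \<in> stab d c" using w p(1) by (auto simp: stab_def permutes_compose)
      qed (simp add: fun_eq_iff permutes_inverses[OF p(1)])
      have 2: "inv_into UNIV p \<circ> w \<in> stab c c \<and> p \<circ> (inv_into UNIV p \<circ> w) = w" if w: "w \<in> stab d c" for w
      proof
        have "c (inv_into UNIV p (w x)) = c x" if "x \<in> S" for x
          using w that d' permutes_in_image[of w S x] by (auto simp: stab_def)
        then show "inv_into UNIV p \<circ> w \<in> stab c c" using w p' by (auto simp: stab_def permutes_compose)
      qed (simp add: fun_eq_iff permutes_inverses[OF p(1)])
      show "bij_betw (\<lambda>w. p \<circ> w) (stab c c) (stab d c)"
        using 1 2 by (rule bij_betw_inverses)
    qed
  qed
  have "(\<Sum>w\<in>?Pm. card (fixed_colorings S m w))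
      = (\<Sum>w\<in>?Pm. \<Sum>c\<in>colorings S m. if \<forall>x\<in>S. c (w x) = c x then 1 else 0)"
    using S by (intro sum.cong) (auto simp: fixed_colorings_def sum.If_cases Int_def)
  also have "\<dots> = (\<Sum>c\<in>colorings S m. card (stab c c))"
    using fin by (subst sum.swap) (auto simp: stab_def sum.If_cases Int_def)
  also have "\<dots> = (\<Sum>c\<in>colorings S m. card (stab d c))" using eq by simp
  also have "\<dots> = card (\<Union>c\<in>colorings S m. stab d c)"
  proof (rule card_UN_disjoint[symmetric])
    show "\<forall>c\<in>colorings S m. \<forall>c'\<in>colorings S m. c \<noteq> c' \<longrightarrow> stab d c \<inter> stab d c' = {}"
      by (auto simp: stab_def colorings_def PiE_iff extensional_def fun_eq_iff) metis
  qed (use fin S in \<open>auto simp: stab_def\<close>)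
  also have "(\<Union>c\<in>colorings S m. stab d c) = ?Pm"
  proof safe
    fix w assume w: "w permutes S"
    let ?c = "\<lambda>x\<in>S. d (w x)"
    have "image_mset ?c (mset_set S) = image_mset d (mset_set S)"
      using permutes_implies_image_mset_eq[OF w, of ?c d] by simp
    then have "?c \<in> colorings S m" using d by (simp add: colorings_def)
    then show "w \<in> (\<Union>c\<in>colorings S m. stab d c)" using w
      by (intro UN_I[of ?c]) (auto simp: stab_def)
  qed (auto simp: stab_def)
  also have "card ?Pm = fact (card S)" using S by (simp add: card_permutations)
  finally show ?thesis .
qed

text \<open>Multisets of pairs play the role of non-negative integer matrices; \<open>m\<close> and \<open>m'\<close> are the
  row and column sums.\<close>

definition contingency :: "'a multiset \<Rightarrow> 'b multiset \<Rightarrow> ('a \<times> 'b) multiset set" where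
  "contingency m m' = {A. image_mset fst A = m \<and> image_mset snd A = m'}"

lemma contingency_size: "A \<in> contingency m m' \<Longrightarrow> size A = size m"
  by (auto simp: contingency_def)

lemma finite_contingency [simp]: "finite (contingency m m')"
proof -
  let ?L = "{xs. set xs \<subseteq> set_mset m \<times> set_mset m' \<and> length xs = size m}"
  have "A \<in> mset ` ?L" if A: "A \<in> contingency m m'" for A
  proof -
    obtain xs where xs: "A = mset xs" using ex_mset by metis
    have "set_mset A \<subseteq> set_mset m \<times> set_mset m'"
      using A by (force simp: contingency_def)
    then show ?thesis using xs contingency_size[OF A] by auto
  qed
  moreover have "finite ?L" by (rule finite_lists_length_eq) simp
  ultimately show ?thesis by (meson finite_imageI finite_subset subsetI)
qed

text \<open>Two fixed colourings are one fixed colouring by pairs of colours, whose content is a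
  contingency table. By Burnside's lemma each table contributes the group order.\<close>

lemma sum_card_fixed_colorings_prod:
  assumes S: "finite S" and m: "size m = card S"
  shows "(\<Sum>w | w permutes S. card (fixed_colorings S m w) * card (fixed_colorings S m' w))
    = fact (card S) * card (contingency m m')"
proof -
  have "card (fixed_colorings S m w) * card (fixed_colorings S m' w)
      = (\<Sum>A\<in>contingency m m'. card (fixed_colorings S A w))" if w: "w permutes S" for w
  proof -
    have "card (fixed_colorings S m w \<times> fixed_colorings S m' w)
        = card (\<Union>A\<in>contingency m m'. fixed_colorings S A w)"
    proof (rule bij_betw_same_card)
      define F where "F p = (\<lambda>x\<in>S. (fst p x, snd p x))" for p :: "('a \<Rightarrow> 'b) \<times> ('a \<Rightarrow> 'c)"
      define H where "H d = ((\<lambda>x\<in>S. fst (d x)), (\<lambda>x\<in>S. snd (d x)))" for d :: "'a \<Rightarrow> 'b \<times> 'c"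
      have FH: "F p \<in> (\<Union>A\<in>contingency m m'. fixed_colorings S A w) \<and> H (F p) = p"
        if p: "p \<in> fixed_colorings S m w \<times> fixed_colorings S m' w" for p
      proof
        obtain c c' where cc: "p = (c, c')"
          and *: "c \<in> fixed_colorings S m w" "c' \<in> fixed_colorings S m' w" using p by blast
        let ?A = "image_mset (F p) (mset_set S)"
        have "image_mset fst ?A = image_mset c (mset_set S)" "image_mset snd ?A = image_mset c' (mset_set S)"
          using S by (auto simp: multiset.map_comp F_def cc intro!: image_mset_cong)
        then have "?A \<in> contingency m m'"
          using * by (simp add: contingency_def fixed_colorings_def colorings_def)
        moreover have "F p \<in> fixed_colorings S ?A w"
          using * permutes_in_image[OF w] by (simp add: fixed_colorings_def colorings_def F_def cc)
        ultimately show "F p \<in> (\<Union>A\<in>contingency m m'. fixed_colorings S A w)"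
          by (rule UN_I)
        have "c \<in> extensional S" "c' \<in> extensional S"
          using * by (simp_all add: fixed_colorings_def colorings_def PiE_def)
        then show "H (F p) = p" by (auto simp: H_def F_def cc fun_eq_iff extensional_def)
      qed
      have HF: "H d \<in> fixed_colorings S m w \<times> fixed_colorings S m' w \<and> F (H d) = d"
        if "d \<in> (\<Union>A\<in>contingency m m'. fixed_colorings S A w)" for d
      proof
        obtain A where A: "A \<in> contingency m m'" and d: "d \<in> fixed_colorings S A w"
          using \<open>d \<in> (\<Union>A\<in>contingency m m'. fixed_colorings S A w)\<close> by blast
        have "image_mset (\<lambda>x\<in>S. fst (d x)) (mset_set S) = image_mset fst A"
          "image_mset (\<lambda>x\<in>S. snd (d x)) (mset_set S) = image_mset snd A"
          using d S by (auto simp: fixed_colorings_def colorings_def multiset.map_comp intro!: image_mset_cong)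
        then show "H d \<in> fixed_colorings S m w \<times> fixed_colorings S m' w"
          using A d permutes_in_image[OF w]
          by (simp add: fixed_colorings_def colorings_def contingency_def H_def)
        have "d \<in> extensional S" using d by (simp add: fixed_colorings_def colorings_def PiE_def)
        then show "F (H d) = d" by (auto simp: F_def H_def fun_eq_iff extensional_def)
      qed
      show "bij_betw F (fixed_colorings S m w \<times> fixed_colorings S m' w)
          (\<Union>A\<in>contingency m m'. fixed_colorings S A w)"
        using FH HF by (rule bij_betw_inverses)
    qed
    also have "\<dots> = (\<Sum>A\<in>contingency m m'. card (fixed_colorings S A w))"
    proof (rule card_UN_disjoint)
      show "\<forall>A\<in>contingency m m'. \<forall>B\<in>contingency m m'. A \<noteq> B \<longrightarrow>
          fixed_colorings S A w \<inter> fixed_colorings S B w = {}"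
        by (auto simp: fixed_colorings_def colorings_def)
    qed (use S in simp_all)
    finally show ?thesis by (simp add: card_cartesian_product)
  qed
  then have "(\<Sum>w | w permutes S. card (fixed_colorings S m w) * card (fixed_colorings S m' w))
      = (\<Sum>w | w permutes S. \<Sum>A\<in>contingency m m'. card (fixed_colorings S A w))"
    by (intro sum.cong) auto
  also have "\<dots> = (\<Sum>A\<in>contingency m m'. \<Sum>w | w permutes S. card (fixed_colorings S A w))"
    by (rule sum.swap)
  also have "\<dots> = (\<Sum>A\<in>contingency m m'. fact (card S))"
    using m by (intro sum.cong sum_card_fixed_colorings[OF S]) (auto dest: contingency_size)
  finally show ?thesis by simp
qed

section \<open>Kostka numbers\<close>

definition fdiag :: "(nat \<Rightarrow> nat) \<Rightarrow> (nat \<times> nat) set" where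
  "fdiag f = {(i, j). j < f i}"

text \<open>Partitions as weakly decreasing functions of finite support: rows beyond the last have
  length 0, so comparing row \<open>i\<close> with row \<open>Suc i\<close> requires no case
  distinction at the end of a list.\<close>

definition shapes :: "(nat \<Rightarrow> nat) set" where
  "shapes = {f. antimono f \<and> (\<exists>L. \<forall>i\<ge>L. f i = 0)}"

definition shape_size :: "(nat \<Rightarrow> nat) \<Rightarrow> nat" where
  "shape_size f = card (fdiag f)"

text \<open>Interlacing row lengths: the skew shape f/g has at most one cell in each column, i.e. it
  is a horizontal strip.\<close>

definition hstrip :: "(nat \<Rightarrow> nat) \<Rightarrow> (nat \<Rightarrow> nat) \<Rightarrow> bool" where
  "hstrip f g \<longleftrightarrow> (\<forall>i. g i \<le> f i \<and> f (Suc i) \<le> g i)"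

lemma fdiag_eq_Sigma: "\<forall>i\<ge>L. f i = 0 \<Longrightarrow> fdiag f = (SIGMA i:{..<L}. {..<f i})"
  by (auto simp: fdiag_def) (metis not_le not_less0)

lemma shape_size_eq: "\<forall>i\<ge>L. f i = 0 \<Longrightarrow> shape_size f = (\<Sum>i<L. f i)"
  by (simp add: shape_size_def fdiag_eq_Sigma)

lemma finite_fdiag: "f \<in> shapes \<Longrightarrow> finite (fdiag f)"
  by (auto simp: shapes_def fdiag_eq_Sigma)

lemma shapes_le: "f \<in> shapes \<Longrightarrow> i \<le> j \<Longrightarrow> f j \<le> f i"
  by (auto simp: shapes_def antimono_def)

lemma shapes_le_shape_size: "f \<in> shapes \<Longrightarrow> f i \<le> shape_size f"
proof -
  assume f: "f \<in> shapes"
  have "{i} \<times> {..<f i} \<subseteq> fdiag f" by (auto simp: fdiag_def)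
  from card_mono[OF finite_fdiag[OF f] this] show ?thesis by (simp add: shape_size_def)
qed

lemma shapes_eq_0: "f \<in> shapes \<Longrightarrow> shape_size f \<le> i \<Longrightarrow> f i = 0"
proof (rule ccontr)
  assume f: "f \<in> shapes" and i: "shape_size f \<le> i" and "f i \<noteq> 0"
  then have "{..i} \<times> {0} \<subseteq> fdiag f"
    using shapes_le[OF f] by (fastforce simp: fdiag_def)
  from card_mono[OF finite_fdiag[OF f] this] show False using i by (simp add: shape_size_def)
qed

lemma finite_shapes: "finite {f \<in> shapes. shape_size f = N}"
proof (rule finite_subset)
  show "{f \<in> shapes. shape_size f = N}
      \<subseteq> {f. \<forall>i. (i \<in> {..<N} \<longrightarrow> f i \<in> {..N}) \<and> (i \<notin> {..<N} \<longrightarrow> f i = 0)}"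
    by (auto simp: shapes_le_shape_size shapes_eq_0)
  show "finite {f. \<forall>i. (i \<in> {..<N} \<longrightarrow> f i \<in> {..N}) \<and> (i \<notin> {..<N} \<longrightarrow> f i = 0)}"
    by (rule finite_set_of_finite_funs) auto
qed

lemma hstrip_lower_shape: "hstrip f g \<Longrightarrow> f \<in> shapes \<Longrightarrow> g \<in> shapes"
proof -
  assume fg: "hstrip f g" and f: "f \<in> shapes"
  then obtain L where L: "\<forall>i\<ge>L. f i = 0" by (auto simp: shapes_def)
  have "g i \<le> f i" "f (Suc i) \<le> g i" for i using fg by (auto simp: hstrip_def)
  then have "\<forall>i\<ge>L. g i = 0" "g (Suc i) \<le> g i" for i
    using L by (metis le_zero_eq, meson order.trans)
  then show ?thesis by (auto simp: shapes_def antimono_iff_le_Suc)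
qed

lemma hstrip_upper_shape: "hstrip f g \<Longrightarrow> g \<in> shapes \<Longrightarrow> f \<in> shapes"
proof -
  assume fg: "hstrip f g" and g: "g \<in> shapes"
  then obtain L where L: "\<forall>i\<ge>L. g i = 0" by (auto simp: shapes_def)
  have "f i = 0" if "i \<ge> Suc L" for i
    using that fg L by (cases i) (auto simp: hstrip_def, metis le_zero_eq)
  moreover have "antimono f"
    using fg by (auto simp: hstrip_def antimono_iff_le_Suc intro: order.trans)
  ultimately show ?thesis by (auto simp: shapes_def)
qed

lemma shape_size_hstrip_le: "hstrip f g \<Longrightarrow> f \<in> shapes \<Longrightarrow> shape_size g \<le> shape_size f"
  unfolding shape_size_def
  by (rule card_mono[OF finite_fdiag]) (auto simp: hstrip_def fdiag_def intro: less_le_trans)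

lemma finite_hstrip_upper: "g \<in> shapes \<Longrightarrow> finite {f. hstrip f g \<and> P f \<and> shape_size f = N}"
  by (rule finite_subset[OF _ finite_shapes[of N]]) (auto intro: hstrip_upper_shape)

lemma finite_hstrip_lower:
  "f \<in> shapes \<Longrightarrow> finite {g. hstrip f g \<and> shape_size f = shape_size g + b}"
  by (rule finite_subset[OF _ finite_shapes[of "shape_size f - b"]]) (auto intro: hstrip_lower_shape)

text \<open>The local rule of Fomin's growth diagrams: reflecting each row of \<open>f\<close> within the interval
  of its admissible values turns common upper neighbours into common lower neighbours.\<close>

lemma shape_size_local_rule:
  assumes "g \<in> shapes" "h \<in> shapes" "f 0 = max (g 0) (h 0) + i"
    and "\<And>j. f (Suc j) + p j = max (g (Suc j)) (h (Suc j)) + min (g j) (h j)"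
  shows "shape_size f + shape_size p = shape_size g + shape_size h + i"
proof -
  obtain L1 L2 where "\<forall>i\<ge>L1. g i = 0" "\<forall>i\<ge>L2. h i = 0" using assms by (auto simp: shapes_def)
  then obtain L where L: "\<forall>i\<ge>L. g i = 0" "\<forall>i\<ge>L. h i = 0"
    by (metis max.bounded_iff)
  have z: "f (Suc j) = 0 \<and> p j = 0" if "j \<ge> L" for j
    using assms(4)[of j] L that by simp
  have "shape_size f = (\<Sum>j<Suc L. f j)"
    by (rule shape_size_eq) (metis Suc_le_D Suc_le_mono z)
  also have "\<dots> = f 0 + (\<Sum>j<L. f (Suc j))" by (rule sum.lessThan_Suc_shift)
  finally have "shape_size f + shape_size p = f 0 + (\<Sum>j<L. f (Suc j) + p j)"
    using shape_size_eq[of L p] z by (simp add: sum.distrib)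
  \<comment> \<open>The maxima, shifted by one row so far, are re-indexed so that row
    \<open>j\<close> contributes max + min, which is \<open>g j + h j\<close>; at \<open>L\<close>
    both shapes have already ended.\<close>
  also have "\<dots> = i + (\<Sum>j<Suc L. max (g j) (h j)) + (\<Sum>j<L. min (g j) (h j))"
    unfolding sum.lessThan_Suc_shift by (simp add: assms(3,4) sum.distrib)
  also have "\<dots> = i + (\<Sum>j<L. max (g j) (h j) + min (g j) (h j))"
    using L by (simp add: sum.distrib)
  also have "\<dots> = i + (\<Sum>j<L. g j + h j)"
    by (simp add: max_def min_def if_distrib add.commute cong: if_cong)
  finally show ?thesis using shape_size_eq[OF L(1)] shape_size_eq[OF L(2)] by (simp add: sum.distrib)
qed

text \<open>The commutation rule for adding and removing horizontal strips. Row \<open>Suc j\<close>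
  of a common upper neighbour and row \<open>j\<close> of a common lower neighbour range over the
  same interval. Row 0 of \<open>f\<close> is bounded only from below, and its excess over
  \<open>max (g 0) (h 0)\<close> is the index \<open>i\<close>.\<close>

lemma card_local_rule:
  assumes g: "g \<in> shapes" and h: "h \<in> shapes"
  shows "card {f. hstrip f g \<and> hstrip f h \<and> shape_size f = shape_size g + a \<and> shape_size f = shape_size h + b}
    = (\<Sum>i\<le>min a b. card {p. hstrip g p \<and> hstrip h p \<and>
        shape_size g = shape_size p + (b - i) \<and> shape_size h = shape_size p + (a - i)})"
    (is "card ?X = (\<Sum>i\<le>_. card (?Y i))")
proof -
  define M where "M j = max (g (Suc j)) (h (Suc j))" for j
  define N where "N j = min (g j) (h j)" for j
  \<comment> \<open>\<open>M j\<close> and \<open>N j\<close> are the ends of the common interval;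
    inside it the truncated subtraction is exact and \<open>r j\<close> is an involution.\<close>
  define r where "r j x = M j + N j - x" for j x
  define F where "F f = (f 0 - max (g 0) (h 0), \<lambda>j. r j (f (Suc j)))" for f
  define H where "H ip = (\<lambda>j. case j of 0 \<Rightarrow> max (g 0) (h 0) + fst ip | Suc j \<Rightarrow> r j (snd ip j))"
    for ip :: "nat \<times> (nat \<Rightarrow> nat)"
  have M: "M j \<le> x \<longleftrightarrow> g (Suc j) \<le> x \<and> h (Suc j) \<le> x" for j x by (simp add: M_def)
  have N: "x \<le> N j \<longleftrightarrow> x \<le> g j \<and> x \<le> h j" for j x by (simp add: N_def)
  have r: "M j \<le> r j x \<and> r j x \<le> N j \<and> r j x + x = M j + N j \<and> r j (r j x) = x"
    if "M j \<le> x" "x \<le> N j" for j x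
    using that unfolding r_def by linarith
  have FH: "F f \<in> (SIGMA i:{..min a b}. ?Y i) \<and> H (F f) = f" if f: "f \<in> ?X" for f
  proof
    have 0: "max (g 0) (h 0) \<le> f 0" using f by (simp add: hstrip_def)
    have S: "M j \<le> f (Suc j)" "f (Suc j) \<le> N j" for j
      using f by (simp_all add: hstrip_def M N)
    let ?i = "f 0 - max (g 0) (h 0)" and ?p = "\<lambda>j. r j (f (Suc j))"
    have "shape_size f + shape_size ?p = shape_size g + shape_size h + ?i"
    proof (rule shape_size_local_rule[OF g h])
      show "f 0 = max (g 0) (h 0) + ?i" using 0 by linarith
      show "f (Suc j) + ?p j = max (g (Suc j)) (h (Suc j)) + min (g j) (h j)" for j
        using r[OF S[of j]] unfolding M_def N_def by linarith
    qed
    moreover have p: "hstrip g ?p" "hstrip h ?p"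
      using r[OF S] M N by (simp_all add: hstrip_def)
    moreover have "shape_size ?p \<le> shape_size g" "shape_size ?p \<le> shape_size h"
      using p g h by (auto intro: shape_size_hstrip_le)
    moreover have "shape_size f = shape_size g + a" "shape_size f = shape_size h + b" using f by auto
    ultimately have "?i \<le> a" "?i \<le> b" "shape_size g = shape_size ?p + (b - ?i)" "shape_size h = shape_size ?p + (a - ?i)"
      by linarith+
    then show "F f \<in> (SIGMA i:{..min a b}. ?Y i)"
      using p unfolding F_def by (intro SigmaI CollectI conjI) simp_all
    show "H (F f) = f"
    proof
      fix j show "H (F f) j = f j"
      proof (cases j)
        case 0
        then show ?thesis using \<open>max (g 0) (h 0) \<le> f 0\<close> by (simp add: H_def F_def)
      next
        case (Suc i)
        then show ?thesis using r[OF S[of i]] by (simp add: H_def F_def)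
      qed
    qed
  qed
  have HF: "H x \<in> ?X \<and> F (H x) = x" if x: "x \<in> (SIGMA i:{..min a b}. ?Y i)" for x
  proof
    obtain i p where ip: "x = (i, p)" by (cases x)
    have S: "M j \<le> p j" "p j \<le> N j" for j
      using x by (simp_all add: hstrip_def ip M N)
    have Hx: "H x 0 = max (g 0) (h 0) + i" "H x (Suc j) = r j (p j)" for j
      by (simp_all add: H_def ip)
    have "shape_size (H x) + shape_size p = shape_size g + shape_size h + i"
    proof (rule shape_size_local_rule[OF g h])
      show "H x (Suc j) + p j = max (g (Suc j)) (h (Suc j)) + min (g j) (h j)" for j
        using r[OF S[of j]] unfolding M_def N_def Hx by linarith
    qed (rule Hx)
    moreover have "hstrip (H x) g \<and> hstrip (H x) h"
      unfolding hstrip_def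
    proof (intro conjI allI)
      fix j
      show "g j \<le> H x j" "h j \<le> H x j"
        using r[OF S[of "j - 1"]] M by (cases j; simp add: Hx)+
      show "H x (Suc j) \<le> g j" "H x (Suc j) \<le> h j"
        using r[OF S[of j]] N by (simp_all add: Hx)
    qed
    ultimately show "H x \<in> ?X" using x by (auto simp: ip)
    show "F (H x) = x"
      using r[OF S] by (simp add: F_def Hx) (simp add: ip)
  qed
  have "card ?X = card (SIGMA i:{..min a b}. ?Y i)"
    using FH HF by (rule bij_betw_same_card[OF bij_betw_inverses])
  also have "\<dots> = (\<Sum>i\<le>min a b. card (?Y i))"
  proof (rule card_SigmaI)
    show "\<forall>i\<in>{..min a b}. finite (?Y i)"
      by (intro ballI, rule finite_subset[OF _ finite_hstrip_lower[OF g]]) blast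
  qed simp
  finally show ?thesis .
qed

section \<open>Semistandard tableaux and removal of the largest letter\<close>

definition sst :: "(nat \<Rightarrow> nat) \<Rightarrow> nat multiset \<Rightarrow> (nat \<times> nat \<Rightarrow> nat) set" where
  "sst f m = {T \<in> extensional (fdiag f).
     (\<forall>i j j'. j < j' \<and> (i, j') \<in> fdiag f \<longrightarrow> T (i, j) \<le> T (i, j')) \<and>
     (\<forall>i i' j. i < i' \<and> (i', j) \<in> fdiag f \<longrightarrow> T (i, j) < T (i', j)) \<and>
     image_mset T (mset_set (fdiag f)) = m}"

definition kostka :: "(nat \<Rightarrow> nat) \<Rightarrow> nat multiset \<Rightarrow> nat" where
  "kostka f m = card (sst f m)"

lemma finite_sst: "f \<in> shapes \<Longrightarrow> finite (sst f m)"
proof -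
  assume f: "f \<in> shapes"
  have "sst f m \<subseteq> fdiag f \<rightarrow>\<^sub>E set_mset m"
    using finite_fdiag[OF f] by (auto simp: sst_def PiE_def)
  from finite_subset[OF this] finite_fdiag[OF f] show ?thesis by (simp add: finite_PiE)
qed

lemma size_content: "f \<in> shapes \<Longrightarrow> T \<in> sst f m \<Longrightarrow> size m = shape_size f"
  by (auto simp: sst_def shape_size_def)

lemma kostka_eq_0: "f \<in> shapes \<Longrightarrow> size m \<noteq> shape_size f \<Longrightarrow> kostka f m = 0"
  using size_content unfolding kostka_def by (metis card.empty equals0I)

lemma lower_set_eq_lessThan_card:
  fixes S :: "nat set"
  assumes "finite S" "\<And>i j. j \<in> S \<Longrightarrow> i < j \<Longrightarrow> i \<in> S"
  shows "S = {..<card S}"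
proof -
  obtain k where k: "k \<notin> S" "\<And>i. i < k \<Longrightarrow> i \<in> S"
    using ex_new_if_finite[OF infinite_UNIV_nat assms(1)] exists_least_iff[of "\<lambda>k. k \<notin> S"] by blast
  then have "S = {..<k}" using assms(2) by (auto simp: not_less) (metis linorder_neqE_nat)
  then show ?thesis by simp
qed

lemma filter_mset_image_mset: "filter_mset P (image_mset f M) = image_mset f (filter_mset (\<lambda>x. P (f x)) M)"
  by (induction M) auto

lemma image_mset_restrict_mset_set: "image_mset (restrict T D) (mset_set D) = image_mset T (mset_set D)"
  by (cases "finite D") (auto intro: image_mset_cong)

text \<open>Branching rule: in a tableau with entries at most \<open>k\<close> the cells containing
  \<open>k\<close> form a horizontal strip, and deleting them leaves a tableau of the inner shape
  \<open>g\<close>.\<close>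

lemma kostka_rec:
  assumes f: "f \<in> shapes" and m: "\<And>x. x \<in># m \<Longrightarrow> x < k"
  shows "kostka f (m + replicate_mset b k)
    = (\<Sum>g | hstrip f g \<and> shape_size f = shape_size g + b. kostka g m)"
proof -
  let ?G = "{g. hstrip f g \<and> shape_size f = shape_size g + b}"
  let ?m = "m + replicate_mset b k"
  note fin = finite_fdiag[OF f]
  \<comment> \<open>Rows increase weakly, so the entries below \<open>k\<close> in row
    \<open>i\<close> occupy its first \<open>sub T i\<close> cells.\<close>
  define sub where "sub T i = card {j. j < f i \<and> T (i, j) < k}" for T :: "nat \<times> nat \<Rightarrow> nat" and i
  define F where "F T = (sub T, restrict T (fdiag (sub T)))" for T
  define H where "H x = (\<lambda>c\<in>fdiag f. if c \<in> fdiag (fst x) then snd x c else k)"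
    for x :: "(nat \<Rightarrow> nat) \<times> (nat \<times> nat \<Rightarrow> nat)"
  have FH: "F T \<in> (SIGMA g:?G. sst g m) \<and> H (F T) = T" if T: "T \<in> sst f ?m" for T
  proof
    have ext: "T \<in> extensional (fdiag f)"
      and row: "\<And>i j j'. j < j' \<Longrightarrow> (i, j') \<in> fdiag f \<Longrightarrow> T (i, j) \<le> T (i, j')"
      and col: "\<And>i i' j. i < i' \<Longrightarrow> (i', j) \<in> fdiag f \<Longrightarrow> T (i, j) < T (i', j)"
      and cont: "image_mset T (mset_set (fdiag f)) = ?m"
      using T by (auto simp: sst_def)
    have le: "T x \<le> k" if "x \<in> fdiag f" for x
    proof -
      have "T x \<in># ?m" unfolding cont[symmetric] using that fin by simp
      then show ?thesis using m by (auto dest: less_imp_le split: if_splits)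
    qed
    have "{j. j < f i \<and> T (i, j) < k} = {..<sub T i}" for i
      unfolding sub_def by (rule lower_set_eq_lessThan_card)
        (auto simp: fdiag_def dest: le_less_trans[OF row])
    then have sub_iff: "j < sub T i \<longleftrightarrow> j < f i \<and> T (i, j) < k" for i j by blast
    then have Dsub: "fdiag (sub T) = {x \<in> fdiag f. T x < k}" by (auto simp: fdiag_def)
    have hs: "hstrip f (sub T)"
      unfolding hstrip_def
    proof (intro allI conjI)
      fix i
      show "sub T i \<le> f i" using sub_iff by (meson not_less order.irrefl)
      \<comment> \<open>The entry in row \<open>Suc i\<close> is at most \<open>k\<close>, so the
        entry above it is smaller: a cell with another cell below it never contains
        \<open>k\<close>.\<close>
      have "j < sub T i" if j: "j < f (Suc i)" for j
      proof -
        have x: "(Suc i, j) \<in> fdiag f" using j by (simp add: fdiag_def)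
        have "T (i, j) < k" using col[OF _ x, of i] le[OF x] by simp
        then show ?thesis using sub_iff j shapes_le[OF f, of i "Suc i"] by simp
      qed
      then show "f (Suc i) \<le> sub T i" by (meson not_less order.irrefl)
    qed
    then have shape: "sub T \<in> shapes" using f by (rule hstrip_lower_shape)
    have "image_mset T (mset_set (fdiag (sub T))) = filter_mset (\<lambda>x. x < k) ?m"
      unfolding Dsub cont[symmetric] using fin by (simp add: filter_mset_image_mset)
    also have "\<dots> = m"
      using m by (induction b) (auto simp: filter_mset_eq_conv)
    finally have cont': "image_mset T (mset_set (fdiag (sub T))) = m" .
    have "shape_size f = size ?m" "shape_size (sub T) = size m"
      using arg_cong[OF cont, of size] arg_cong[OF cont', of size] by (simp_all add: shape_size_def)
    then have "sub T \<in> ?G" using hs by simp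
    moreover have "restrict T (fdiag (sub T)) \<in> sst (sub T) m"
      unfolding sst_def mem_Collect_eq
    proof (intro conjI allI impI)
      have D: "x \<in> fdiag f" if "x \<in> fdiag (sub T)" for x using that Dsub by blast
      show "restrict T (fdiag (sub T)) (i, j) \<le> restrict T (fdiag (sub T)) (i, j')"
        if "j < j' \<and> (i, j') \<in> fdiag (sub T)" for i j j'
        using that row[of j j' i] D by (auto simp: fdiag_def)
      show "restrict T (fdiag (sub T)) (i, j) < restrict T (fdiag (sub T)) (i', j)"
        if "i < i' \<and> (i', j) \<in> fdiag (sub T)" for i i' j
        using that col[of i i' j] D shapes_le[OF shape, of i i'] by (auto simp: fdiag_def)
      show "image_mset (restrict T (fdiag (sub T))) (mset_set (fdiag (sub T))) = m"
        using cont' by (simp add: image_mset_restrict_mset_set)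
    qed simp
    ultimately show "F T \<in> (SIGMA g:?G. sst g m)" unfolding F_def by (intro SigmaI)
    show "H (F T) = T"
    proof
      fix x show "H (F T) x = T x"
      proof (cases "x \<in> fdiag f")
        case True
        then show ?thesis using le[OF True] by (simp add: H_def F_def Dsub)
      next
        case False
        then show ?thesis using extensional_arb[OF ext] by (simp add: H_def)
      qed
    qed
  qed
  have HF: "H x \<in> sst f ?m \<and> F (H x) = x" if x: "x \<in> (SIGMA g:?G. sst g m)" for x
  proof -
    obtain g T where gT: "x = (g, T)" by (cases x)
    have hs: "hstrip f g" and b: "shape_size f = shape_size g + b" and T: "T \<in> sst g m"
      using x gT by auto
    have g: "g \<in> shapes" using hs f by (rule hstrip_lower_shape)
    have DgD: "fdiag g \<subseteq> fdiag f" using hs by (auto simp: hstrip_def fdiag_def intro: less_le_trans)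
    have ext: "T \<in> extensional (fdiag g)"
      and row: "\<And>i j j'. j < j' \<Longrightarrow> (i, j') \<in> fdiag g \<Longrightarrow> T (i, j) \<le> T (i, j')"
      and col: "\<And>i i' j. i < i' \<Longrightarrow> (i', j) \<in> fdiag g \<Longrightarrow> T (i, j) < T (i', j)"
      and cont: "image_mset T (mset_set (fdiag g)) = m"
      using T by (auto simp: sst_def)
    have less: "T y < k" if "y \<in> fdiag g" for y
      using that m[of "T y"] finite_fdiag[OF g] unfolding cont[symmetric] by simp
    have Hin: "H x y = T y" if "y \<in> fdiag g" for y
      using that DgD by (auto simp: H_def gT)
    have Hout: "H x y = k" if "y \<in> fdiag f" "y \<notin> fdiag g" for y
      using that by (simp add: H_def gT)
    have Hle: "H x y \<le> k" if "y \<in> fdiag f" for y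
    proof (cases "y \<in> fdiag g")
      case True
      then show ?thesis using less[OF True] Hin[OF True] by simp
    qed (use that Hout in simp)
    have "H x \<in> sst f ?m"
      unfolding sst_def mem_Collect_eq
    proof (intro conjI allI impI)
      show "H x \<in> extensional (fdiag f)" by (simp add: H_def)
      show "H x (i, j) \<le> H x (i, j')" if j: "j < j' \<and> (i, j') \<in> fdiag f" for i j j'
      proof (cases "(i, j') \<in> fdiag g")
        case True
        then have "(i, j) \<in> fdiag g" using j by (simp add: fdiag_def)
        with True j row show ?thesis by (simp add: Hin)
      next
        case False
        then have "H x (i, j') = k" using j Hout by blast
        moreover have "(i, j) \<in> fdiag f" using j by (simp add: fdiag_def)
        ultimately show ?thesis using Hle by simp
      qed
      show "H x (i, j) < H x (i', j)" if i: "i < i' \<and> (i', j) \<in> fdiag f" for i i' j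
      proof -
        \<comment> \<open>By interlacing, every cell of \<open>f\<close> that has a cell below it
          lies in \<open>g\<close>, so an added \<open>k\<close> is always at the bottom of its
          column.\<close>
        have "j < f (Suc i)" using i shapes_le[OF f, of "Suc i" i'] by (simp add: fdiag_def)
        also have "f (Suc i) \<le> g i" using hs by (simp add: hstrip_def)
        finally have ij: "(i, j) \<in> fdiag g" by (simp add: fdiag_def)
        show ?thesis
        proof (cases "(i', j) \<in> fdiag g")
          case True
          then show ?thesis using ij i col by (simp add: Hin)
        next
          case False
          then show ?thesis using ij i less Hin Hout by simp
        qed
      qed
      have "mset_set (fdiag f) = mset_set (fdiag g) + mset_set (fdiag f - fdiag g)"
        using DgD fin mset_set_Union[of "fdiag g" "fdiag f - fdiag g"] finite_fdiag[OF g]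
        by (simp add: Un_absorb1 Un_Diff_cancel Diff_disjoint)
      moreover have "image_mset (H x) (mset_set (fdiag g)) = m"
        unfolding cont[symmetric] using finite_fdiag[OF g] by (intro image_mset_cong) (simp add: Hin)
      moreover have "image_mset (H x) (mset_set (fdiag f - fdiag g))
          = image_mset (\<lambda>_. k) (mset_set (fdiag f - fdiag g))"
        using fin by (intro image_mset_cong) (simp add: Hout)
      moreover have "card (fdiag f - fdiag g) = b"
        using card_Diff_subset[OF finite_fdiag[OF g] DgD] b by (simp add: shape_size_def)
      ultimately show "image_mset (H x) (mset_set (fdiag f)) = ?m"
        by (simp add: image_mset_const_eq)
    qed
    moreover have "sub (H x) = g"
    proof
      fix i
      have "{j. j < f i \<and> H x (i, j) < k} = {..<g i}"
      proof safe
        fix j assume "j < f i" "H x (i, j) < k"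
        then show "j < g i" using Hout[of "(i, j)"] by (auto simp: fdiag_def)
      next
        fix j assume "j < g i"
        then have "(i, j) \<in> fdiag g" by (simp add: fdiag_def)
        then show "j < f i" "H x (i, j) < k" using DgD less Hin by (auto simp: fdiag_def)
      qed
      then show "sub (H x) i = g i" by (simp add: sub_def)
    qed
    moreover have "restrict (H x) (fdiag g) = T"
      using Hin ext by (auto simp: fun_eq_iff extensional_def)
    ultimately show ?thesis by (simp add: F_def gT)
  qed
  have "card (sst f ?m) = card (SIGMA g:?G. sst g m)"
    using FH HF by (rule bij_betw_same_card[OF bij_betw_inverses])
  also have "\<dots> = (\<Sum>g\<in>?G. card (sst g m))"
    using finite_hstrip_lower[OF f] hstrip_lower_shape[OF _ f] finite_sst
    by (intro card_SigmaI) auto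
  finally show ?thesis by (simp add: kostka_def)
qed

section \<open>Pieri's rule and the numerical RSK identity\<close>

lemma finite_submsets [simp]: "finite {\<kappa> :: nat multiset. \<kappa> \<subseteq># M \<and> P \<kappa>}"
proof (rule finite_subset)
  show "{\<kappa>. \<kappa> \<subseteq># M \<and> P \<kappa>} \<subseteq> fst ` msplits M"
    by (force simp: msplits_def intro: image_eqI[of _ fst "(x, M - x)" for x])
qed simp

lemma filter_mset_empty_conv: "filter_mset P M = {#} \<longleftrightarrow> (\<forall>x\<in>#M. \<not> P x)"
  by (induction M) auto

text \<open>Submultisets are sorted by their number \<open>i\<close> of copies of \<open>k\<close>.
  This \<open>i\<close> has the same range as the index in \<open>card_local_rule\<close>, so that
  the two sums can be matched term by term.\<close>

lemma sum_subset_mset_split: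
  fixes F :: "nat multiset \<Rightarrow> 'a :: comm_monoid_add"
  assumes m: "\<And>x. x \<in># m \<Longrightarrow> x < k"
  shows "(\<Sum>\<kappa> | \<kappa> \<subseteq># m + replicate_mset b k \<and> size \<kappa> = a. F \<kappa>)
    = (\<Sum>i\<le>min a b. \<Sum>\<kappa> | \<kappa> \<subseteq># m \<and> size \<kappa> = a - i. F (\<kappa> + replicate_mset i k))"
proof -
  let ?S = "SIGMA i:{..min a b}. {\<kappa>. \<kappa> \<subseteq># m \<and> size \<kappa> = a - i}"
  let ?R = "{\<kappa>. \<kappa> \<subseteq># m + replicate_mset b k \<and> size \<kappa> = a}"
  have mk: "k \<notin># m" using m by blast
  define P where "P x = snd x + replicate_mset (fst x) k" for x :: "nat \<times> nat multiset"
  define Q where "Q \<kappa> = (count \<kappa> k, filter_mset (\<lambda>x. x \<noteq> k) \<kappa>)" for \<kappa> :: "nat multiset"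
  have PQ: "P x \<in> ?R \<and> Q (P x) = x" if x: "x \<in> ?S" for x
  proof
    obtain i \<kappa> where i: "x = (i, \<kappa>)" "i \<le> a" "i \<le> b" "\<kappa> \<subseteq># m" "size \<kappa> = a - i" using x by auto
    have "replicate_mset i k \<subseteq># replicate_mset b k" using i(3) by (simp add: subseteq_mset_def)
    then show "P x \<in> ?R" using i by (auto simp: P_def intro: subset_mset.add_mono)
    have "k \<notin># \<kappa>" using mk i(4) mset_subset_eqD by metis
    then have "filter_mset (\<lambda>x. x \<noteq> k) \<kappa> = \<kappa>" "count \<kappa> k = 0"
      by (auto simp: filter_mset_eq_conv) (simp add: not_in_iff)
    moreover have "filter_mset (\<lambda>x. x \<noteq> k) (replicate_mset i k) = {#}"
      by (auto simp: filter_mset_empty_conv)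
    ultimately show "Q (P x) = x" by (simp add: P_def Q_def i(1))
  qed
  have QP: "Q \<kappa> \<in> ?S \<and> P (Q \<kappa>) = \<kappa>" if \<kappa>: "\<kappa> \<in> ?R" for \<kappa>
  proof
    have eq: "filter_mset (\<lambda>x. x \<noteq> k) \<kappa> + replicate_mset (count \<kappa> k) k = \<kappa>"
      by (rule multiset_eqI) auto
    then show "P (Q \<kappa>) = \<kappa>" by (simp add: P_def Q_def)
    have c: "count \<kappa> x \<le> count m x + (if x = k then b else 0)" for x
      using \<kappa> mset_subset_eq_count[of \<kappa> "m + replicate_mset b k" x] by (auto split: if_splits)
    have "count m k = 0" using mk by (simp add: not_in_iff)
    then have "count \<kappa> k \<le> b" using c[of k] by simp
    moreover have "count (filter_mset (\<lambda>x. x \<noteq> k) \<kappa>) x \<le> count m x" for x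
      using c[of x] by (cases "x = k") simp_all
    then have "filter_mset (\<lambda>x. x \<noteq> k) \<kappa> \<subseteq># m" by (rule mset_subset_eqI)
    moreover have "size (filter_mset (\<lambda>x. x \<noteq> k) \<kappa>) + count \<kappa> k = a"
      using arg_cong[OF eq, of size] \<kappa> by simp
    ultimately show "Q \<kappa> \<in> ?S" unfolding Q_def by (intro SigmaI) auto
  qed
  have "(\<Sum>\<kappa>\<in>?R. F \<kappa>) = (\<Sum>x\<in>?S. F (P x))"
    using sum.reindex_bij_betw[OF bij_betw_inverses[of ?S P ?R Q], OF PQ QP, of F] by simp
  also have "\<dots> = (\<Sum>i\<le>min a b. \<Sum>\<kappa> | \<kappa> \<subseteq># m \<and> size \<kappa> = a - i. F (P (i, \<kappa>)))"
    by (simp add: sum.Sigma)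
  finally show ?thesis by (simp add: P_def)
qed

lemma mset_split_largest:
  fixes m :: "nat multiset"
  assumes "\<And>x. x \<in># m \<Longrightarrow> x < Suc k"
  obtains m0 b where "m = m0 + replicate_mset b k" "\<And>x. x \<in># m0 \<Longrightarrow> x < k"
proof
  show "m = filter_mset (\<lambda>x. x \<noteq> k) m + replicate_mset (count m k) k"
    by (rule multiset_eqI) auto
  show "x < k" if "x \<in># filter_mset (\<lambda>x. x \<noteq> k) m" for x
    using that assms[of x] by auto
qed

lemma fdiag_empty_iff: "fdiag f = {} \<longleftrightarrow> f = (\<lambda>_. 0)"
  by (auto simp: fdiag_def fun_eq_iff)

lemma shape_size_zero [simp]: "shape_size (\<lambda>_. 0) = 0"
  by (simp add: shape_size_def fdiag_def)

lemma shape_size_eq_0_iff: "f \<in> shapes \<Longrightarrow> shape_size f = 0 \<longleftrightarrow> f = (\<lambda>_. 0)"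
  using finite_fdiag[of f] by (auto simp: shape_size_def fdiag_empty_iff)

lemma zero_shape [simp]: "(\<lambda>_. 0) \<in> shapes"
  by (auto simp: shapes_def antimono_def)

lemma kostka_empty: "f \<in> shapes \<Longrightarrow> kostka f {#} = (if f = (\<lambda>_. 0) then 1 else 0)"
proof (cases "f = (\<lambda>_. 0)")
  case True
  then have "sst f {#} = {\<lambda>_. undefined}"
    by (auto simp: sst_def fdiag_def)
  with True show ?thesis by (simp add: kostka_def)
next
  case False
  assume f: "f \<in> shapes"
  then have "shape_size f \<noteq> 0"
    using False finite_fdiag[OF f] by (simp add: shape_size_def fdiag_empty_iff)
  with False f show ?thesis by (simp add: kostka_eq_0)
qed

text \<open>The coefficients of the monomial \<open>m\<close> in Pieri's rule \<open>h\<^sub>a s\<^sub>g = \<Sum> s\<^sub>f\<close>.\<close>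

lemma sum_kostka_hstrip:
  assumes "g \<in> shapes" "\<And>x. x \<in># m \<Longrightarrow> x < k"
  shows "(\<Sum>f | hstrip f g \<and> shape_size f = shape_size g + a. kostka f m)
    = (\<Sum>\<kappa> | \<kappa> \<subseteq># m \<and> size \<kappa> = a. kostka g (m - \<kappa>))"
  using assms
proof (induction k arbitrary: g m a)
  case 0
  then have m: "m = {#}" by (metis less_nat_zero_code multiset_nonemptyE)
  have up: "{f. hstrip f g \<and> shape_size f = shape_size g + a} \<subseteq> shapes"
    using hstrip_upper_shape 0(1) by blast
  have "(\<Sum>f | hstrip f g \<and> shape_size f = shape_size g + a. kostka f m)
      = (\<Sum>f | hstrip f g \<and> shape_size f = shape_size g + a. if f = (\<lambda>_. 0) then 1 else 0)"
    unfolding m using up by (intro sum.cong) (auto simp: kostka_empty)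
  also have "\<dots> = (if hstrip (\<lambda>_. 0) g \<and> shape_size g + a = 0 then 1 else 0)"
    using finite_hstrip_upper[OF 0(1), of "\<lambda>_. True"] by (auto simp: sum.delta)
  also have "\<dots> = (if a = 0 \<and> g = (\<lambda>_. 0) then 1 else 0)"
  proof -
    have "hstrip (\<lambda>_. 0) g \<longleftrightarrow> g = (\<lambda>_. 0)" by (auto simp: hstrip_def fun_eq_iff)
    then show ?thesis by auto
  qed
  also have "\<dots> = (\<Sum>\<kappa> | \<kappa> \<subseteq># m \<and> size \<kappa> = a. kostka g (m - \<kappa>))"
  proof -
    have "{\<kappa>. \<kappa> \<subseteq># m \<and> size \<kappa> = a} = (if a = 0 then {{#}} else {})" unfolding m by auto
    then show ?thesis using 0(1) by (simp add: m kostka_empty)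
  qed
  finally show ?case .
next
  case (Suc k)
  note g = Suc.prems(1)
  obtain m0 b where m: "m = m0 + replicate_mset b k" and m0: "\<And>x. x \<in># m0 \<Longrightarrow> x < k"
    using mset_split_largest[OF Suc.prems(2)] by metis
  have m0k: "x \<in># m0 - \<kappa> \<Longrightarrow> x < k" for x \<kappa> using m0 in_diffD by metis
  define U where "U = {f. hstrip f g \<and> shape_size f = shape_size g + a}"
  have U: "f \<in> shapes" if "f \<in> U" for f using that hstrip_upper_shape g by (auto simp: U_def)
  define V where "V = {h \<in> shapes. shape_size h + b = shape_size g + a}"
  have finU: "finite U" unfolding U_def using finite_hstrip_upper[OF g, of "\<lambda>_. True"] by simp
  have finV: "finite V" unfolding V_def
    by (rule finite_subset[OF _ finite_shapes[of "shape_size g + a - b"]]) auto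
  define W where "W i = {p. hstrip g p \<and> shape_size g = shape_size p + (b - i)}" for i
  have finW: "finite (W i)" for i unfolding W_def by (rule finite_hstrip_lower[OF g])
  have W: "p \<in> shapes" if "p \<in> W i" for p i using that hstrip_lower_shape g by (auto simp: W_def)
  \<comment> \<open>Each \<open>f\<close> loses its strip of \<open>b\<close> letters
    \<open>k\<close>, leaving \<open>h\<close>.\<close>
  have "(\<Sum>f\<in>U. kostka f m) = (\<Sum>f\<in>U. \<Sum>h | h \<in> V \<and> hstrip f h. kostka h m0)"
  proof (rule sum.cong[OF refl])
    fix f assume f: "f \<in> U"
    have "{h. hstrip f h \<and> shape_size f = shape_size h + b} = {h \<in> V. hstrip f h}"
      using f hstrip_lower_shape[OF _ U[OF f]] by (auto simp: V_def U_def)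
    then show "kostka f m = (\<Sum>h | h \<in> V \<and> hstrip f h. kostka h m0)"
      unfolding m using kostka_rec[OF U[OF f] m0] by simp
  qed
  also have "\<dots> = (\<Sum>h\<in>V. \<Sum>f | f \<in> U \<and> hstrip f h. kostka h m0)"
    using finU finV by (rule sum.swap_restrict)
  \<comment> \<open>For fixed \<open>h\<close> only the number of shapes \<open>f\<close> above both
    \<open>g\<close> and \<open>h\<close> matters; the local rule counts the shapes \<open>p\<close>
    below both instead.\<close>
  also have "\<dots> = (\<Sum>h\<in>V. \<Sum>i\<le>min a b. card {p \<in> W i. hstrip h p \<and> shape_size h = shape_size p + (a - i)} * kostka h m0)"
  proof (rule sum.cong[OF refl])
    fix h assume h: "h \<in> V"
    have "{f. f \<in> U \<and> hstrip f h} = {f. hstrip f g \<and> hstrip f h \<and> shape_size f = shape_size g + a \<and> shape_size f = shape_size h + b}"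
      using h by (auto simp: U_def V_def)
    then have "card {f. f \<in> U \<and> hstrip f h} = (\<Sum>i\<le>min a b. card {p. hstrip g p \<and> hstrip h p \<and>
        shape_size g = shape_size p + (b - i) \<and> shape_size h = shape_size p + (a - i)})"
      using card_local_rule[OF g, of h a b] h by (simp add: V_def)
    also have "\<dots> = (\<Sum>i\<le>min a b. card {p \<in> W i. hstrip h p \<and> shape_size h = shape_size p + (a - i)})"
      by (intro sum.cong arg_cong[of _ _ card]) (auto simp: W_def)
    finally show "(\<Sum>f | f \<in> U \<and> hstrip f h. kostka h m0)
        = (\<Sum>i\<le>min a b. card {p \<in> W i. hstrip h p \<and> shape_size h = shape_size p + (a - i)} * kostka h m0)"
      by (simp add: sum_distrib_right)
  qed
  also have "\<dots> = (\<Sum>i\<le>min a b. \<Sum>h\<in>V. \<Sum>p | p \<in> W i \<and> (hstrip h p \<and> shape_size h = shape_size p + (a - i)). kostka h m0)"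
    by (subst sum.swap) simp
  also have "\<dots> = (\<Sum>i\<le>min a b. \<Sum>p\<in>W i. \<Sum>h | h \<in> V \<and> (hstrip h p \<and> shape_size h = shape_size p + (a - i)). kostka h m0)"
    using finV finW by (intro sum.cong refl sum.swap_restrict)
  \<comment> \<open>The shapes \<open>h\<close> now range over all extensions of \<open>p\<close> by
    \<open>a - i\<close> cells, filled from \<open>m0\<close>, so the induction hypothesis applies
    to \<open>p\<close>.\<close>
  also have "\<dots> = (\<Sum>i\<le>min a b. \<Sum>p\<in>W i. \<Sum>\<kappa> | \<kappa> \<subseteq># m0 \<and> size \<kappa> = a - i. kostka p (m0 - \<kappa>))"
  proof (intro sum.cong refl)
    fix i p assume i: "i \<in> {..min a b}" and p: "p \<in> W i"
    have "{h. h \<in> V \<and> (hstrip h p \<and> shape_size h = shape_size p + (a - i))}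
        = {h. hstrip h p \<and> shape_size h = shape_size p + (a - i)}"
      using i p hstrip_upper_shape[OF _ W[OF p]] by (auto simp: V_def W_def)
    then show "(\<Sum>h | h \<in> V \<and> (hstrip h p \<and> shape_size h = shape_size p + (a - i)). kostka h m0)
        = (\<Sum>\<kappa> | \<kappa> \<subseteq># m0 \<and> size \<kappa> = a - i. kostka p (m0 - \<kappa>))"
      using Suc.IH[OF W[OF p] m0] by simp
  qed
  also have "\<dots> = (\<Sum>i\<le>min a b. \<Sum>\<kappa> | \<kappa> \<subseteq># m0 \<and> size \<kappa> = a - i. \<Sum>p\<in>W i. kostka p (m0 - \<kappa>))"
    by (intro sum.cong refl sum.swap)
  \<comment> \<open>A strip of \<open>b - i\<close> letters \<open>k\<close> leads from
    \<open>p\<close> back to \<open>g\<close>; the other \<open>i\<close> copies of \<open>k\<close>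
    belong to the removed submultiset.\<close>
  also have "\<dots> = (\<Sum>i\<le>min a b. \<Sum>\<kappa> | \<kappa> \<subseteq># m0 \<and> size \<kappa> = a - i. kostka g (m - (\<kappa> + replicate_mset i k)))"
  proof (intro sum.cong refl)
    fix i \<kappa> assume i: "i \<in> {..min a b}" and \<kappa>: "\<kappa> \<in> {\<kappa>. \<kappa> \<subseteq># m0 \<and> size \<kappa> = a - i}"
    have "m - (\<kappa> + replicate_mset i k) = (m0 - \<kappa>) + replicate_mset (b - i) k"
      using i \<kappa> unfolding m
      by (intro multiset_eqI) (auto simp: subseteq_mset_def)
    then show "(\<Sum>p\<in>W i. kostka p (m0 - \<kappa>)) = kostka g (m - (\<kappa> + replicate_mset i k))"
      using kostka_rec[OF g, of "m0 - \<kappa>" k "b - i"] m0k by (simp add: W_def)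
  qed
  also have "\<dots> = (\<Sum>\<kappa> | \<kappa> \<subseteq># m \<and> size \<kappa> = a. kostka g (m - \<kappa>))"
    unfolding m by (rule sum_subset_mset_split[symmetric, OF m0])
  finally show ?case by (simp add: U_def)
qed

text \<open>A contingency table is split into row \<open>k\<close>, whose multiset of column indices
  is \<kappa>, and the remaining rows.\<close>

lemma card_contingency_rec:
  fixes m :: "nat multiset" and m' :: "nat multiset"
  assumes m: "\<And>x. x \<in># m \<Longrightarrow> x < k"
  shows "card (contingency (m + replicate_mset b k) m')
    = (\<Sum>\<kappa> | \<kappa> \<subseteq># m' \<and> size \<kappa> = b. card (contingency m (m' - \<kappa>)))"
proof -
  let ?S = "SIGMA \<kappa>:{\<kappa>. \<kappa> \<subseteq># m' \<and> size \<kappa> = b}. contingency m (m' - \<kappa>)"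
  define P where "P x = snd x + image_mset (Pair k) (fst x)" for x :: "nat multiset \<times> (nat \<times> nat) multiset"
  define Q where "Q A = (image_mset snd (filter_mset (\<lambda>x. fst x = k) A), filter_mset (\<lambda>x. fst x \<noteq> k) A)"
    for A :: "(nat \<times> nat) multiset"
  have mk: "k \<notin># m" using m by blast
  have PQ: "P x \<in> contingency (m + replicate_mset b k) m' \<and> Q (P x) = x" if x: "x \<in> ?S" for x
  proof
    obtain \<kappa> A where x': "x = (\<kappa>, A)" "\<kappa> \<subseteq># m'" "size \<kappa> = b" "A \<in> contingency m (m' - \<kappa>)"
      using x by auto
    show "P x \<in> contingency (m + replicate_mset b k) m'"
      using x' by (simp add: P_def contingency_def multiset.map_comp comp_def image_mset_const_eq)
    have "fst y \<noteq> k" if "y \<in># A" for y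
      using x'(4) mk that by (auto simp: contingency_def)
    then have "filter_mset (\<lambda>y. fst y = k) A = {#}" "filter_mset (\<lambda>y. fst y \<noteq> k) A = A"
      by (auto simp: filter_mset_eq_conv filter_mset_empty_conv)
    then show "Q (P x) = x"
      by (simp add: P_def Q_def x'(1) filter_mset_image_mset multiset.map_comp comp_def)
  qed
  have QP: "Q A \<in> ?S \<and> P (Q A) = A" if A: "A \<in> contingency (m + replicate_mset b k) m'" for A
  proof
    let ?A = "filter_mset (\<lambda>x. fst x = k) A" and ?A' = "filter_mset (\<lambda>x. fst x \<noteq> k) A"
    have split: "A = ?A + ?A'" by (rule multiset_partition)
    have fstA: "image_mset fst A = m + replicate_mset b k" and sndA: "image_mset snd A = m'"
      using A by (auto simp: contingency_def)
    have "image_mset (\<lambda>x. (k, snd x)) ?A = ?A"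
      by (rule image_mset_cong[of _ _ "\<lambda>x. x", simplified]) auto
    then have "P (Q A) = ?A' + ?A"
      by (simp add: P_def Q_def multiset.map_comp comp_def)
    also have "\<dots> = A" by (metis add.commute split)
    finally show "P (Q A) = A" .
    have "image_mset fst ?A = filter_mset (\<lambda>x. x = k) (m + replicate_mset b k)"
      unfolding fstA[symmetric] by (simp add: filter_mset_image_mset)
    also have "\<dots> = replicate_mset b k"
      using mk by (simp add: filter_eq_replicate_mset not_in_iff)
    finally have "size ?A = b" by (metis size_image_mset size_replicate_mset)
    moreover have "image_mset fst ?A' = filter_mset (\<lambda>x. x \<noteq> k) (m + replicate_mset b k)"
      unfolding fstA[symmetric] by (simp add: filter_mset_image_mset)
    moreover have "filter_mset (\<lambda>x. x \<noteq> k) m = m" "filter_mset (\<lambda>x. x \<noteq> k) (replicate_mset b k) = {#}"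
      using mk by (auto simp: filter_mset_eq_conv filter_mset_empty_conv)
    ultimately have "size ?A = b" "image_mset fst ?A' = m" by simp_all
    moreover have "image_mset snd ?A + image_mset snd ?A' = m'"
      unfolding sndA[symmetric] image_mset_union[symmetric] by (simp only: split[symmetric])
    then have "image_mset snd ?A \<subseteq># m'" "image_mset snd ?A' = m' - image_mset snd ?A"
      by auto
    ultimately show "Q A \<in> ?S"
      unfolding Q_def by (intro SigmaI) (auto simp: contingency_def)
  qed
  have "card (contingency (m + replicate_mset b k) m') = card ?S"
    using PQ QP by (rule bij_betw_same_card[OF bij_betw_inverses, symmetric])
  also have "\<dots> = (\<Sum>\<kappa> | \<kappa> \<subseteq># m' \<and> size \<kappa> = b. card (contingency m (m' - \<kappa>)))"
    by (intro card_SigmaI) auto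
  finally show ?thesis .
qed

text \<open>Removing the strip of the largest letter from the first tableau and exchanging sums
  leaves a sum of \<open>kostka f m'\<close> over the shapes \<open>f\<close> above a fixed
  \<open>g\<close>. Pieri's rule turns it into a choice of \<kappa> inside \<open>m'\<close>, which
  is the recursion of \<open>card_contingency_rec\<close>.\<close>

lemma sum_kostka_prod_bounded:
  assumes "\<And>x. x \<in># m \<Longrightarrow> x < k" "size m = N"
  shows "(\<Sum>f | f \<in> shapes \<and> shape_size f = N. kostka f m * kostka f m') = card (contingency m m')"
  using assms
proof (induction k arbitrary: m m' N)
  case 0
  then have m: "m = {#}" by (metis less_nat_zero_code multiset_nonemptyE)
  then have "N = 0" using 0 by simp
  have "{f \<in> shapes. shape_size f = 0} = {\<lambda>_. 0}"
    by (auto simp: shape_size_eq_0_iff)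
  moreover have "contingency {#} m' = (if m' = {#} then {{#}} else {})"
    by (auto simp: contingency_def)
  moreover have "kostka (\<lambda>_. 0) m' = (if m' = {#} then 1 else 0)"
    by (auto simp: kostka_empty kostka_eq_0)
  ultimately show ?case by (cases "m' = {#}") (simp_all add: m \<open>N = 0\<close> kostka_empty)
next
  case (Suc k)
  obtain m0 b where m: "m = m0 + replicate_mset b k" and m0: "\<And>x. x \<in># m0 \<Longrightarrow> x < k"
    using mset_split_largest[OF Suc.prems(1)] by metis
  have N: "N = size m0 + b" using Suc.prems(2) m by simp
  let ?F = "{f \<in> shapes. shape_size f = N}" and ?G = "{g \<in> shapes. shape_size g = size m0}"
  have "(\<Sum>f\<in>?F. kostka f m * kostka f m')
      = (\<Sum>f\<in>?F. \<Sum>g | g \<in> ?G \<and> hstrip f g. kostka g m0 * kostka f m')"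
  proof (rule sum.cong[OF refl])
    fix f assume f: "f \<in> ?F"
    then have "{g. hstrip f g \<and> shape_size f = shape_size g + b} = {g. g \<in> ?G \<and> hstrip f g}"
      by (auto simp: N intro: hstrip_lower_shape)
    then show "kostka f m * kostka f m' = (\<Sum>g | g \<in> ?G \<and> hstrip f g. kostka g m0 * kostka f m')"
      unfolding m using kostka_rec[of f m0 k b] f m0 by (simp add: sum_distrib_right)
  qed
  also have "\<dots> = (\<Sum>g\<in>?G. \<Sum>f | f \<in> ?F \<and> hstrip f g. kostka g m0 * kostka f m')"
    by (rule sum.swap_restrict) (rule finite_shapes)+
  also have "\<dots> = (\<Sum>g\<in>?G. \<Sum>\<kappa> | \<kappa> \<subseteq># m' \<and> size \<kappa> = b. kostka g m0 * kostka g (m' - \<kappa>))"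
  proof (rule sum.cong[OF refl])
    fix g assume g: "g \<in> ?G"
    have eq: "{f. f \<in> ?F \<and> hstrip f g} = {f. hstrip f g \<and> shape_size f = shape_size g + b}"
      using g by (auto simp: N intro: hstrip_upper_shape)
    have "(\<Sum>f | hstrip f g \<and> shape_size f = shape_size g + b. kostka f m')
        = (\<Sum>\<kappa> | \<kappa> \<subseteq># m' \<and> size \<kappa> = b. kostka g (m' - \<kappa>))"
      using g by (intro sum_kostka_hstrip[of _ _ "Suc (Max (set_mset m'))"]) (auto simp: less_Suc_eq_le)
    then show "(\<Sum>f | f \<in> ?F \<and> hstrip f g. kostka g m0 * kostka f m')
        = (\<Sum>\<kappa> | \<kappa> \<subseteq># m' \<and> size \<kappa> = b. kostka g m0 * kostka g (m' - \<kappa>))"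
      unfolding eq by (simp flip: sum_distrib_left)
  qed
  also have "\<dots> = (\<Sum>\<kappa> | \<kappa> \<subseteq># m' \<and> size \<kappa> = b. \<Sum>g\<in>?G. kostka g m0 * kostka g (m' - \<kappa>))"
    by (rule sum.swap)
  also have "\<dots> = (\<Sum>\<kappa> | \<kappa> \<subseteq># m' \<and> size \<kappa> = b. card (contingency m0 (m' - \<kappa>)))"
    by (intro sum.cong refl Suc.IH m0)
  also have "\<dots> = card (contingency m m')"
    unfolding m by (rule card_contingency_rec[symmetric, OF m0])
  finally show ?case by simp
qed

lemma sum_kostka_prod:
  "(\<Sum>f | f \<in> shapes \<and> shape_size f = size m. kostka f m * kostka f m') = card (contingency m m')"
  by (rule sum_kostka_prod_bounded[of m "Suc (Max (set_mset m))"]) (auto simp: less_Suc_eq_le)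

section \<open>Partitions as shapes and triangularity of the Kostka numbers\<close>

definition row_len :: "nat list \<Rightarrow> nat \<Rightarrow> nat" where
  "row_len \<mu> i = (if i < length \<mu> then \<mu> ! i else 0)"

lemma diagram_eq_fdiag: "diagram \<mu> = fdiag (row_len \<mu>)"
  by (auto simp: diagram_def fdiag_def row_len_def split: if_splits)

lemma row_len_shape: "sorted_wrt (\<ge>) \<mu> \<Longrightarrow> row_len \<mu> \<in> shapes"
  unfolding shapes_def mem_Collect_eq
proof (intro conjI exI[of _ "length \<mu>"])
  assume s: "sorted_wrt (\<ge>) \<mu>"
  show "antimono (row_len \<mu>)"
    unfolding antimono_iff_le_Suc row_len_def
    using s by (auto simp: sorted_wrt_iff_nth_less)
qed (simp add: row_len_def)

lemma shape_size_row_len: "shape_size (row_len \<mu>) = sum_list \<mu>"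
proof -
  have "shape_size (row_len \<mu>) = (\<Sum>i<length \<mu>. row_len \<mu> i)"
    by (rule shape_size_eq) (simp add: row_len_def)
  also have "\<dots> = sum_list \<mu>"
    by (simp add: row_len_def sum_list_sum_nth lessThan_atLeast0)
  finally show ?thesis .
qed

lemma finite_diagram [simp]: "finite (diagram \<mu>)"
  by (rule finite_subset[of _ "SIGMA i:{..<length \<mu>}. {..<\<mu> ! i}"]) (auto simp: diagram_def)

lemma card_diagram: "card (diagram \<mu>) = sum_list \<mu>"
  by (simp add: diagram_eq_fdiag shape_size_row_len flip: shape_size_def)

lemma row_len_nonzero: "0 \<notin> set \<mu> \<Longrightarrow> {i. row_len \<mu> i \<noteq> 0} = {..<length \<mu>}"
  by (auto simp: row_len_def) (metis gr0I nth_mem)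

lemma row_len_inj:
  assumes "0 \<notin> set \<mu>" "0 \<notin> set \<nu>" "row_len \<mu> = row_len \<nu>"
  shows "\<mu> = \<nu>"
proof -
  have len: "length \<mu> = length \<nu>"
    using row_len_nonzero[OF assms(1)] row_len_nonzero[OF assms(2)] assms(3) by (metis lessThan_eq_iff)
  show ?thesis
    using fun_cong[OF assms(3)] len by (intro nth_equalityI) (auto simp: row_len_def split: if_splits, metis)
qed

lemma bij_betw_row_len: "bij_betw row_len (partitions_of n) {f \<in> shapes. shape_size f = n}"
proof (rule bij_betw_imageI)
  show "inj_on row_len (partitions_of n)"
    by (rule inj_onI) (auto simp: partitions_of_def intro: row_len_inj)
  show "row_len ` partitions_of n = {f \<in> shapes. shape_size f = n}"
  proof (intro subset_antisym subsetI)
    fix f assume f: "f \<in> {f \<in> shapes. shape_size f = n}"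
    define L where "L = card {i. f i \<noteq> 0}"
    obtain K where K: "\<forall>i\<ge>K. f i = 0" using f unfolding shapes_def by blast
    have "i < K" if "f i \<noteq> 0" for i using K that by (meson not_le)
    then have "{i. f i \<noteq> 0} \<subseteq> {..<K}" by blast
    then have "finite {i. f i \<noteq> 0}" by (rule finite_subset) simp
    then have "{i. f i \<noteq> 0} = {..<L}"
      unfolding L_def
    proof (rule lower_set_eq_lessThan_card)
      fix i j assume "j \<in> {i. f i \<noteq> 0}" "i < j"
      then show "i \<in> {i. f i \<noteq> 0}" using f shapes_le[of f i j] by auto
    qed
    then have nz: "f i \<noteq> 0 \<longleftrightarrow> i < L" for i by blast
    let ?\<mu> = "map f [0..<L]"
    have row_len: "row_len ?\<mu> = f" using nz by (auto simp: row_len_def fun_eq_iff)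
    have "sorted_wrt (\<ge>) ?\<mu>"
      using f by (auto simp: sorted_wrt_iff_nth_less intro: shapes_le)
    moreover have "0 \<notin> set ?\<mu>"
    proof
      assume "0 \<in> set ?\<mu>"
      then obtain i where "i < L" "f i = 0" by auto
      then show False using nz[of i] by simp
    qed
    moreover have "sum_list ?\<mu> = n" using shape_size_row_len[of ?\<mu>] row_len f by simp
    ultimately have "?\<mu> \<in> partitions_of n" by (simp add: partitions_of_def)
    with row_len show "f \<in> row_len ` partitions_of n" by (metis imageI)
  qed (auto simp: partitions_of_def shape_size_row_len intro: row_len_shape)
qed

lemma mfps_coeff_schur: "mfps_coeff (schur \<mu>) m = of_nat (kostka (row_len \<mu>) m)"
  unfolding schur.rep_eq kostka_def sst_def ssyt_def diagram_eq_fdiag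
  by (intro arg_cong[of _ _ of_nat] arg_cong[of _ _ card]) auto

lemma sum_schur_coeff_prod:
  assumes "size m = n"
  shows "(\<Sum>\<mu>\<in>partitions_of n. kostka (row_len \<mu>) m * kostka (row_len \<mu>) m') = card (contingency m m')"
  using sum.reindex_bij_betw[OF bij_betw_row_len, of "\<lambda>f. kostka f m * kostka f m'" n] sum_kostka_prod[of m m'] assms
  by simp

text \<open>The monomial x^\<mu>, with row indices as variables. Its element sum \<Sum> i * \<mu>_i
  is the statistic that orders partitions in all triangularity arguments.\<close>

definition row_content :: "nat list \<Rightarrow> nat multiset" where
  "row_content \<mu> = image_mset fst (mset_set (diagram \<mu>))"

lemma size_row_content [simp]: "size (row_content \<mu>) = sum_list \<mu>"
  by (simp add: row_content_def card_diagram)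

lemma count_row_content: "count (row_content \<mu>) i = row_len \<mu> i"
proof -
  have "{x \<in> diagram \<mu>. i = fst x} = {i} \<times> {..<row_len \<mu> i}"
    by (auto simp: diagram_def row_len_def split: if_splits)
  moreover have "count (row_content \<mu>) i = (\<Sum>x | x \<in> diagram \<mu> \<and> i = fst x. 1)"
    unfolding row_content_def count_image_mset' by (rule sum.cong) auto
  ultimately show ?thesis by simp
qed

lemma row_content_inj:
  assumes "\<mu> \<in> partitions_of n" "\<nu> \<in> partitions_of n'" "row_content \<mu> = row_content \<nu>"
  shows "\<mu> = \<nu>"
proof (rule row_len_inj)
  show "row_len \<mu> = row_len \<nu>" using assms(3) by (metis count_row_content ext)
qed (use assms in \<open>auto simp: partitions_of_def\<close>)

text \<open>A strictly increasing column of natural numbers starts at 0 or more and grows by at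
  least 1 per row.\<close>

lemma column_strict_ge_row:
  assumes "sorted_wrt (\<ge>) \<mu>"
    and strict: "\<And>i i' j. i < i' \<Longrightarrow> (i', j) \<in> diagram \<mu> \<Longrightarrow> c (i, j) < (c (i', j) :: nat)"
  shows "(i, j) \<in> diagram \<mu> \<Longrightarrow> i \<le> c (i, j)"
proof (induction i)
  case (Suc i)
  have "(i, j) \<in> diagram \<mu>"
    using Suc.prems shapes_le[OF row_len_shape[OF assms(1)], of i "Suc i"]
    by (auto simp: diagram_eq_fdiag fdiag_def)
  then have "i \<le> c (i, j)" by (rule Suc.IH)
  also have "\<dots> < c (Suc i, j)" using Suc.prems by (intro strict) auto
  finally show ?case by simp
qed simp

text \<open>Each entry is at least its row index, so a total not above that of
  \<open>row_content \<mu>\<close> leaves no room for a strict inequality. Applied both to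
  semistandard tableaux and to tableaux whose columns are sorted by a colouring.\<close>

lemma column_strict_eq_row:
  assumes "sorted_wrt (\<ge>) \<mu>"
    and strict: "\<And>i i' j. i < i' \<Longrightarrow> (i', j) \<in> diagram \<mu> \<Longrightarrow> c (i, j) < (c (i', j) :: nat)"
    and le: "sum_mset (image_mset c (mset_set (diagram \<mu>))) \<le> sum_mset (row_content \<mu>)"
    and x: "x \<in> diagram \<mu>"
  shows "c x = fst x"
proof (rule ccontr)
  have ge: "fst y \<le> c y" if "y \<in> diagram \<mu>" for y
    using column_strict_ge_row[OF assms(1), of c "fst y" "snd y"] strict that by simp
  assume "c x \<noteq> fst x"
  with ge[OF x] have "fst x < c x" by simp
  with x ge have "(\<Sum>y\<in>diagram \<mu>. fst y) < (\<Sum>y\<in>diagram \<mu>. c y)"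
    by (intro sum_strict_mono_ex1) auto
  with le show False by (simp add: row_content_def sum_unfold_sum_mset)
qed

text \<open>If the content has an element sum no larger than that of
  \<open>row_content \<mu>\<close>, the rows of the tableau are constant and the content is
  \<open>row_content \<mu>\<close> itself.\<close>

lemma kostka_nonzero_imp:
  assumes \<mu>: "\<mu> \<in> partitions_of n" and \<nu>: "\<nu> \<in> partitions_of n"
    and nz: "kostka (row_len \<mu>) (row_content \<nu>) \<noteq> 0"
  shows "\<mu> = \<nu> \<or> sum_mset (row_content \<mu>) < sum_mset (row_content \<nu>)"
proof (cases "sum_mset (row_content \<mu>) < sum_mset (row_content \<nu>)")
  case False
  obtain T where T: "T \<in> sst (row_len \<mu>) (row_content \<nu>)"
    using nz unfolding kostka_def by (metis card.empty equals0I)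
  have "T x = fst x" if "x \<in> diagram \<mu>" for x
    by (rule column_strict_eq_row[OF _ _ _ that])
      (use \<mu> T False in \<open>auto simp: partitions_of_def sst_def diagram_eq_fdiag\<close>)
  then have "image_mset T (mset_set (diagram \<mu>)) = row_content \<mu>"
    unfolding row_content_def by (intro image_mset_cong) simp
  then have "row_content \<mu> = row_content \<nu>" using T by (simp add: sst_def diagram_eq_fdiag)
  then show ?thesis using row_content_inj[OF \<mu> \<nu>] by blast
qed simp

text \<open>The only such tableau fills row \<open>i\<close> with \<open>i\<close>.\<close>

lemma kostka_row_content_self:
  assumes \<mu>: "\<mu> \<in> partitions_of n"
  shows "kostka (row_len \<mu>) (row_content \<mu>) = 1"
proof -
  have s: "sorted_wrt (\<ge>) \<mu>" using \<mu> by (simp add: partitions_of_def)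
  have "T = restrict fst (diagram \<mu>)" if T: "T \<in> sst (row_len \<mu>) (row_content \<mu>)" for T
  proof
    fix x
    show "T x = restrict fst (diagram \<mu>) x"
    proof (cases "x \<in> diagram \<mu>")
      case True
      have "T x = fst x"
        by (rule column_strict_eq_row[OF s _ _ True])
          (use T in \<open>auto simp: sst_def diagram_eq_fdiag\<close>)
      then show ?thesis using True by simp
    next
      case False
      have "T \<in> extensional (diagram \<mu>)" using T by (simp add: sst_def diagram_eq_fdiag)
      from extensional_arb[OF this False] show ?thesis using False by simp
    qed
  qed
  moreover have "restrict fst (diagram \<mu>) \<in> sst (row_len \<mu>) (row_content \<mu>)"
  proof -
    have "(i, j) \<in> diagram \<mu>" if "(i', j') \<in> diagram \<mu>" "i \<le> i'" "j \<le> j'" for i i' j j'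
      using that shapes_le[OF row_len_shape[OF s], of i i'] by (auto simp: diagram_eq_fdiag fdiag_def)
    then show ?thesis
      unfolding sst_def diagram_eq_fdiag[symmetric]
      by (auto simp: image_mset_restrict_mset_set row_content_def dest: less_imp_le)
  qed
  ultimately have "sst (row_len \<mu>) (row_content \<mu>) = {restrict fst (diagram \<mu>)}" by blast
  then show ?thesis by (simp add: kostka_def)
qed

text \<open>By induction on \<open>N i\<close>: once the rows \<open>k\<close> with \<open>N k < N i\<close> are known, row \<open>i\<close> is read off
  the Gram matrix.\<close>

lemma unitriangular_gram_unique:
  fixes a b :: "'i \<Rightarrow> 'x \<Rightarrow> 'k :: field" and N :: "'i \<Rightarrow> nat"
  assumes I: "finite I" and C: "\<And>i. i \<in> I \<Longrightarrow> C i \<in> X"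
    and a: "\<And>i j. i \<in> I \<Longrightarrow> j \<in> I \<Longrightarrow> a i (C j) \<noteq> 0 \<Longrightarrow> i = j \<or> N i < N j" "\<And>i. i \<in> I \<Longrightarrow> a i (C i) = 1"
    and b: "\<And>i j. i \<in> I \<Longrightarrow> j \<in> I \<Longrightarrow> b i (C j) \<noteq> 0 \<Longrightarrow> i = j \<or> N i < N j" "\<And>i. i \<in> I \<Longrightarrow> b i (C i) = 1"
    and gram: "\<And>i x. i \<in> I \<Longrightarrow> x \<in> X \<Longrightarrow>
      (\<Sum>k\<in>I. a k (C i) * a k x) = (\<Sum>k\<in>I. b k (C i) * b k x)"
    and i: "i \<in> I" and x: "x \<in> X"
  shows "a i x = b i x"
  using i x
proof (induction "N i" arbitrary: i x rule: less_induct)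
  case less
  \<comment> \<open>Triangularity leaves only \<open>k = i\<close>, with factor 1, and indices with
    smaller \<open>N\<close>, which the induction hypothesis covers.\<close>
  have split: "(\<Sum>k\<in>I. c k (C i) * c k x) = c i x + (\<Sum>k | k \<in> I \<and> N k < N i. c k (C i) * c k x)"
    if c: "\<And>k. k \<in> I \<Longrightarrow> c k (C i) \<noteq> 0 \<Longrightarrow> k = i \<or> N k < N i" "c i (C i) = 1" for c :: "'i \<Rightarrow> 'x \<Rightarrow> 'k"
  proof -
    have "(\<Sum>k\<in>I. c k (C i) * c k x) = (\<Sum>k\<in>insert i {k \<in> I. N k < N i}. c k (C i) * c k x)"
      using I less.prems c(1) by (intro sum.mono_neutral_right) auto
    also have "\<dots> = c i x + (\<Sum>k | k \<in> I \<and> N k < N i. c k (C i) * c k x)"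
      using I c(2) by (subst sum.insert) auto
    finally show ?thesis .
  qed
  have eq: "(\<Sum>k | k \<in> I \<and> N k < N i. a k (C i) * a k x) = (\<Sum>k | k \<in> I \<and> N k < N i. b k (C i) * b k x)"
  proof (rule sum.cong[OF refl])
    fix k assume "k \<in> {k \<in> I. N k < N i}"
    then have "k \<in> I" "N k < N i" by auto
    then show "a k (C i) * a k x = b k (C i) * b k x"
      using less.hyps[OF _ _ C[OF less.prems(1)]] less.hyps[OF _ _ less.prems(2)] by presburger
  qed
  have Sa: "(\<Sum>k\<in>I. a k (C i) * a k x) = a i x + (\<Sum>k | k \<in> I \<and> N k < N i. a k (C i) * a k x)"
    by (rule split) (use a less.prems(1) in blast)+
  have Sb: "(\<Sum>k\<in>I. b k (C i) * b k x) = b i x + (\<Sum>k | k \<in> I \<and> N k < N i. b k (C i) * b k x)"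
    by (rule split) (use b less.prems(1) in blast)+
  show ?case
    using gram[OF less.prems] unfolding Sa Sb eq add_right_cancel .
qed

section \<open>Matrices of linear maps\<close>

definition coords :: "('t \<Rightarrow>\<^sub>0 complex) list \<Rightarrow> ('t \<Rightarrow>\<^sub>0 complex) \<Rightarrow> complex vec" where
  "coords bs v = vec (length bs) (\<lambda>i. fvs.representation (set bs) v (bs ! i))"

definition lincomb_list :: "('t \<Rightarrow>\<^sub>0 complex) list \<Rightarrow> complex vec \<Rightarrow> 't \<Rightarrow>\<^sub>0 complex" where
  "lincomb_list bs x = (\<Sum>i<length bs. fscale (x $ i) (bs ! i))"

text \<open>The construction of \<open>specht_rep\<close> for arbitrary maps, so that sums of group
  elements also have a matrix and a trace.\<close>

definition matrix_of :: "('t \<Rightarrow>\<^sub>0 complex) list \<Rightarrow> (('t \<Rightarrow>\<^sub>0 complex) \<Rightarrow> 't \<Rightarrow>\<^sub>0 complex) \<Rightarrow> complex mat" where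
  "matrix_of bs f = mat (length bs) (length bs) (\<lambda>(i, j). fvs.representation (set bs) (f (bs ! j)) (bs ! i))"

definition flinear :: "(('t \<Rightarrow>\<^sub>0 complex) \<Rightarrow> 't \<Rightarrow>\<^sub>0 complex) \<Rightarrow> bool" where
  "flinear f \<longleftrightarrow> (\<forall>u v. f (u + v) = f u + f v) \<and> (\<forall>c v. f (fscale c v) = fscale c (f v))"

lemma flinear_sum:
  assumes "flinear f"
  shows "f (\<Sum>i\<in>I. g i) = (\<Sum>i\<in>I. f (g i))"
proof -
  have "f (fscale 0 0) = fscale 0 (f 0)" using assms by (simp only: flinear_def)
  then have "f 0 = 0" by simp
  then show ?thesis using assms
    by (induction I rule: infinite_finite_induct) (auto simp: flinear_def)
qed

lemma flinear_span:
  assumes "flinear f" "v \<in> fvs.span B" "\<And>b. b \<in> B \<Longrightarrow> f b \<in> fvs.span C"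
  shows "f v \<in> fvs.span C"
  using assms(2)
proof (induction rule: fvs.span_induct_alt)
  case base
  have "f (fscale 0 0) = fscale 0 (f 0)" using assms(1) by (simp only: flinear_def)
  then show ?case by (simp add: fvs.span_zero)
next
  case (step c x y)
  then show ?case using assms(1,3)
    by (simp add: flinear_def fvs.span_add fvs.span_scale)
qed

context
  fixes bs :: "('t \<Rightarrow>\<^sub>0 complex) list"
  assumes dist: "distinct bs" and ind: "fvs.independent (set bs)"
begin

lemma coords_carrier [simp]: "coords bs v \<in> carrier_vec (length bs)"
  by (simp add: coords_def)

lemma matrix_of_carrier [simp]: "matrix_of bs f \<in> carrier_mat (length bs) (length bs)"
  by (simp add: matrix_of_def)

lemma sum_set_nth: "(\<Sum>b\<in>set bs. h b) = (\<Sum>i<length bs. h (bs ! i))"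
  using sum.reindex_bij_betw[OF bij_betw_nth[OF dist refl refl], of h] by simp

lemma lincomb_coords: "v \<in> fvs.span (set bs) \<Longrightarrow> lincomb_list bs (coords bs v) = v"
  using fvs.sum_representation_eq[OF ind, of v "set bs"]
  by (simp add: lincomb_list_def coords_def sum_set_nth)

lemma lincomb_span: "lincomb_list bs x \<in> fvs.span (set bs)"
  unfolding lincomb_list_def by (intro fvs.span_sum fvs.span_scale fvs.span_base) simp

lemma representation_lincomb:
  assumes "\<And>i. i \<in> I \<Longrightarrow> v i \<in> fvs.span (set bs)"
  shows "fvs.representation (set bs) (\<Sum>i\<in>I. fscale (c i) (v i)) b
    = (\<Sum>i\<in>I. c i * fvs.representation (set bs) (v i) b)"
proof -
  have "fvs.representation (set bs) (\<Sum>i\<in>I. fscale (c i) (v i)) b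
      = (\<Sum>i\<in>I. fvs.representation (set bs) (fscale (c i) (v i)) b)"
    by (subst fvs.representation_sum[OF ind]) (auto intro: fvs.span_scale assms)
  also have "\<dots> = (\<Sum>i\<in>I. c i * fvs.representation (set bs) (v i) b)"
    by (intro sum.cong refl) (simp add: fvs.representation_scale[OF ind assms])
  finally show ?thesis .
qed

lemma coords_zero: "coords bs 0 = 0\<^sub>v (length bs)"
  by (auto simp: coords_def fvs.representation_zero)

lemma coords_lincomb:
  assumes x: "x \<in> carrier_vec (length bs)"
  shows "coords bs (lincomb_list bs x) = x"
proof (rule eq_vecI)
  fix i assume "i < dim_vec x"
  then have i: "i < length bs" using x by simp
  have "coords bs (lincomb_list bs x) $ i
      = (\<Sum>j<length bs. x $ j * fvs.representation (set bs) (bs ! j) (bs ! i))"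
    using i by (simp add: coords_def lincomb_list_def)
      (subst representation_lincomb; simp add: fvs.span_base)
  also have "\<dots> = (\<Sum>j<length bs. x $ j * (if j = i then 1 else 0))"
    using i dist
    by (intro sum.cong refl)
      (simp add: fvs.representation_basis[OF ind] nth_eq_iff_index_eq)
  also have "\<dots> = x $ i" using i by (simp add: if_distrib cong: if_cong)
  finally show "coords bs (lincomb_list bs x) $ i = x $ i" .
qed (use x in \<open>simp add: coords_def\<close>)

lemma lincomb_add:
  "x \<in> carrier_vec (length bs) \<Longrightarrow> y \<in> carrier_vec (length bs) \<Longrightarrow>
    lincomb_list bs (x + y) = lincomb_list bs x + lincomb_list bs y"
  by (simp add: lincomb_list_def fvs.scale_left_distrib sum.distrib)

lemma lincomb_scale:
  "x \<in> carrier_vec (length bs) \<Longrightarrow> lincomb_list bs (c \<cdot>\<^sub>v x) = fscale c (lincomb_list bs x)"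
  by (simp add: lincomb_list_def fvs.scale_sum_right)

lemma lincomb_zero: "lincomb_list bs (0\<^sub>v (length bs)) = 0"
  by (simp add: lincomb_list_def)

lemma coords_apply:
  assumes f: "flinear f" and inv: "\<And>b. b \<in> set bs \<Longrightarrow> f b \<in> fvs.span (set bs)"
    and v: "v \<in> fvs.span (set bs)"
  shows "coords bs (f v) = matrix_of bs f *\<^sub>v coords bs v"
proof (rule eq_vecI)
  fix i assume "i < dim_vec (matrix_of bs f *\<^sub>v coords bs v)"
  then have i: "i < length bs" by (simp add: matrix_of_def)
  have "f v = f (\<Sum>j<length bs. fscale (coords bs v $ j) (bs ! j))"
    using lincomb_coords[OF v] by (simp add: lincomb_list_def)
  also have "\<dots> = (\<Sum>j<length bs. fscale (coords bs v $ j) (f (bs ! j)))"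
    using f by (simp add: flinear_sum[OF f]) (simp add: flinear_def)
  finally have "coords bs (f v) $ i
      = (\<Sum>j<length bs. coords bs v $ j * fvs.representation (set bs) (f (bs ! j)) (bs ! i))"
    using i inv by (simp add: coords_def) (subst representation_lincomb; simp)
  also have "\<dots> = (matrix_of bs f *\<^sub>v coords bs v) $ i"
    using i by (auto simp: matrix_of_def scalar_prod_def coords_def lessThan_atLeast0 mult.commute intro!: sum.cong)
  finally show "coords bs (f v) $ i = (matrix_of bs f *\<^sub>v coords bs v) $ i" .
qed (simp add: matrix_of_def coords_def)

lemma matrix_of_comp:
  assumes f: "flinear f" and invf: "\<And>b. b \<in> set bs \<Longrightarrow> f b \<in> fvs.span (set bs)"
    and invg: "\<And>b. b \<in> set bs \<Longrightarrow> g b \<in> fvs.span (set bs)"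
  shows "matrix_of bs (\<lambda>v. f (g v)) = matrix_of bs f * matrix_of bs g"
proof (rule eq_matI)
  fix i j assume "i < dim_row (matrix_of bs f * matrix_of bs g)" "j < dim_col (matrix_of bs f * matrix_of bs g)"
  then have ij: "i < length bs" "j < length bs" by (auto simp: matrix_of_def)
  have "matrix_of bs (\<lambda>v. f (g v)) $$ (i, j) = coords bs (f (g (bs ! j))) $ i"
    using ij by (simp add: matrix_of_def coords_def)
  also have "\<dots> = (matrix_of bs f *\<^sub>v coords bs (g (bs ! j))) $ i"
    using ij by (simp add: coords_apply[OF f invf] invg)
  also have "coords bs (g (bs ! j)) = col (matrix_of bs g) j"
    using ij by (auto simp: matrix_of_def coords_def)
  also have "(matrix_of bs f *\<^sub>v col (matrix_of bs g) j) $ i = (matrix_of bs f * matrix_of bs g) $$ (i, j)"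
    using ij by (simp add: matrix_of_def)
  finally show "matrix_of bs (\<lambda>v. f (g v)) $$ (i, j) = (matrix_of bs f * matrix_of bs g) $$ (i, j)" .
qed (auto simp: matrix_of_def)

lemma matrix_of_id: "matrix_of bs (\<lambda>v. v) = 1\<^sub>m (length bs)"
proof (rule eq_matI)
  fix i j assume "i < dim_row (1\<^sub>m (length bs))" "j < dim_col (1\<^sub>m (length bs))"
  then show "matrix_of bs (\<lambda>v. v) $$ (i, j) = 1\<^sub>m (length bs) $$ (i, j)"
    using dist by (auto simp: matrix_of_def fvs.representation_basis[OF ind] nth_eq_iff_index_eq)
qed (auto simp: matrix_of_def)

lemma trace_matrix_of_sum:
  assumes inv: "\<And>w b. w \<in> W \<Longrightarrow> b \<in> set bs \<Longrightarrow> f w b \<in> fvs.span (set bs)"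
  shows "trace (matrix_of bs (\<lambda>v. \<Sum>w\<in>W. f w v)) = (\<Sum>w\<in>W. trace (matrix_of bs (f w)))"
proof -
  have "trace (matrix_of bs (\<lambda>v. \<Sum>w\<in>W. f w v))
      = (\<Sum>i<length bs. \<Sum>w\<in>W. fvs.representation (set bs) (f w (bs ! i)) (bs ! i))"
    using inv by (simp add: trace_def matrix_of_def fvs.representation_sum[OF ind])
  also have "\<dots> = (\<Sum>w\<in>W. trace (matrix_of bs (f w)))"
    by (subst sum.swap) (simp add: trace_def matrix_of_def)
  finally show ?thesis .
qed

text \<open>Expanding \<open>v\<close> in the basis shows that \<open>f\<close> multiplies
  \<open>v\<close> by the sum of the products of \<open>\<phi> b\<close> and the coordinate of
  \<open>v\<close> at \<open>b\<close>; the trace is the same sum. Used for symmetrisation over a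
  stabilizer, whose image is a line.\<close>

lemma trace_matrix_of_rank_one:
  assumes f: "flinear f" and v: "v \<in> fvs.span (set bs)" "v \<noteq> 0"
    and img: "\<And>b. b \<in> set bs \<Longrightarrow> f b = fscale (\<phi> b) v" and fv: "f v = fscale c v"
  shows "trace (matrix_of bs f) = c"
proof -
  have "trace (matrix_of bs f) = (\<Sum>i<length bs. \<phi> (bs ! i) * coords bs v $ i)"
    using v(1) by (simp add: trace_def matrix_of_def img fvs.representation_scale[OF ind] coords_def)
  moreover have "fscale (\<Sum>i<length bs. \<phi> (bs ! i) * coords bs v $ i) v = fscale c v"
  proof -
    have "f v = f (\<Sum>j<length bs. fscale (coords bs v $ j) (bs ! j))"
      using lincomb_coords[OF v(1)] by (simp add: lincomb_list_def)
    also have "\<dots> = (\<Sum>j<length bs. fscale (coords bs v $ j) (f (bs ! j)))"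
      using f by (simp add: flinear_sum[OF f]) (simp add: flinear_def)
    also have "\<dots> = fscale (\<Sum>i<length bs. \<phi> (bs ! i) * coords bs v $ i) v"
      by (simp add: img fvs.scale_sum_left mult.commute)
    finally show ?thesis unfolding fv by (rule sym)
  qed
  ultimately show ?thesis using v(2) by (metis fvs.scale_cancel_right)
qed

end

section \<open>Specht modules\<close>

text \<open>For the collision argument, in which a transposition both fixes and negates a
  vector.\<close>

lemma fscale_minus_self: "v = fscale (- 1) v \<Longrightarrow> v = 0"
proof (rule poly_mapping_eqI)
  fix k assume v: "v = fscale (- 1) v"
  have "Poly_Mapping.lookup v k = - Poly_Mapping.lookup v k"
    by (subst (1) v) simp
  then show "Poly_Mapping.lookup v k = Poly_Mapping.lookup 0 k" by simp
qed

lemma flinear_scale: "flinear f \<Longrightarrow> f (fscale c v) = fscale c (f v)"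
  by (simp add: flinear_def)

lemma act_superset:
  assumes "finite K" "Poly_Mapping.keys v \<subseteq> K"
  shows "act w v = (\<Sum>T\<in>K. Poly_Mapping.single (perm_tabloid w T) (Poly_Mapping.lookup v T))"
  unfolding act_def using assms
  by (intro sum.mono_neutral_left) (auto simp: in_keys_iff)

lemma fscale_single: "fscale c (Poly_Mapping.single k a) = Poly_Mapping.single k (c * a)"
  by (rule poly_mapping_eqI) (simp add: lookup_single when_def)

lemma flinear_act: "flinear (act w)"
  unfolding flinear_def
proof (intro conjI allI)
  fix u v :: "tabloid \<Rightarrow>\<^sub>0 complex" and c
  let ?K = "Poly_Mapping.keys u \<union> Poly_Mapping.keys v"
  have K: "finite ?K" "Poly_Mapping.keys (u + v) \<subseteq> ?K" "Poly_Mapping.keys u \<subseteq> ?K" "Poly_Mapping.keys v \<subseteq> ?K"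
    by (auto dest: Poly_Mapping.keys_add[THEN subsetD])
  show "act w (u + v) = act w u + act w v"
    unfolding act_superset[OF K(1,2)] act_superset[OF K(1,3)] act_superset[OF K(1,4)]
    by (simp add: lookup_add single_add sum.distrib)
  have "Poly_Mapping.keys (fscale c v) \<subseteq> Poly_Mapping.keys v" by (auto simp: in_keys_iff)
  from act_superset[OF _ this, of w] act_superset[of "Poly_Mapping.keys v" v w]
  show "act w (fscale c v) = fscale c (act w v)"
    by (simp add: fvs.scale_sum_right fscale_single)
qed

lemma act_single: "act w (Poly_Mapping.single T c) = Poly_Mapping.single (perm_tabloid w T) c"
  using act_superset[of "{T}" "Poly_Mapping.single T c" w] by auto

lemma perm_tabloid_comp: "perm_tabloid (u \<circ> v) T = perm_tabloid u (perm_tabloid v T)"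
  by (simp add: perm_tabloid_def image_comp)

lemma act_comp: "act (u \<circ> v) x = act u (act v x)"
proof -
  have "act u (act v x) = (\<Sum>T\<in>Poly_Mapping.keys x. act u (Poly_Mapping.single (perm_tabloid v T) (Poly_Mapping.lookup x T)))"
    unfolding act_def[of v] by (rule flinear_sum[OF flinear_act])
  also have "\<dots> = act (u \<circ> v) x"
    by (simp add: act_single act_def[of "u \<circ> v"] perm_tabloid_comp)
  finally show ?thesis ..
qed

lemma act_id: "act id x = x"
proof (rule poly_mapping_eqI)
  fix T
  have "perm_tabloid id T = T" for T by (simp add: perm_tabloid_def map_idI)
  then show "Poly_Mapping.lookup (act id x) T = Poly_Mapping.lookup x T"
    by (simp add: act_def lookup_sum lookup_single when_def sum.delta in_keys_iff)
qed

lemma lookup_act: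
  assumes "inj w"
  shows "Poly_Mapping.lookup (act w v) (perm_tabloid w T) = Poly_Mapping.lookup v T"
proof -
  have inj: "perm_tabloid w T' = perm_tabloid w T \<longleftrightarrow> T' = T" for T'
    using assms by (simp add: perm_tabloid_def inj_image_eq_iff inj_map_eq_map inj_on_def)
  have "act w v = (\<Sum>T\<in>insert T (Poly_Mapping.keys v). Poly_Mapping.single (perm_tabloid w T) (Poly_Mapping.lookup v T))"
    by (rule act_superset) auto
  then show ?thesis
    by (simp only: lookup_sum lookup_single inj when_def) (subst sum.delta; simp)
qed

section \<open>Tableaux, tabloids and signed column sums\<close>

definition move :: "nat list \<Rightarrow> (nat \<Rightarrow> nat) \<Rightarrow> (nat \<times> nat \<Rightarrow> nat) \<Rightarrow> nat \<times> nat \<Rightarrow> nat" where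
  "move \<mu> w t = (\<lambda>x\<in>diagram \<mu>. w (t x))"

text \<open>This function determines the tabloid of \<open>t\<close>, and it is also a colouring of
  the entries to which straightening can be applied.\<close>

definition row_of :: "nat list \<Rightarrow> (nat \<times> nat \<Rightarrow> nat) \<Rightarrow> nat \<Rightarrow> nat" where
  "row_of \<mu> t x = fst (inv_into (diagram \<mu>) t x)"

abbreviation tabloid_vec :: "nat list \<Rightarrow> (nat \<times> nat \<Rightarrow> nat) \<Rightarrow> tabloid \<Rightarrow>\<^sub>0 complex" where
  "tabloid_vec \<mu> t \<equiv> Poly_Mapping.single (tabloid_of \<mu> t) 1"

definition col_set :: "nat list \<Rightarrow> (nat \<times> nat \<Rightarrow> nat) \<Rightarrow> nat \<Rightarrow> nat set" where
  "col_set \<mu> t j = {t (i, j) | i. (i, j) \<in> diagram \<mu>}"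

text \<open>James' signed column sum of \<open>t\<close>, as an operator on all combinations of
  tabloids; it sends the tabloid of \<open>t\<close> to the polytabloid of \<open>t\<close>.\<close>

definition col_antisym ::
    "nat list \<Rightarrow> (nat \<times> nat \<Rightarrow> nat) \<Rightarrow> (tabloid \<Rightarrow>\<^sub>0 complex) \<Rightarrow> tabloid \<Rightarrow>\<^sub>0 complex" where
  "col_antisym \<mu> t v = (\<Sum>\<pi>\<in>column_stabilizer \<mu> t. fscale (of_int (sign \<pi>)) (act \<pi> v))"

context
  fixes \<mu> :: "nat list" and n :: nat
  assumes \<mu>: "\<mu> \<in> partitions_of n"
begin

lemma sorted_shape: "sorted_wrt (\<ge>) \<mu>" and sum_list_shape: "sum_list \<mu> = n"
  using \<mu> by (auto simp: partitions_of_def)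

lemma tableau_bij: "t \<in> tableaux \<mu> \<Longrightarrow> bij_betw t (diagram \<mu>) {1..n}"
  by (simp add: tableaux_def sum_list_shape)

lemma tableau_in: "t \<in> tableaux \<mu> \<Longrightarrow> x \<in> diagram \<mu> \<Longrightarrow> t x \<in> {1..n}"
  using tableau_bij bij_betwE by blast

lemma tableau_eq_iff: "t \<in> tableaux \<mu> \<Longrightarrow> x \<in> diagram \<mu> \<Longrightarrow> y \<in> diagram \<mu> \<Longrightarrow> t x = t y \<longleftrightarrow> x = y"
  using bij_betw_imp_inj_on[OF tableau_bij] by (metis inj_onD)

lemma tableau_surj:
  assumes "t \<in> tableaux \<mu>" "x \<in> {1..n}"
  obtains y where "y \<in> diagram \<mu>" "t y = x"
  using bij_betw_imp_surj_on[OF tableau_bij[OF assms(1)]] assms(2) by (metis imageE)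

lemma finite_tableaux: "finite (tableaux \<mu>)"
proof (rule finite_subset)
  show "tableaux \<mu> \<subseteq> diagram \<mu> \<rightarrow>\<^sub>E {1..n}"
    using tableau_in by (auto simp: tableaux_def PiE_def)
qed (simp add: finite_PiE)

lemma tableaux_nonempty: "tableaux \<mu> \<noteq> {}"
proof -
  obtain f where f: "bij_betw f (diagram \<mu>) {1..n}"
    using finite_same_card_bij[of "diagram \<mu>" "{1..n}"] card_diagram sum_list_shape by auto
  then have "bij_betw (restrict f (diagram \<mu>)) (diagram \<mu>) {1..n}"
    by (subst bij_betw_cong[of _ _ f]) auto
  then have "restrict f (diagram \<mu>) \<in> tableaux \<mu>"
    by (simp add: tableaux_def sum_list_shape)
  then show ?thesis by blast
qed

lemma move_tableau:
  assumes "w permutes {1..n}" "t \<in> tableaux \<mu>"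
  shows "move \<mu> w t \<in> tableaux \<mu>"
proof -
  have "bij_betw (w \<circ> t) (diagram \<mu>) {1..n}"
    using tableau_bij[OF assms(2)] permutes_imp_bij[OF assms(1)] by (rule bij_betw_trans)
  then have "bij_betw (move \<mu> w t) (diagram \<mu>) {1..n}"
    by (subst bij_betw_cong[of _ _ "w \<circ> t"]) (auto simp: move_def)
  then show ?thesis by (simp add: tableaux_def sum_list_shape move_def)
qed

lemma tableaux_transitive:
  assumes "t \<in> tableaux \<mu>" "s \<in> tableaux \<mu>"
  obtains w where "w permutes {1..n}" "s = move \<mu> w t" "\<And>x. x \<in> diagram \<mu> \<Longrightarrow> w (t x) = s x"
proof -
  let ?w = "\<lambda>x. if x \<in> {1..n} then s (inv_into (diagram \<mu>) t x) else x"
  have "bij_betw (s \<circ> inv_into (diagram \<mu>) t) {1..n} {1..n}"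
    using bij_betw_inv_into[OF tableau_bij[OF assms(1)]] tableau_bij[OF assms(2)] by (rule bij_betw_trans)
  then have "bij_betw ?w {1..n} {1..n}"
    by (subst bij_betw_cong[of _ _ "s \<circ> inv_into (diagram \<mu>) t"]) auto
  then have w: "?w permutes {1..n}" by (rule bij_imp_permutes) auto
  have ws: "?w (t x) = s x" if "x \<in> diagram \<mu>" for x
    using that tableau_in[OF assms(1) that] bij_betw_imp_inj_on[OF tableau_bij[OF assms(1)]] by simp
  have "s = move \<mu> ?w t"
  proof
    fix x
    show "s x = move \<mu> ?w t x"
    proof (cases "x \<in> diagram \<mu>")
      case True
      then show ?thesis using ws[OF True] by (simp add: move_def)
    next
      case False
      have "s \<in> extensional (diagram \<mu>)" using assms(2) by (simp add: tableaux_def)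
      from extensional_arb[OF this False] show ?thesis using False by (simp add: move_def)
    qed
  qed
  with w ws show ?thesis using that by blast
qed

lemma perm_tabloid_of: "perm_tabloid w (tabloid_of \<mu> t) = tabloid_of \<mu> (move \<mu> w t)"
  by (auto simp: perm_tabloid_def tabloid_of_def move_def diagram_def intro!: image_eqI)

lemma row_of_tableau: "t \<in> tableaux \<mu> \<Longrightarrow> x \<in> diagram \<mu> \<Longrightarrow> row_of \<mu> t (t x) = fst x"
  by (simp add: row_of_def inv_into_f_f[OF bij_betw_imp_inj_on[OF tableau_bij]])

text \<open>A tabloid is the list of fibres of \<open>row_of\<close>, so tabloids can be compared
  entry by entry.\<close>

lemma tabloid_of_row_of:
  assumes t: "t \<in> tableaux \<mu>"
  shows "tabloid_of \<mu> t = map (\<lambda>i. {x \<in> {1..n}. row_of \<mu> t x = i}) [0..<length \<mu>]"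
  unfolding tabloid_of_def
proof (rule map_cong[OF refl])
  fix i assume "i \<in> set [0..<length \<mu>]"
  then have i: "(i, j) \<in> diagram \<mu> \<longleftrightarrow> j < \<mu> ! i" for j by (simp add: diagram_def)
  show "{t (i, j) |j. j < \<mu> ! i} = {x \<in> {1..n}. row_of \<mu> t x = i}"
  proof (intro subset_antisym subsetI)
    fix x assume "x \<in> {t (i, j) |j. j < \<mu> ! i}"
    then obtain j where "(i, j) \<in> diagram \<mu>" "x = t (i, j)" using i by blast
    then show "x \<in> {x \<in> {1..n}. row_of \<mu> t x = i}"
      using tableau_in[OF t] row_of_tableau[OF t] by auto
  next
    fix x assume x: "x \<in> {x \<in> {1..n}. row_of \<mu> t x = i}"
    then obtain y where y: "y \<in> diagram \<mu>" "t y = x" using tableau_surj[OF t] by blast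
    then have "fst y = i" using x row_of_tableau[OF t, of y] by simp
    then show "x \<in> {t (i, j) |j. j < \<mu> ! i}" using y i by (cases y) auto
  qed
qed

lemma tabloid_eq_iff:
  assumes t: "t \<in> tableaux \<mu>" and s: "s \<in> tableaux \<mu>"
  shows "tabloid_of \<mu> t = tabloid_of \<mu> s \<longleftrightarrow> (\<forall>x\<in>{1..n}. row_of \<mu> t x = row_of \<mu> s x)"
proof
  assume eq: "tabloid_of \<mu> t = tabloid_of \<mu> s"
  show "\<forall>x\<in>{1..n}. row_of \<mu> t x = row_of \<mu> s x"
  proof
    fix x assume x: "x \<in> {1..n}"
    obtain y where y: "y \<in> diagram \<mu>" "t y = x" using tableau_surj[OF t x] .
    then have i: "row_of \<mu> t x < length \<mu>"
      using row_of_tableau[OF t y(1)] by (auto simp: diagram_def)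
    have "x \<in> tabloid_of \<mu> t ! row_of \<mu> t x" using x i by (simp add: tabloid_of_row_of[OF t])
    then have "x \<in> tabloid_of \<mu> s ! row_of \<mu> t x" unfolding eq .
    then show "row_of \<mu> t x = row_of \<mu> s x" using x i by (simp add: tabloid_of_row_of[OF s])
  qed
next
  assume "\<forall>x\<in>{1..n}. row_of \<mu> t x = row_of \<mu> s x"
  then show "tabloid_of \<mu> t = tabloid_of \<mu> s"
    unfolding tabloid_of_row_of[OF t] tabloid_of_row_of[OF s] by auto
qed

lemma column_stabilizer_iff:
  "\<pi> \<in> column_stabilizer \<mu> t \<longleftrightarrow> \<pi> permutes {1..n} \<and> (\<forall>j. \<pi> ` col_set \<mu> t j = col_set \<mu> t j)"
  by (simp add: column_stabilizer_def col_set_def sum_list_shape Let_def)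

lemma finite_column_stabilizer: "finite (column_stabilizer \<mu> t)"
  by (rule finite_subset[OF _ finite_permutations[of "{1..n}"]]) (auto simp: column_stabilizer_iff)

lemma column_stabilizer_permutes: "\<pi> \<in> column_stabilizer \<mu> t \<Longrightarrow> \<pi> permutes {1..n}"
  by (simp add: column_stabilizer_iff)

lemma id_column_stabilizer: "id \<in> column_stabilizer \<mu> t"
  by (simp add: column_stabilizer_iff permutes_id)

lemma comp_column_stabilizer:
  "\<pi> \<in> column_stabilizer \<mu> t \<Longrightarrow> \<sigma> \<in> column_stabilizer \<mu> t \<Longrightarrow> \<pi> \<circ> \<sigma> \<in> column_stabilizer \<mu> t"
  unfolding column_stabilizer_iff image_comp[symmetric] by (simp add: permutes_compose)

lemma inv_column_stabilizer:
  assumes "\<pi> \<in> column_stabilizer \<mu> t"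
  shows "inv' \<pi> \<in> column_stabilizer \<mu> t"
proof -
  have p: "\<pi> permutes {1..n}" and c: "\<pi> ` col_set \<mu> t j = col_set \<mu> t j" for j
    using assms by (auto simp: column_stabilizer_iff)
  have "inv' \<pi> ` col_set \<mu> t j = inv' \<pi> ` \<pi> ` col_set \<mu> t j" for j by (simp add: c)
  also have "\<dots> j = col_set \<mu> t j" for j
    by (simp add: image_comp permutes_inv_o[OF p])
  finally show ?thesis using permutes_inv[OF p] by (simp add: column_stabilizer_iff)
qed

lemma col_set_move: "col_set \<mu> (move \<mu> w t) j = w ` col_set \<mu> t j"
  by (auto simp: col_set_def move_def)

lemma conj_column_stabilizer:
  assumes w: "w permutes {1..n}" and \<pi>: "\<pi> \<in> column_stabilizer \<mu> t"
  shows "w \<circ> \<pi> \<circ> inv' w \<in> column_stabilizer \<mu> (move \<mu> w t)"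
proof -
  have "(w \<circ> \<pi> \<circ> inv' w) ` w ` A = w ` \<pi> ` A" for A
    by (simp add: image_comp comp_def permutes_inverses[OF w])
  then show ?thesis using \<pi> w
    by (auto simp: column_stabilizer_iff col_set_move permutes_compose permutes_inv)
qed

lemma sum_column_stabilizer_move:
  assumes w: "w permutes {1..n}"
  shows "(\<Sum>\<pi>\<in>column_stabilizer \<mu> (move \<mu> w t). f \<pi>)
    = (\<Sum>\<pi>\<in>column_stabilizer \<mu> t. f (w \<circ> \<pi> \<circ> inv' w))"
proof (rule sum.reindex_bij_betw[symmetric], rule bij_betw_inverses)
  show "w \<circ> \<pi> \<circ> inv' w \<in> column_stabilizer \<mu> (move \<mu> w t) \<and> inv' w \<circ> (w \<circ> \<pi> \<circ> inv' w) \<circ> w = \<pi>"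
    if "\<pi> \<in> column_stabilizer \<mu> t" for \<pi>
    using conj_column_stabilizer[OF w that] by (simp add: fun_eq_iff permutes_inverses[OF w])
  fix \<pi> assume \<pi>: "\<pi> \<in> column_stabilizer \<mu> (move \<mu> w t)"
  have "(inv' w \<circ> \<pi> \<circ> w) ` A = inv' w ` \<pi> ` w ` A" for A by (simp add: image_comp)
  moreover have "inv' w ` w ` A = A" for A by (simp add: image_comp permutes_inv_o[OF w])
  ultimately have "inv' w \<circ> \<pi> \<circ> w \<in> column_stabilizer \<mu> t"
    using \<pi> w by (auto simp: column_stabilizer_iff col_set_move permutes_compose permutes_inv)
  then show "inv' w \<circ> \<pi> \<circ> w \<in> column_stabilizer \<mu> t \<and> w \<circ> (inv' w \<circ> \<pi> \<circ> w) \<circ> inv' w = \<pi>"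
    by (simp add: fun_eq_iff permutes_inverses[OF w])
qed

lemma permutes_permutation: "w permutes {1..n} \<Longrightarrow> permutation w"
  by (auto simp: permutation_permutes)

lemma sign_conj:
  assumes w: "w permutes {1..n}" and \<pi>: "\<pi> permutes {1..n}"
  shows "sign (w \<circ> \<pi> \<circ> inv' w) = sign \<pi>"
proof -
  have p: "permutation w" "permutation \<pi>" "permutation (inv' w)"
    using w \<pi> permutes_inv[OF w] by (auto intro: permutes_permutation)
  show ?thesis
    using p by (simp add: sign_compose permutation_compose sign_inverse mult.commute)
qed

text \<open>\<open>w\<close> conjugates the column stabilizer of \<open>t\<close> into that of the
  moved tableau, and conjugation preserves signs.\<close>

lemma act_polytabloid:
  assumes w: "w permutes {1..n}"
  shows "act w (polytabloid \<mu> t) = polytabloid \<mu> (move \<mu> w t)"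
proof -
  have "act w (polytabloid \<mu> t) = (\<Sum>\<pi>\<in>column_stabilizer \<mu> t.
      Poly_Mapping.single (perm_tabloid w (perm_tabloid \<pi> (tabloid_of \<mu> t))) (of_int (sign \<pi>)))"
    unfolding polytabloid_def by (simp add: flinear_sum[OF flinear_act] act_single)
  also have "\<dots> = (\<Sum>\<pi>\<in>column_stabilizer \<mu> t.
      Poly_Mapping.single (perm_tabloid (w \<circ> \<pi> \<circ> inv' w) (tabloid_of \<mu> (move \<mu> w t)))
        (of_int (sign (w \<circ> \<pi> \<circ> inv' w))))"
  proof (rule sum.cong[OF refl])
    fix \<pi> assume \<pi>: "\<pi> \<in> column_stabilizer \<mu> t"
    have "(w \<circ> \<pi> \<circ> inv' w) \<circ> w = w \<circ> \<pi>" by (simp add: fun_eq_iff permutes_inverses[OF w])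
    then have "perm_tabloid (w \<circ> \<pi> \<circ> inv' w) (tabloid_of \<mu> (move \<mu> w t))
        = perm_tabloid w (perm_tabloid \<pi> (tabloid_of \<mu> t))"
      by (simp only: perm_tabloid_of[symmetric] perm_tabloid_comp[symmetric])
    then show "Poly_Mapping.single (perm_tabloid w (perm_tabloid \<pi> (tabloid_of \<mu> t))) (of_int (sign \<pi>))
        = Poly_Mapping.single (perm_tabloid (w \<circ> \<pi> \<circ> inv' w) (tabloid_of \<mu> (move \<mu> w t)))
          (of_int (sign (w \<circ> \<pi> \<circ> inv' w)) :: complex)"
      using sign_conj[OF w column_stabilizer_permutes[OF \<pi>]] by simp
  qed
  also have "\<dots> = polytabloid \<mu> (move \<mu> w t)"
    unfolding polytabloid_def by (rule sum_column_stabilizer_move[OF w, symmetric])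
  finally show ?thesis .
qed

lemma flinear_col_antisym: "flinear (col_antisym \<mu> t)"
  using flinear_act unfolding flinear_def col_antisym_def
  by (simp add: fvs.scale_right_distrib sum.distrib fvs.scale_sum_right mult.commute)

lemma col_antisym_tabloid: "col_antisym \<mu> t (tabloid_vec \<mu> t) = polytabloid \<mu> t"
  by (simp add: col_antisym_def polytabloid_def act_single fscale_single)

text \<open>Right translation by \<sigma> permutes the column stabilizer and multiplies every sign
  by \<open>sign \<sigma>\<close>.\<close>

lemma col_antisym_act:
  assumes \<sigma>: "\<sigma> \<in> column_stabilizer \<mu> t"
  shows "col_antisym \<mu> t (act \<sigma> v) = fscale (of_int (sign \<sigma>)) (col_antisym \<mu> t v)"
proof -
  have s: "sign (\<pi> \<circ> \<sigma>) * sign \<sigma> = sign \<pi>" if "\<pi> \<in> column_stabilizer \<mu> t" for \<pi>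
    using sign_compose[of \<pi> \<sigma>] \<sigma> that column_stabilizer_permutes permutes_permutation
    by (simp add: mult.assoc)
  have "col_antisym \<mu> t (act \<sigma> v)
      = (\<Sum>\<pi>\<in>column_stabilizer \<mu> t. fscale (of_int (sign \<sigma>)) (fscale (of_int (sign (\<pi> \<circ> \<sigma>))) (act (\<pi> \<circ> \<sigma>) v)))"
    unfolding col_antisym_def
    by (intro sum.cong refl) (simp add: act_comp s[symmetric] mult.commute)
  also have "\<dots> = (\<Sum>\<pi>\<in>column_stabilizer \<mu> t. fscale (of_int (sign \<sigma>)) (fscale (of_int (sign \<pi>)) (act \<pi> v)))"
  proof (rule sum.reindex_bij_betw[of "\<lambda>\<pi>. \<pi> \<circ> \<sigma>"], rule bij_betw_inverses[where g = "\<lambda>\<pi>. \<pi> \<circ> inv' \<sigma>"])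
    note p = column_stabilizer_permutes[OF \<sigma>]
    show "\<pi> \<circ> \<sigma> \<in> column_stabilizer \<mu> t \<and> \<pi> \<circ> \<sigma> \<circ> inv' \<sigma> = \<pi>" if "\<pi> \<in> column_stabilizer \<mu> t" for \<pi>
      using comp_column_stabilizer[OF that \<sigma>] by (simp add: fun_eq_iff permutes_inverses[OF p])
    show "\<pi> \<circ> inv' \<sigma> \<in> column_stabilizer \<mu> t \<and> \<pi> \<circ> inv' \<sigma> \<circ> \<sigma> = \<pi>" if "\<pi> \<in> column_stabilizer \<mu> t" for \<pi>
      using comp_column_stabilizer[OF that inv_column_stabilizer[OF \<sigma>]]
      by (simp add: fun_eq_iff permutes_inverses[OF p])
  qed
  finally show ?thesis by (simp add: col_antisym_def fvs.scale_sum_right)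
qed

lemma move_column_stabilizer:
  assumes \<sigma>: "\<sigma> \<in> column_stabilizer \<mu> t"
  shows "column_stabilizer \<mu> (move \<mu> \<sigma> t) = column_stabilizer \<mu> t"
  using \<sigma> by (auto simp: column_stabilizer_iff col_set_move)

lemma polytabloid_move:
  assumes \<sigma>: "\<sigma> \<in> column_stabilizer \<mu> t"
  shows "polytabloid \<mu> (move \<mu> \<sigma> t) = fscale (of_int (sign \<sigma>)) (polytabloid \<mu> t)"
proof -
  have "polytabloid \<mu> (move \<mu> \<sigma> t) = col_antisym \<mu> (move \<mu> \<sigma> t) (act \<sigma> (tabloid_vec \<mu> t))"
    by (simp add: col_antisym_tabloid[symmetric] act_single perm_tabloid_of)
  also have "\<dots> = col_antisym \<mu> t (act \<sigma> (tabloid_vec \<mu> t))"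
    by (simp add: col_antisym_def move_column_stabilizer[OF \<sigma>])
  finally show ?thesis by (simp add: col_antisym_act[OF \<sigma>] col_antisym_tabloid)
qed

lemma transpose_column_stabilizer:
  assumes t: "t \<in> tableaux \<mu>" and D: "(i, j) \<in> diagram \<mu>" "(i', j) \<in> diagram \<mu>"
  shows "transpose (t (i, j)) (t (i', j)) \<in> column_stabilizer \<mu> t"
proof -
  let ?x = "t (i, j)" and ?y = "t (i', j)"
  have xy: "?x \<in> {1..n}" "?y \<in> {1..n}" using tableau_in[OF t] D by auto
  have "transpose ?x ?y ` col_set \<mu> t j' = col_set \<mu> t j'" for j'
  proof -
    have mem: "t (k, j) \<in> col_set \<mu> t j' \<longleftrightarrow> j' = j" if "(k, j) \<in> diagram \<mu>" for k
      using that tableau_eq_iff[OF t] by (auto simp: col_set_def)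
    have "?x \<in> col_set \<mu> t j' \<longleftrightarrow> ?y \<in> col_set \<mu> t j'" using mem D by simp
    then show ?thesis by (simp add: transpose_image_eq)
  qed
  then show ?thesis using xy by (simp add: column_stabilizer_iff permutes_swap_id)
qed

text \<open>Among the rearrangements of \<open>t\<close> within its columns, one maximising
  \<open>\<Sum> i * c (t (i, j))\<close> has no descents.\<close>

lemma ex_sorted_columns:
  fixes c :: "nat \<Rightarrow> nat"
  assumes t: "t \<in> tableaux \<mu>"
    and inj: "\<And>i i' j. i < i' \<Longrightarrow> (i', j) \<in> diagram \<mu> \<Longrightarrow> c (t (i, j)) \<noteq> c (t (i', j))"
  shows "\<exists>\<pi>\<in>column_stabilizer \<mu> t. \<forall>i i' j. i < i' \<longrightarrow> (i', j) \<in> diagram \<mu> \<longrightarrow>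
    c (\<pi> (t (i, j))) < c (\<pi> (t (i', j)))"
proof -
  have lower: "(i, j) \<in> diagram \<mu>" if "i \<le> i'" "(i', j) \<in> diagram \<mu>" for i i' j
    using that shapes_le[OF row_len_shape[OF sorted_shape], of i i'] by (auto simp: diagram_eq_fdiag fdiag_def)
  let ?C = "column_stabilizer \<mu> t"
  define \<Phi> where "\<Phi> \<pi> = (\<Sum>x\<in>diagram \<mu>. fst x * c (\<pi> (t x)))" for \<pi>
  obtain \<pi> where \<pi>: "\<pi> \<in> ?C" and max: "\<And>\<sigma>. \<sigma> \<in> ?C \<Longrightarrow> \<Phi> \<sigma> \<le> \<Phi> \<pi>"
  proof -
    have "Max (\<Phi> ` ?C) \<in> \<Phi> ` ?C"
      using finite_column_stabilizer id_column_stabilizer by (intro Max_in) auto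
    then obtain \<pi> where "\<pi> \<in> ?C" "\<Phi> \<pi> = Max (\<Phi> ` ?C)" by auto
    then show ?thesis using that finite_column_stabilizer by (metis Max_ge finite_imageI imageI)
  qed
  have perm: "\<pi> permutes {1..n}" by (rule column_stabilizer_permutes[OF \<pi>])
  have col: "\<exists>k. (k, j) \<in> diagram \<mu> \<and> \<pi> (t (i, j)) = t (k, j)" if "(i, j) \<in> diagram \<mu>" for i j
  proof -
    have "t (i, j) \<in> col_set \<mu> t j" using that by (auto simp: col_set_def)
    then have "\<pi> (t (i, j)) \<in> col_set \<mu> t j" using \<pi> unfolding column_stabilizer_iff by blast
    then show ?thesis by (auto simp: col_set_def)
  qed
  have "c (\<pi> (t (i, j))) < c (\<pi> (t (i', j)))" if ii: "i < i'" and D': "(i', j) \<in> diagram \<mu>" for i i' j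
  proof (rule ccontr)
    assume "\<not> ?thesis"
    have D: "(i, j) \<in> diagram \<mu>" using lower[of i i' j] ii D' by simp
    let ?x = "t (i, j)" and ?y = "t (i', j)"
    have xy: "?x \<noteq> ?y" using tableau_eq_iff[OF t D D'] ii by simp
    obtain k k' where k: "(k, j) \<in> diagram \<mu>" "\<pi> ?x = t (k, j)" "(k', j) \<in> diagram \<mu>" "\<pi> ?y = t (k', j)"
      using col[OF D] col[OF D'] by blast
    \<comment> \<open>\<open>inj\<close> speaks of the colours of \<open>t\<close>; since \<pi>
      keeps both entries in column \<open>j\<close>, it separates the colours of their images as
      well.\<close>
    have "\<pi> ?x \<noteq> \<pi> ?y" using xy permutes_inj[OF perm] by (metis injD)
    then have "k \<noteq> k'" using k by auto
    then have "c (\<pi> ?x) \<noteq> c (\<pi> ?y)"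
      using inj[of k k' j] inj[of k' k j] k by (metis linorder_neqE_nat)
    with \<open>\<not> ?thesis\<close> have gt: "c (\<pi> ?y) < c (\<pi> ?x)" by simp
    \<comment> \<open>Exchanging the two entries in the wrong order raises \<open>\<Phi>\<close> by
      i' - i times their colour difference, against maximality.\<close>
    let ?\<sigma> = "\<pi> \<circ> transpose ?x ?y"
    have "?\<sigma> \<in> ?C" using comp_column_stabilizer[OF \<pi> transpose_column_stabilizer[OF t D D']] .
    then have "\<Phi> ?\<sigma> \<le> \<Phi> \<pi>" by (rule max)
    moreover have "\<Phi> \<pi> < \<Phi> ?\<sigma>"
    proof -
      let ?R = "diagram \<mu> - {(i, j), (i', j)}"
      have split: "\<Phi> \<tau> = (i * c (\<tau> ?x) + i' * c (\<tau> ?y)) + (\<Sum>x\<in>?R. fst x * c (\<tau> (t x)))" for \<tau>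
      proof -
        have "\<Phi> \<tau> = (\<Sum>x\<in>{(i, j), (i', j)}. fst x * c (\<tau> (t x))) + (\<Sum>x\<in>?R. fst x * c (\<tau> (t x)))"
          unfolding \<Phi>_def using D D' by (subst add.commute, intro sum.subset_diff) auto
        also have "(\<Sum>x\<in>{(i, j), (i', j)}. fst x * c (\<tau> (t x))) = i * c (\<tau> ?x) + i' * c (\<tau> ?y)"
          using ii by simp
        finally show ?thesis .
      qed
      have R: "(\<Sum>x\<in>?R. fst x * c (?\<sigma> (t x))) = (\<Sum>x\<in>?R. fst x * c (\<pi> (t x)))"
      proof (rule sum.cong[OF refl])
        fix x assume "x \<in> ?R"
        then have "t x \<noteq> ?x" "t x \<noteq> ?y"
          using tableau_eq_iff[OF t _ D, of x] tableau_eq_iff[OF t _ D', of x] by auto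
        then show "fst x * c (?\<sigma> (t x)) = fst x * c (\<pi> (t x))" by (simp add: transpose_def)
      qed
      have "i * c (\<pi> ?x) + i' * c (\<pi> ?y) < i * c (\<pi> ?y) + i' * c (\<pi> ?x)"
      proof -
        obtain d where d: "i' = i + Suc d" using less_imp_Suc_add[OF ii] by auto
        show ?thesis using gt unfolding d by (simp add: algebra_simps) (simp add: add_less_le_mono)
      qed
      then show ?thesis unfolding split R by simp
    qed
    ultimately show False by simp
  qed
  with \<pi> show ?thesis by blast
qed

section \<open>Straightening and its consequences for polytabloids\<close>

text \<open>Two equal colours in a column give a transposition that respects the colouring but
  changes signs. Otherwise the columns can be sorted strictly, and the bound on the colour sum makes
  every colour its row index. The colours will be the rows of a second tableau, or a colouring of
  small content.\<close>

lemma collision_or_straighten: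
  fixes c :: "nat \<Rightarrow> nat"
  assumes t: "t \<in> tableaux \<mu>"
    and le: "sum_mset (image_mset c (mset_set {1..n})) \<le> sum_mset (row_content \<mu>)"
  obtains (collision) x y where "x \<noteq> y" "c x = c y" "x \<in> {1..n}" "y \<in> {1..n}"
      "transpose x y \<in> column_stabilizer \<mu> t"
    | (straighten) \<pi> where "\<pi> \<in> column_stabilizer \<mu> t" "\<And>x. x \<in> diagram \<mu> \<Longrightarrow> c (\<pi> (t x)) = fst x"
proof (cases "\<exists>i i' j. i < i' \<and> (i', j) \<in> diagram \<mu> \<and> c (t (i, j)) = c (t (i', j))")
  case True
  then obtain i i' j where *: "i < i'" "(i', j) \<in> diagram \<mu>" "c (t (i, j)) = c (t (i', j))" by blast
  then have D: "(i, j) \<in> diagram \<mu>"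
    using shapes_le[OF row_len_shape[OF sorted_shape], of i i'] by (auto simp: diagram_eq_fdiag fdiag_def)
  show ?thesis
    by (rule collision[of "t (i, j)" "t (i', j)"])
      (use * D tableau_eq_iff[OF t D *(2)] tableau_in[OF t] transpose_column_stabilizer[OF t D *(2)] in auto)
next
  case False
  then obtain \<pi> where \<pi>: "\<pi> \<in> column_stabilizer \<mu> t"
    "\<forall>i i' j. i < i' \<longrightarrow> (i', j) \<in> diagram \<mu> \<longrightarrow> c (\<pi> (t (i, j))) < c (\<pi> (t (i', j)))"
    using ex_sorted_columns[OF t, of c] by blast
  have "bij_betw (\<lambda>x. \<pi> (t x)) (diagram \<mu>) {1..n}"
    using bij_betw_trans[OF tableau_bij[OF t] permutes_imp_bij[OF column_stabilizer_permutes[OF \<pi>(1)]]]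
    by (simp add: comp_def)
  then have "mset_set {1..n} = image_mset (\<lambda>x. \<pi> (t x)) (mset_set (diagram \<mu>))"
    using image_mset_mset_set[OF bij_betw_imp_inj_on] bij_betw_imp_surj_on by metis
  then have "image_mset (\<lambda>x. c (\<pi> (t x))) (mset_set (diagram \<mu>)) = image_mset c (mset_set {1..n})"
    by (simp add: multiset.map_comp comp_def)
  then have "c (\<pi> (t x)) = fst x" if "x \<in> diagram \<mu>" for x
    using le \<pi>(2) that sorted_shape
    by (intro column_strict_eq_row[of \<mu> "\<lambda>x. c (\<pi> (t x))"]) auto
  with \<pi>(1) show ?thesis by (rule straighten)
qed

lemma row_of_move:
  assumes w: "w permutes {1..n}" and t: "t \<in> tableaux \<mu>" and x: "x \<in> {1..n}"
  shows "row_of \<mu> (move \<mu> w t) (w x) = row_of \<mu> t x"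
proof -
  obtain y where y: "y \<in> diagram \<mu>" "t y = x" using tableau_surj[OF t x] .
  have "row_of \<mu> (move \<mu> w t) (move \<mu> w t y) = fst y"
    by (rule row_of_tableau[OF move_tableau[OF w t] y(1)])
  then show ?thesis using y row_of_tableau[OF t y(1)] by (simp add: move_def)
qed

lemma tabloid_move_eq:
  assumes w: "w permutes {1..n}" and t: "t \<in> tableaux \<mu>"
    and inv: "\<And>x. x \<in> {1..n} \<Longrightarrow> row_of \<mu> t (w x) = row_of \<mu> t x"
  shows "tabloid_of \<mu> (move \<mu> w t) = tabloid_of \<mu> t"
  unfolding tabloid_eq_iff[OF move_tableau[OF w t] t]
proof
  fix x assume "x \<in> {1..n}"
  then obtain y where y: "y \<in> {1..n}" "x = w y"
    using permutes_image[OF w] by (metis imageE)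
  then show "row_of \<mu> (move \<mu> w t) x = row_of \<mu> t x"
    using row_of_move[OF w t y(1)] inv[OF y(1)] by simp
qed

lemma row_of_content:
  assumes t: "t \<in> tableaux \<mu>"
  shows "image_mset (row_of \<mu> t) (mset_set {1..n}) = row_content \<mu>"
proof -
  have "mset_set {1..n} = image_mset t (mset_set (diagram \<mu>))"
    using image_mset_mset_set[OF bij_betw_imp_inj_on] bij_betw_imp_surj_on tableau_bij[OF t] by metis
  then show ?thesis
    unfolding row_content_def
    by (simp add: multiset.map_comp) (intro image_mset_cong, simp add: row_of_tableau[OF t])
qed

text \<open>Straightening with the rows of \<open>s\<close> as colours: a collision makes the image
  its own negative, and otherwise \<open>s\<close> has the same tabloid as a column rearrangement of
  \<open>t\<close>.\<close>

lemma col_antisym_tabloid_vec: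
  assumes t: "t \<in> tableaux \<mu>" and s: "s \<in> tableaux \<mu>"
  shows "col_antisym \<mu> t (tabloid_vec \<mu> s) \<in> fvs.span {polytabloid \<mu> t}"
proof -
  have "sum_mset (image_mset (row_of \<mu> s) (mset_set {1..n})) \<le> sum_mset (row_content \<mu>)"
    by (simp only: row_of_content[OF s] order.refl)
  from t this show ?thesis
  proof (cases rule: collision_or_straighten)
    case (collision x y)
    let ?\<tau> = "transpose x y"
    have \<tau>: "?\<tau> permutes {1..n}" using collision(3,4) by (rule permutes_swap_id)
    have "row_of \<mu> s (?\<tau> z) = row_of \<mu> s z" for z using collision(2) by (simp add: transpose_def)
    then have "tabloid_of \<mu> (move \<mu> ?\<tau> s) = tabloid_of \<mu> s"
      by (intro tabloid_move_eq[OF \<tau> s])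
    then have "col_antisym \<mu> t (tabloid_vec \<mu> s) = col_antisym \<mu> t (act ?\<tau> (tabloid_vec \<mu> s))"
      by (simp add: act_single perm_tabloid_of)
    also have "\<dots> = fscale (- 1) (col_antisym \<mu> t (tabloid_vec \<mu> s))"
      using collision(1) by (simp add: col_antisym_act[OF collision(5)] sign_swap_id)
    finally have "col_antisym \<mu> t (tabloid_vec \<mu> s) = 0" by (rule fscale_minus_self)
    then show ?thesis by (simp add: fvs.span_zero)
  next
    case (straighten \<pi>)
    note p = column_stabilizer_permutes[OF straighten(1)]
    note mt = move_tableau[OF p t]
    have "tabloid_of \<mu> (move \<mu> \<pi> t) = tabloid_of \<mu> s"
      unfolding tabloid_eq_iff[OF mt s]
    proof
      fix x assume "x \<in> {1..n}"
      then obtain y where y: "y \<in> diagram \<mu>" "move \<mu> \<pi> t y = x" using tableau_surj[OF mt] by metis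
      then show "row_of \<mu> (move \<mu> \<pi> t) x = row_of \<mu> s x"
        using row_of_tableau[OF mt y(1)] straighten(2)[OF y(1)] by (simp add: move_def)
    qed
    then have "col_antisym \<mu> t (tabloid_vec \<mu> s) = col_antisym \<mu> t (act \<pi> (tabloid_vec \<mu> t))"
      by (simp add: act_single perm_tabloid_of)
    also have "\<dots> = fscale (of_int (sign \<pi>)) (polytabloid \<mu> t)"
      by (simp add: col_antisym_act[OF straighten(1)] col_antisym_tabloid)
    finally show ?thesis by (simp add: fvs.span_scale fvs.span_base)
  qed
qed

lemma polytabloid_in_span_tabloids:
  assumes t: "t \<in> tableaux \<mu>"
  shows "polytabloid \<mu> t \<in> fvs.span (tabloid_vec \<mu> ` tableaux \<mu>)"
  unfolding polytabloid_def
proof (rule fvs.span_sum)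
  fix \<pi> assume \<pi>: "\<pi> \<in> column_stabilizer \<mu> t"
  have "Poly_Mapping.single (perm_tabloid \<pi> (tabloid_of \<mu> t)) (of_int (sign \<pi>))
      = fscale (of_int (sign \<pi>)) (tabloid_vec \<mu> (move \<mu> \<pi> t))"
    by (simp add: fscale_single perm_tabloid_of)
  also have "\<dots> \<in> fvs.span (tabloid_vec \<mu> ` tableaux \<mu>)"
    using move_tableau[OF column_stabilizer_permutes[OF \<pi>] t]
    by (intro fvs.span_scale fvs.span_base) blast
  finally show "Poly_Mapping.single (perm_tabloid \<pi> (tabloid_of \<mu> t)) (of_int (sign \<pi>))
      \<in> fvs.span (tabloid_vec \<mu> ` tableaux \<mu>)" .
qed

text \<open>By linearity from tabloids. That the image lies on the line of one polytabloid is what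
  leaves an invariant subspace only the extreme cases.\<close>

lemma col_antisym_specht:
  assumes t: "t \<in> tableaux \<mu>" and u: "u \<in> specht \<mu>"
  shows "col_antisym \<mu> t u \<in> fvs.span {polytabloid \<mu> t}"
proof (rule flinear_span[OF flinear_col_antisym])
  show "u \<in> fvs.span (polytabloid \<mu> ` tableaux \<mu>)" using u by (simp add: specht_def)
  fix b assume "b \<in> polytabloid \<mu> ` tableaux \<mu>"
  then obtain s where s: "s \<in> tableaux \<mu>" "b = polytabloid \<mu> s" by blast
  show "col_antisym \<mu> t b \<in> fvs.span {polytabloid \<mu> t}"
    unfolding s(2)
    by (rule flinear_span[OF flinear_col_antisym polytabloid_in_span_tabloids[OF s(1)]])
      (use col_antisym_tabloid_vec[OF t] in blast)
qed

lemma lookup_polytabloid: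
  "Poly_Mapping.lookup (polytabloid \<mu> t) T
    = (\<Sum>\<pi>\<in>column_stabilizer \<mu> t. if perm_tabloid \<pi> (tabloid_of \<mu> t) = T then of_int (sign \<pi>) else 0)"
  by (simp add: polytabloid_def lookup_sum lookup_single when_def)

text \<open>A permutation that preserves both the columns and the rows of \<open>t\<close> fixes
  every entry, so only the identity contributes.\<close>

lemma lookup_polytabloid_self:
  assumes t: "t \<in> tableaux \<mu>"
  shows "Poly_Mapping.lookup (polytabloid \<mu> t) (tabloid_of \<mu> t) = 1"
proof -
  have fix_imp: "\<pi> = id" if \<pi>: "\<pi> \<in> column_stabilizer \<mu> t"
    and eq: "perm_tabloid \<pi> (tabloid_of \<mu> t) = tabloid_of \<mu> t" for \<pi>
  proof
    note p = column_stabilizer_permutes[OF \<pi>]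
    fix x
    show "\<pi> x = id x"
    proof (cases "x \<in> {1..n}")
      case True
      obtain i j where y: "(i, j) \<in> diagram \<mu>" "t (i, j) = x" using tableau_surj[OF t True] by (metis surj_pair)
      have "x \<in> col_set \<mu> t j" using y by (auto simp: col_set_def)
      then have "\<pi> x \<in> col_set \<mu> t j" using \<pi> unfolding column_stabilizer_iff by blast
      then obtain i' where i': "(i', j) \<in> diagram \<mu>" "\<pi> x = t (i', j)" by (auto simp: col_set_def)
      have "\<pi> x \<in> {1..n}" using True permutes_in_image[OF p] by simp
      then have "row_of \<mu> t (\<pi> x) = row_of \<mu> (move \<mu> \<pi> t) (\<pi> x)"
        using eq tabloid_eq_iff[OF move_tableau[OF p t] t] by (simp add: perm_tabloid_of)
      also have "\<dots> = row_of \<mu> t x" by (rule row_of_move[OF p t True])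
      finally have "i' = i"
        using row_of_tableau[OF t y(1)] row_of_tableau[OF t i'(1)] y(2) i'(2) by simp
      then show ?thesis using y(2) i'(2) by simp
    qed (use permutes_not_in[OF p] in simp)
  qed
  have "perm_tabloid id (tabloid_of \<mu> t) = tabloid_of \<mu> t" by (simp add: perm_tabloid_def map_idI)
  then have "Poly_Mapping.lookup (polytabloid \<mu> t) (tabloid_of \<mu> t)
      = (\<Sum>\<pi>\<in>column_stabilizer \<mu> t. if \<pi> = id then 1 else 0)"
    unfolding lookup_polytabloid using fix_imp by (intro sum.cong refl) auto
  also have "\<dots> = 1" using finite_column_stabilizer id_column_stabilizer by simp
  finally show ?thesis .
qed

lemma polytabloid_nonzero: "t \<in> tableaux \<mu> \<Longrightarrow> polytabloid \<mu> t \<noteq> 0"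
  using lookup_polytabloid_self by fastforce

text \<open>The signed column sum is self-adjoint for the bilinear form in which tabloids are
  orthonormal; the right-hand side is the pairing of \<open>u\<close> with the polytabloid.\<close>

lemma lookup_col_antisym_self:
  "Poly_Mapping.lookup (col_antisym \<mu> t u) (tabloid_of \<mu> t)
    = (\<Sum>T\<in>Poly_Mapping.keys u. Poly_Mapping.lookup u T * Poly_Mapping.lookup (polytabloid \<mu> t) T)"
proof -
  let ?C = "column_stabilizer \<mu> t" and ?T = "tabloid_of \<mu> t"
  have "Poly_Mapping.lookup (col_antisym \<mu> t u) ?T
      = (\<Sum>\<pi>\<in>?C. of_int (sign \<pi>) * Poly_Mapping.lookup (act \<pi> u) ?T)"
    by (simp add: col_antisym_def lookup_sum)
  also have "\<dots> = (\<Sum>\<pi>\<in>?C. of_int (sign (inv' \<pi>)) * Poly_Mapping.lookup u (perm_tabloid (inv' \<pi>) ?T))"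
  proof (rule sum.cong[OF refl])
    fix \<pi> assume \<pi>: "\<pi> \<in> ?C"
    note p = column_stabilizer_permutes[OF \<pi>]
    have "perm_tabloid \<pi> (perm_tabloid (inv' \<pi>) ?T) = ?T"
      by (simp add: perm_tabloid_comp[symmetric] permutes_inv_o[OF p]) (simp add: perm_tabloid_def map_idI)
    then have "Poly_Mapping.lookup (act \<pi> u) ?T = Poly_Mapping.lookup u (perm_tabloid (inv' \<pi>) ?T)"
      using lookup_act[OF permutes_inj[OF p], of u "perm_tabloid (inv' \<pi>) ?T"] by simp
    then show "of_int (sign \<pi>) * Poly_Mapping.lookup (act \<pi> u) ?T
        = of_int (sign (inv' \<pi>)) * Poly_Mapping.lookup u (perm_tabloid (inv' \<pi>) ?T)"
      by (simp add: sign_inverse permutes_permutation[OF p])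
  qed
  also have "\<dots> = (\<Sum>\<pi>\<in>?C. of_int (sign \<pi>) * Poly_Mapping.lookup u (perm_tabloid \<pi> ?T))"
    by (rule sum.reindex_bij_betw[of inv'], rule bij_betw_inverses[where g = inv'])
      (use inv_column_stabilizer column_stabilizer_permutes permutes_inv_inv in blast)+
  also have "\<dots> = (\<Sum>\<pi>\<in>?C. \<Sum>T\<in>Poly_Mapping.keys u.
      Poly_Mapping.lookup u T * (if perm_tabloid \<pi> ?T = T then of_int (sign \<pi>) else 0))"
    by (intro sum.cong refl) (simp add: if_distrib in_keys_iff mult.commute cong: if_cong)
  also have "\<dots> = (\<Sum>T\<in>Poly_Mapping.keys u. Poly_Mapping.lookup u T * Poly_Mapping.lookup (polytabloid \<mu> t) T)"
    by (subst sum.swap) (simp add: lookup_polytabloid sum_distrib_left)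
  finally show ?thesis .
qed

text \<open>Polytabloids have integer coefficients, so a vector of the Specht module that is
  orthogonal to all of them is orthogonal to itself for the Hermitian form.\<close>

lemma col_antisym_zero_imp_zero:
  assumes u: "u \<in> specht \<mu>" and z: "\<And>t. t \<in> tableaux \<mu> \<Longrightarrow> col_antisym \<mu> t u = 0"
  shows "u = 0"
proof -
  define B where "B v = (\<Sum>T\<in>Poly_Mapping.keys u. Poly_Mapping.lookup u T * cnj (Poly_Mapping.lookup v T))" for v
  have "B v = 0" if "v \<in> fvs.span (polytabloid \<mu> ` tableaux \<mu>)" for v
    using that
  proof (induction rule: fvs.span_induct_alt)
    case base
    then show ?case by (simp add: B_def)
  next
    case (step c x y)
    then obtain t where t: "t \<in> tableaux \<mu>" "x = polytabloid \<mu> t" by blast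
    have "cnj (Poly_Mapping.lookup x T) = Poly_Mapping.lookup x T" for T
      unfolding t(2) lookup_polytabloid by (simp add: if_distrib[of cnj] cong: if_cong)
    then have "B x = Poly_Mapping.lookup (col_antisym \<mu> t u) (tabloid_of \<mu> t)"
      by (simp add: B_def lookup_col_antisym_self t(2))
    then have "B x = 0" by (simp add: z[OF t(1)])
    moreover have "B (fscale c x + y) = cnj c * B x + B y"
      by (simp add: B_def lookup_add algebra_simps sum.distrib sum_distrib_left)
    ultimately show ?case using step.IH by simp
  qed
  then have "B u = 0" using u by (simp add: specht_def)
  moreover have "B u = of_real (\<Sum>T\<in>Poly_Mapping.keys u. (cmod (Poly_Mapping.lookup u T))\<^sup>2)"
    unfolding B_def of_real_sum complex_norm_square ..
  ultimately have "(\<Sum>T\<in>Poly_Mapping.keys u. (cmod (Poly_Mapping.lookup u T))\<^sup>2) = 0"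
    by (metis of_real_eq_0_iff)
  then have "\<forall>T\<in>Poly_Mapping.keys u. (cmod (Poly_Mapping.lookup u T))\<^sup>2 = 0"
    by (subst (asm) sum_nonneg_eq_0_iff) auto
  then have "Poly_Mapping.lookup u T = 0" for T
    by (cases "T \<in> Poly_Mapping.keys u") (auto simp: in_keys_iff)
  then show ?thesis by (intro poly_mapping_eqI) simp
qed

section \<open>The Specht module as an irreducible representation\<close>

text \<open>Justifies the \<open>SOME\<close>: a maximal independent subset of the finitely many
  polytabloids can be listed.\<close>

lemma specht_basis:
  "distinct (specht_basis \<mu>)" "fvs.independent (set (specht_basis \<mu>))"
  "fvs.span (set (specht_basis \<mu>)) = specht \<mu>"
proof -
  let ?V = "polytabloid \<mu> ` tableaux \<mu>"
  obtain B where B: "B \<subseteq> ?V" "fvs.independent B" "?V \<subseteq> fvs.span B"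
    using fvs.maximal_independent_subset[of ?V] by blast
  have "finite B" using B(1) finite_tableaux by (rule finite_subset[OF _ finite_imageI])
  then obtain bs where bs: "set bs = B" "distinct bs" using finite_distinct_list by blast
  have "fvs.span B = specht \<mu>"
    unfolding specht_def using B fvs.span_mono[OF B(1)] fvs.span_minimal[OF B(3) fvs.subspace_span] by blast
  then have "\<exists>bs. distinct bs \<and> fvs.independent (set bs) \<and> fvs.span (set bs) = specht \<mu>"
    using B bs by blast
  from someI_ex[OF this]
  show "distinct (specht_basis \<mu>)" "fvs.independent (set (specht_basis \<mu>))"
    "fvs.span (set (specht_basis \<mu>)) = specht \<mu>"
    by (simp_all add: specht_basis_def)
qed

lemma act_specht:
  assumes w: "w permutes {1..n}" and v: "v \<in> specht \<mu>"
  shows "act w v \<in> specht \<mu>"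
  unfolding specht_def
  by (rule flinear_span[OF flinear_act v[unfolded specht_def]])
    (use move_tableau[OF w] act_polytabloid[OF w] in \<open>auto intro!: fvs.span_base\<close>)

lemma specht_basis_in: "b \<in> set (specht_basis \<mu>) \<Longrightarrow> b \<in> specht \<mu>"
  using specht_basis(3) fvs.span_base by blast

lemma specht_rep_eq: "specht_rep \<mu> w = matrix_of (specht_basis \<mu>) (act w)"
  by (simp add: specht_rep_def matrix_of_def Let_def)

lemma act_specht_basis:
  "w permutes {1..n} \<Longrightarrow> b \<in> set (specht_basis \<mu>) \<Longrightarrow> act w b \<in> fvs.span (set (specht_basis \<mu>))"
  using act_specht specht_basis_in specht_basis(3) by blast

lemma matrix_rep_specht: "matrix_rep (sym_group n) (length (specht_basis \<mu>)) (specht_rep \<mu>)"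
proof (rule matrix_repI[OF sym_group_is_group])
  fix g h assume gh: "g \<in> carrier (sym_group n)" "h \<in> carrier (sym_group n)"
  then have p: "g permutes {1..n}" "h permutes {1..n}" by (simp_all add: sym_group_simps)
  show "specht_rep \<mu> g \<in> carrier_mat (length (specht_basis \<mu>)) (length (specht_basis \<mu>))"
    by (simp add: specht_rep_eq matrix_of_carrier[OF specht_basis(1,2)])
  have "act (g \<circ> h) = (\<lambda>v. act g (act h v))" by (simp add: fun_eq_iff act_comp)
  then show "specht_rep \<mu> (g \<otimes>\<^bsub>sym_group n\<^esub> h) = specht_rep \<mu> g * specht_rep \<mu> h"
    unfolding sym_group_mult specht_rep_eq
    using matrix_of_comp[OF specht_basis(1,2) flinear_act act_specht_basis[OF p(1)] act_specht_basis[OF p(2)]]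
    by simp
next
  have "act id = (\<lambda>v. v)" by (simp add: fun_eq_iff act_id)
  then show "specht_rep \<mu> \<one>\<^bsub>sym_group n\<^esub> = 1\<^sub>m (length (specht_basis \<mu>))"
    unfolding sym_group_one specht_rep_eq by (simp add: matrix_of_id[OF specht_basis(1,2)])
qed

text \<open>James' submodule argument. If some signed column sum does not kill an invariant
  subspace, the subspace contains a polytabloid and, by transitivity on tableaux, all of them; if
  all of them kill it, it is zero by \<open>col_antisym_zero_imp_zero\<close>.\<close>

lemma irreducible_specht: "irreducible_rep (sym_group n) (length (specht_basis \<mu>)) (specht_rep \<mu>)"
  unfolding irreducible_rep_def
proof (intro conjI allI impI matrix_rep_specht)
  let ?bs = "specht_basis \<mu>"
  let ?d = "length ?bs"
  let ?\<Phi> = "lincomb_list ?bs"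
  note b12 = specht_basis(1,2)
  obtain t0 where t0: "t0 \<in> tableaux \<mu>" using tableaux_nonempty by blast
  have poly_in: "polytabloid \<mu> t \<in> specht \<mu>" if "t \<in> tableaux \<mu>" for t
    using that by (simp add: specht_def fvs.span_base)
  show "0 < ?d"
  proof (rule ccontr)
    assume "\<not> 0 < ?d"
    then have "specht \<mu> = {0}" using specht_basis(3) by simp
    then show False using poly_in[OF t0] polytabloid_nonzero[OF t0] by simp
  qed
  fix W
  assume W: "VectorSpace.subspace class_ring W (module_vec TYPE(complex) ?d) \<and>
    (\<forall>g\<in>carrier (sym_group n). \<forall>v\<in>W. specht_rep \<mu> g *\<^sub>v v \<in> W)"
  then have Wsub: "W \<subseteq> carrier_vec ?d" and W0: "0\<^sub>v ?d \<in> W"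
    and Wadd: "\<And>v w. v \<in> W \<Longrightarrow> w \<in> W \<Longrightarrow> v + w \<in> W"
    and Wscale: "\<And>c v. v \<in> W \<Longrightarrow> c \<cdot>\<^sub>v v \<in> W"
    and Winv: "\<And>g v. g permutes {1..n} \<Longrightarrow> v \<in> W \<Longrightarrow> specht_rep \<mu> g *\<^sub>v v \<in> W"
    unfolding subspace_module_vec_iff by (auto simp: sym_group_simps)
  \<comment> \<open>The subspace of coordinate vectors is carried into the Specht module, where
    \<open>act\<close> and the signed column sums operate.\<close>
  let ?U = "?\<Phi> ` W"
  have U_specht: "u \<in> specht \<mu>" if "u \<in> ?U" for u
    using that lincomb_span[OF b12] specht_basis(3) by auto
  have U_sub: "fvs.subspace ?U"
    unfolding fvs.subspace_def
  proof (intro conjI ballI allI)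
    show "0 \<in> ?U" using lincomb_zero[OF b12] W0 by (metis imageI)
    fix x assume "x \<in> ?U"
    then obtain x' where x': "x' \<in> W" "x = ?\<Phi> x'" by blast
    show "x + y \<in> ?U" if y: "y \<in> ?U" for y
    proof -
      obtain y' where y': "y' \<in> W" "y = ?\<Phi> y'" using y by blast
      have "?\<Phi> (x' + y') = x + y"
        using lincomb_add[OF b12, of x' y'] Wsub x' y' by blast
      then show ?thesis using Wadd[OF x'(1) y'(1)] by (metis imageI)
    qed
    show "fscale c x \<in> ?U" for c
    proof -
      have "?\<Phi> (c \<cdot>\<^sub>v x') = fscale c x"
        using lincomb_scale[OF b12, of x' c] Wsub x' by blast
      then show ?thesis using Wscale[OF x'(1)] by (metis imageI)
    qed
  qed
  have U_act: "act g u \<in> ?U" if g: "g permutes {1..n}" and u: "u \<in> ?U" for g u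
  proof -
    obtain v where v: "v \<in> W" "u = ?\<Phi> v" using u by blast
    have us: "u \<in> fvs.span (set ?bs)" using U_specht[OF u] specht_basis(3) by simp
    have gs: "act g u \<in> fvs.span (set ?bs)" using act_specht[OF g U_specht[OF u]] specht_basis(3) by simp
    have "coords ?bs (act g u) = specht_rep \<mu> g *\<^sub>v coords ?bs u"
      unfolding specht_rep_eq by (rule coords_apply[OF b12 flinear_act act_specht_basis[OF g] us])
    also have "coords ?bs u = v" unfolding v(2) by (rule coords_lincomb[OF b12]) (use v Wsub in blast)
    finally have "?\<Phi> (coords ?bs (act g u)) \<in> ?U" using Winv[OF g v(1)] by simp
    then show ?thesis by (simp only: lincomb_coords[OF b12 gs])
  qed
  show "W = {0\<^sub>v ?d} \<or> W = carrier_vec ?d"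
  proof (cases "\<exists>u\<in>?U. \<exists>t\<in>tableaux \<mu>. col_antisym \<mu> t u \<noteq> 0")
    case True
    then obtain u t where u: "u \<in> ?U" and t: "t \<in> tableaux \<mu>" and nz: "col_antisym \<mu> t u \<noteq> 0" by blast
    have "col_antisym \<mu> t u \<in> ?U"
      unfolding col_antisym_def using U_act[OF column_stabilizer_permutes u]
      by (intro fvs.subspace_sum[OF U_sub] fvs.subspace_scale[OF U_sub])
    moreover obtain c where c: "col_antisym \<mu> t u = fscale c (polytabloid \<mu> t)"
      using col_antisym_specht[OF t U_specht[OF u]] by (auto simp: fvs.span_singleton)
    ultimately have "fscale (inverse c) (fscale c (polytabloid \<mu> t)) \<in> ?U"
      using fvs.subspace_scale[OF U_sub] by metis
    moreover have "c \<noteq> 0" using c nz by auto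
    ultimately have et: "polytabloid \<mu> t \<in> ?U" by simp
    have "polytabloid \<mu> s \<in> ?U" if s: "s \<in> tableaux \<mu>" for s
    proof -
      obtain w where "w permutes {1..n}" "s = move \<mu> w t" using tableaux_transitive[OF t s] by metis
      then show ?thesis using U_act[OF _ et] act_polytabloid by metis
    qed
    then have "specht \<mu> \<subseteq> ?U"
      unfolding specht_def by (intro fvs.span_minimal U_sub) blast
    have "carrier_vec ?d \<subseteq> W"
    proof
      fix x :: "complex vec" assume x: "x \<in> carrier_vec ?d"
      have "?\<Phi> x \<in> ?U" using \<open>specht \<mu> \<subseteq> ?U\<close> lincomb_span[OF b12] specht_basis(3) by blast
      then obtain y where y: "y \<in> W" "?\<Phi> x = ?\<Phi> y" by blast
      then have "x = y" using coords_lincomb[OF b12] x Wsub by (metis subsetD)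
      then show "x \<in> W" using y by simp
    qed
    then show ?thesis using Wsub by blast
  next
    case False
    then have "u = 0" if "u \<in> ?U" for u using col_antisym_zero_imp_zero[OF U_specht[OF that]] that by blast
    then have "v = 0\<^sub>v ?d" if "v \<in> W" for v
      using coords_lincomb[OF b12] coords_zero[OF b12] that Wsub by (metis imageI subsetD)
    then show ?thesis using W0 by blast
  qed
qed

lemma specht_char_eq: "specht_char \<mu> = character (sym_group n) (specht_rep \<mu>)"
  using \<mu> by (simp add: specht_char_def partitions_of_def)

lemma specht_char_irr: "specht_char \<mu> \<in> irr_chars (sym_group n)"
  unfolding specht_char_eq irr_chars_def using irreducible_specht by blast

text \<open>By Frobenius reciprocity this sum computes the multiplicity of the Specht module in the
  permutation module on the colourings with the content of \<open>c\<close>.\<close>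

lemma sum_specht_char_stabilizer:
  fixes c :: "nat \<Rightarrow> nat"
  assumes le: "sum_mset (image_mset c (mset_set {1..n})) \<le> sum_mset (row_content \<mu>)"
  defines "H \<equiv> {w. w permutes {1..n} \<and> (\<forall>x\<in>{1..n}. c (w x) = c x)}"
  shows "(\<Sum>w\<in>H. specht_char \<mu> w)
    = (if image_mset c (mset_set {1..n}) = row_content \<mu> then of_nat (card H) else 0)"
proof -
  let ?bs = "specht_basis \<mu>"
  note b12 = specht_basis(1,2)
  \<comment> \<open>Symmetrisation over the stabilizer \<open>H\<close> of \<open>c\<close>; the
    character sum is its trace on the Specht module.\<close>
  define R where "R v = (\<Sum>w\<in>H. act w v)" for v
  have H: "w permutes {1..n}" "x \<in> {1..n} \<Longrightarrow> c (w x) = c x" if "w \<in> H" for w x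
    using that by (auto simp: H_def)
  have finH: "finite H" unfolding H_def by (rule finite_subset[OF _ finite_permutations[of "{1..n}"]]) auto
  have idH: "id \<in> H" by (simp add: H_def permutes_id)
  have linR: "flinear R"
    using flinear_act unfolding flinear_def R_def by (simp add: sum.distrib fvs.scale_sum_right)
  have R_act: "R (act \<sigma> v) = R v" if \<sigma>: "\<sigma> \<in> H" for \<sigma> v
  proof -
    note p = H(1)[OF \<sigma>]
    have inv_in: "c (inv' \<sigma> x) = c x" if "x \<in> {1..n}" for x
      using H(2)[OF \<sigma>, of "inv' \<sigma> x"] that permutes_in_image[OF permutes_inv[OF p]] permutes_inverses(1)[OF p] by simp
    have "R (act \<sigma> v) = (\<Sum>w\<in>H. act (w \<circ> \<sigma>) v)" by (simp add: R_def act_comp)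
    also have "\<dots> = (\<Sum>w\<in>H. act w v)"
    proof (rule sum.reindex_bij_betw[of "\<lambda>w. w \<circ> \<sigma>"], rule bij_betw_inverses[where g = "\<lambda>w. w \<circ> inv' \<sigma>"])
      show "w \<circ> \<sigma> \<in> H \<and> w \<circ> \<sigma> \<circ> inv' \<sigma> = w" if "w \<in> H" for w
        using that H(2)[OF \<sigma>] permutes_in_image[OF p] permutes_compose[OF p]
        by (auto simp: H_def fun_eq_iff permutes_inverses[OF p])
      show "w \<circ> inv' \<sigma> \<in> H \<and> w \<circ> inv' \<sigma> \<circ> \<sigma> = w" if "w \<in> H" for w
        using that inv_in permutes_in_image[OF permutes_inv[OF p]] permutes_compose[OF permutes_inv[OF p]]
        by (auto simp: H_def fun_eq_iff permutes_inverses[OF p])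
    qed
    finally show ?thesis by (simp add: R_def)
  qed
  have "specht_char \<mu> w = trace (matrix_of ?bs (act w))" if "w \<in> H" for w
    using H(1)[OF that] unfolding specht_char_eq character_def by (simp add: sym_group_carrier specht_rep_eq)
  moreover have "trace (matrix_of ?bs R) = (\<Sum>w\<in>H. trace (matrix_of ?bs (act w)))"
    unfolding R_def by (rule trace_matrix_of_sum[OF b12 act_specht_basis[OF H(1)]])
  ultimately have trace: "(\<Sum>w\<in>H. specht_char \<mu> w) = trace (matrix_of ?bs R)"
    by simp
  \<comment> \<open>A collision gives a transposition in \<open>H\<close>, which negates the
    polytabloid but is absorbed by \<open>R\<close>. Straightening gives a tableau whose rows are
    the colour classes.\<close>
  have collapse: "R (polytabloid \<mu> t) = 0 \<or>
      (\<exists>s\<in>tableaux \<mu>. (\<forall>x\<in>diagram \<mu>. c (s x) = fst x) \<and> R (polytabloid \<mu> t) \<in> fvs.span {R (polytabloid \<mu> s)})"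
    if t: "t \<in> tableaux \<mu>" for t
    using t le
  proof (cases rule: collision_or_straighten)
    case (collision x y)
    let ?\<tau> = "transpose x y"
    have "?\<tau> \<in> H" using collision by (auto simp: H_def permutes_swap_id transpose_def)
    then have "R (polytabloid \<mu> t) = R (act ?\<tau> (polytabloid \<mu> t))" by (rule R_act[symmetric])
    also have "act ?\<tau> (polytabloid \<mu> t) = fscale (- 1) (polytabloid \<mu> t)"
      using collision(1) act_polytabloid[OF permutes_swap_id[OF collision(3,4)]]
      by (simp add: polytabloid_move[OF collision(5)] sign_swap_id)
    also have "R \<dots> = fscale (- 1) (R (polytabloid \<mu> t))" by (rule flinear_scale[OF linR])
    finally show ?thesis using fscale_minus_self by blast
  next
    case (straighten \<pi>)
    let ?s = "move \<mu> \<pi> t"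
    have s: "?s \<in> tableaux \<mu>" by (rule move_tableau[OF column_stabilizer_permutes[OF straighten(1)] t])
    have "\<forall>x\<in>diagram \<mu>. c (?s x) = fst x" using straighten(2) by (simp add: move_def)
    moreover have "fscale (of_int (sign \<pi>)) (R (polytabloid \<mu> ?s)) = R (polytabloid \<mu> t)"
      by (simp add: polytabloid_move[OF straighten(1)] flinear_scale[OF linR] flip: of_int_mult)
    then have "R (polytabloid \<mu> t) \<in> fvs.span {R (polytabloid \<mu> ?s)}"
      by (metis fvs.span_base fvs.span_scale insertI1)
    ultimately show ?thesis using s by blast
  qed
  have content_of: "image_mset c (mset_set {1..n}) = row_content \<mu>"
    if s: "s \<in> tableaux \<mu>" "\<forall>x\<in>diagram \<mu>. c (s x) = fst x" for s
  proof -
    have "mset_set {1..n} = image_mset s (mset_set (diagram \<mu>))"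
      using image_mset_mset_set[OF bij_betw_imp_inj_on] bij_betw_imp_surj_on tableau_bij[OF s(1)] by metis
    then show ?thesis
      unfolding row_content_def using s(2) by (simp add: multiset.map_comp) (intro image_mset_cong, simp)
  qed
  show ?thesis
  proof (cases "image_mset c (mset_set {1..n}) = row_content \<mu>")
    case False
    then have "R (polytabloid \<mu> t) = 0" if "t \<in> tableaux \<mu>" for t
      using collapse[OF that] content_of by blast
    then have "R b \<in> fvs.span {}" if "b \<in> specht \<mu>" for b
      using that unfolding specht_def by (rule_tac flinear_span[OF linR]) (auto intro: fvs.span_zero)
    then have "R b = 0" if "b \<in> set ?bs" for b using specht_basis_in[OF that] by simp
    then have "trace (matrix_of ?bs R) = 0"
      by (simp add: trace_def matrix_of_def fvs.representation_zero)
    then show ?thesis using False trace by simp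
  next
    case True
    obtain h where h: "bij_betw h (diagram \<mu>) {1..n}" "\<And>x. x \<in> diagram \<mu> \<Longrightarrow> c (h x) = fst x"
      using image_mset_eq_obtain_bij[of "diagram \<mu>" "{1..n}" fst c] True by (auto simp: row_content_def)
    define t0 where "t0 = restrict h (diagram \<mu>)"
    have "bij_betw t0 (diagram \<mu>) {1..n}"
      using h(1) by (subst bij_betw_cong[of _ _ h]) (auto simp: t0_def)
    then have t0: "t0 \<in> tableaux \<mu>" by (simp add: tableaux_def sum_list_shape t0_def)
    have ct0: "c (t0 x) = fst x" if "x \<in> diagram \<mu>" for x using h(2) that by (simp add: t0_def)
    have row_t0: "row_of \<mu> t0 x = c x" if x: "x \<in> {1..n}" for x
    proof -
      obtain y where "y \<in> diagram \<mu>" "t0 y = x" using tableau_surj[OF t0 x] .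
      then show ?thesis using row_of_tableau[OF t0, of y] ct0[of y] by simp
    qed
    let ?v = "R (polytabloid \<mu> t0)"
    \<comment> \<open>Two tableaux having the colour classes as rows differ by an element of
      \<open>H\<close>, which \<open>R\<close> absorbs; so the image of \<open>R\<close> lies on one
      line.\<close>
    have same: "R (polytabloid \<mu> s) = ?v" if s: "s \<in> tableaux \<mu>" "\<forall>x\<in>diagram \<mu>. c (s x) = fst x" for s
    proof -
      obtain w where w: "w permutes {1..n}" "s = move \<mu> w t0" "\<And>x. x \<in> diagram \<mu> \<Longrightarrow> w (t0 x) = s x"
        using tableaux_transitive[OF t0 s(1)] by metis
      have "c (w x) = c x" if x: "x \<in> {1..n}" for x
      proof -
        obtain y where "y \<in> diagram \<mu>" "t0 y = x" using tableau_surj[OF t0 x] .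
        then show ?thesis using w(3)[of y] s(2) ct0[of y] by auto
      qed
      then have "w \<in> H" using w(1) by (simp add: H_def)
      then show ?thesis using R_act[of w "polytabloid \<mu> t0"] act_polytabloid[OF w(1)] w(2) by simp
    qed
    have "R (polytabloid \<mu> t) \<in> fvs.span {?v}" if "t \<in> tableaux \<mu>" for t
      using collapse[OF that] same by (auto simp: fvs.span_zero)
    then have "R b \<in> fvs.span {?v}" if "b \<in> specht \<mu>" for b
      using that unfolding specht_def by (rule_tac flinear_span[OF linR]) auto
    then have "\<exists>k. R b = fscale k ?v" if "b \<in> set ?bs" for b
      using specht_basis_in[OF that] by (auto simp: fvs.span_singleton)
    then obtain \<phi> where \<phi>: "\<And>b. b \<in> set ?bs \<Longrightarrow> R b = fscale (\<phi> b) ?v" by metis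
    have e0: "polytabloid \<mu> t0 \<in> specht \<mu>" using t0 by (simp add: specht_def fvs.span_base)
    have v_in: "?v \<in> fvs.span (set ?bs)"
      unfolding R_def using act_specht[OF H(1) e0] specht_basis(3) by (intro fvs.span_sum) auto
    \<comment> \<open>\<open>H\<close> permutes entries within the rows of \<open>t0\<close>, so
      every summand of \<open>?v\<close> has coefficient 1 at the tabloid of \<open>t0\<close> and
      nothing cancels.\<close>
    have "Poly_Mapping.lookup (act w (polytabloid \<mu> t0)) (tabloid_of \<mu> t0) = 1" if w: "w \<in> H" for w
    proof -
      have "tabloid_of \<mu> (move \<mu> w t0) = tabloid_of \<mu> t0"
      proof (rule tabloid_move_eq[OF H(1)[OF w] t0])
        fix x assume x: "x \<in> {1..n}"
        then have "w x \<in> {1..n}" using permutes_in_image[OF H(1)[OF w]] by simp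
        then show "row_of \<mu> t0 (w x) = row_of \<mu> t0 x" using row_t0 H(2)[OF w] x by simp
      qed
      then show ?thesis
        using lookup_act[OF permutes_inj[OF H(1)[OF w]], of "polytabloid \<mu> t0" "tabloid_of \<mu> t0"]
          lookup_polytabloid_self[OF t0] by (simp add: perm_tabloid_of)
    qed
    then have "Poly_Mapping.lookup ?v (tabloid_of \<mu> t0) = of_nat (card H)"
      by (simp add: R_def lookup_sum)
    moreover have "card H \<noteq> 0" using finH idH by auto
    ultimately have "?v \<noteq> 0" by auto
    \<comment> \<open>Since \<open>R\<close> absorbs every element of \<open>H\<close>, applying it
      twice multiplies by \<open>card H\<close>; this eigenvalue on the line is the trace.\<close>
    have "R ?v = (\<Sum>\<sigma>\<in>H. R (act \<sigma> (polytabloid \<mu> t0)))"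
      by (subst (2) R_def) (rule flinear_sum[OF linR])
    also have "\<dots> = (\<Sum>\<sigma>\<in>H. ?v)" using R_act by simp
    also have "\<dots> = fscale (of_nat (card H)) ?v"
      by (rule poly_mapping_eqI) (simp add: lookup_sum)
    finally have Rv: "R ?v = fscale (of_nat (card H)) ?v" .
    have "trace (matrix_of ?bs R) = of_nat (card H)"
      by (rule trace_matrix_of_rank_one[OF b12 linR v_in \<open>?v \<noteq> 0\<close> \<phi> Rv])
    then show ?thesis using True trace by simp
  qed
qed

end

section \<open>Young's rule\<close>

lemma card_fixed_colorings_conj:
  assumes w: "w permutes S" and u: "u permutes S"
  shows "card (fixed_colorings S m (u \<circ> w \<circ> inv' u)) = card (fixed_colorings S m w)"
proof -
  note u' = permutes_inv[OF u]
  define P where "P c = (\<lambda>x\<in>S. c (u x))" for c :: "'a \<Rightarrow> 'b"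
  define Q where "Q c = (\<lambda>x\<in>S. c (inv' u x))" for c :: "'a \<Rightarrow> 'b"
  have "P c \<in> fixed_colorings S m w \<and> Q (P c) = c" if c: "c \<in> fixed_colorings S m (u \<circ> w \<circ> inv' u)" for c
  proof
    have "c (u (w x)) = c (u x)" if "x \<in> S" for x
    proof -
      have "u x \<in> S" using that permutes_in_image[OF u] by simp
      then have "c ((u \<circ> w \<circ> inv' u) (u x)) = c (u x)" using c unfolding fixed_colorings_def by blast
      then show ?thesis by (simp add: permutes_inverses[OF u])
    qed
    moreover have "image_mset (P c) (mset_set S) = image_mset c (mset_set S)"
      using permutes_implies_image_mset_eq[OF u, of "P c" c] by (simp add: P_def)
    ultimately show "P c \<in> fixed_colorings S m w"
      using c permutes_in_image[OF w] by (simp add: fixed_colorings_def colorings_def P_def)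
    have "c \<in> extensional S" using c by (simp add: fixed_colorings_def colorings_def PiE_def)
    then show "Q (P c) = c"
      using permutes_in_image[OF u'] by (auto simp: P_def Q_def fun_eq_iff extensional_def permutes_inverses[OF u])
  qed
  moreover have "Q c \<in> fixed_colorings S m (u \<circ> w \<circ> inv' u) \<and> P (Q c) = c" if c: "c \<in> fixed_colorings S m w" for c
  proof
    have "c (w (inv' u x)) = c (inv' u x)" if "x \<in> S" for x
      using that permutes_in_image[OF u'] c unfolding fixed_colorings_def by simp
    moreover have "image_mset (Q c) (mset_set S) = image_mset c (mset_set S)"
      using permutes_implies_image_mset_eq[OF u', of "Q c" c] by (simp add: Q_def)
    ultimately show "Q c \<in> fixed_colorings S m (u \<circ> w \<circ> inv' u)"
      using c permutes_in_image[OF w] permutes_in_image[OF u] permutes_in_image[OF u']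
      by (simp add: fixed_colorings_def colorings_def Q_def permutes_inverses[OF u])
    have "c \<in> extensional S" using c by (simp add: fixed_colorings_def colorings_def PiE_def)
    then show "P (Q c) = c"
      using permutes_in_image[OF u] by (auto simp: P_def Q_def fun_eq_iff extensional_def permutes_inverses[OF u])
  qed
  ultimately show ?thesis by (rule bij_betw_same_card[OF bij_betw_inverses])
qed

text \<open>The character of the permutation representation on the colourings with content
  \<open>m\<close>.\<close>

definition coloring_char :: "nat \<Rightarrow> 'c multiset \<Rightarrow> (nat \<Rightarrow> nat) \<Rightarrow> complex" where
  "coloring_char n m w = of_nat (card (fixed_colorings {1..n} m w))"

lemma class_function_coloring_char: "class_function (sym_group n) (coloring_char n m)"
  unfolding class_function_def
proof (intro ballI)
  fix w u assume wu: "w \<in> carrier (sym_group n)" "u \<in> carrier (sym_group n)"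
  then have p: "w permutes {1..n}" "u permutes {1..n}" by (simp_all add: sym_group_carrier)
  show "coloring_char n m (u \<otimes>\<^bsub>sym_group n\<^esub> w \<otimes>\<^bsub>sym_group n\<^esub> inv\<^bsub>sym_group n\<^esub> u) = coloring_char n m w"
    unfolding sym_group_inv_equality[OF wu(2)] sym_group_mult coloring_char_def card_fixed_colorings_conj[OF p] ..
qed

lemma class_function_specht_char:
  "\<mu> \<in> partitions_of n \<Longrightarrow> class_function (sym_group n) (specht_char \<mu>)"
  using class_function_irr_chars[OF sym_group_is_group specht_char_irr] .

text \<open>The multiplicity of the Specht character in \<open>coloring_char n m\<close>, as a
  pairing; the inverse usual on one argument is harmless by
  \<open>class_function_inv\<close>.\<close>

definition specht_mult :: "nat \<Rightarrow> nat list \<Rightarrow> nat multiset \<Rightarrow> complex" where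
  "specht_mult n \<mu> m = (\<Sum>w\<in>carrier (sym_group n). coloring_char n m w * specht_char \<mu> w) / fact n"

text \<open>Summing over colourings first splits the pairing into character sums over stabilizers,
  evaluated by \<open>sum_specht_char_stabilizer\<close>; by Burnside's lemma the stabilizer orders
  add up to \<open>fact n\<close>.\<close>

lemma specht_mult_content:
  assumes \<mu>: "\<mu> \<in> partitions_of n" and le: "sum_mset m \<le> sum_mset (row_content \<mu>)"
  shows "specht_mult n \<mu> m = (if m = row_content \<mu> then 1 else 0)"
proof -
  let ?S = "{1..n}"
  define stab where "stab c = {w. w permutes ?S \<and> (\<forall>x\<in>?S. c (w x) = c x)}" for c :: "nat \<Rightarrow> nat"
  have fin: "finite {w. w permutes ?S}" by (simp add: finite_permutations)
  have swap: "(\<Sum>w | w permutes ?S. of_nat (card (fixed_colorings ?S m w)) * h w)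
      = (\<Sum>c\<in>colorings ?S m. \<Sum>w\<in>stab c. h w)" for h :: "_ \<Rightarrow> complex"
  proof -
    have "(\<Sum>w | w permutes ?S. of_nat (card (fixed_colorings ?S m w)) * h w)
        = (\<Sum>w | w permutes ?S. \<Sum>c | c \<in> colorings ?S m \<and> (\<forall>x\<in>?S. c (w x) = c x). h w)"
      by (simp add: fixed_colorings_def)
    also have "\<dots> = (\<Sum>c\<in>colorings ?S m. \<Sum>w | w \<in> {w. w permutes ?S} \<and> (\<forall>x\<in>?S. c (w x) = c x). h w)"
      using fin by (intro sum.swap_restrict) simp_all
    finally show ?thesis by (simp add: stab_def)
  qed
  have "(\<Sum>w\<in>stab c. specht_char \<mu> w) = (if m = row_content \<mu> then of_nat (card (stab c)) else 0)"
    if c: "c \<in> colorings ?S m" for c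
  proof -
    have m: "image_mset c (mset_set ?S) = m" using c by (simp add: colorings_def)
    show ?thesis
      using sum_specht_char_stabilizer[OF \<mu>, of c] le unfolding m stab_def by simp
  qed
  then have *: "specht_mult n \<mu> m
      = (\<Sum>c\<in>colorings ?S m. if m = row_content \<mu> then of_nat (card (stab c)) else 0) / fact n"
    using swap[of "specht_char \<mu>"] by (simp add: specht_mult_def coloring_char_def sym_group_simps(1))
  show ?thesis
  proof (cases "m = row_content \<mu>")
    case True
    then have "size m = card ?S" using \<mu> by (simp add: partitions_of_def)
    then have "(\<Sum>w | w permutes ?S. card (fixed_colorings ?S m w)) = fact n"
      using sum_card_fixed_colorings[of ?S m] by simp
    then have "(\<Sum>c\<in>colorings ?S m. of_nat (card (stab c)) :: complex) = fact n"
      using swap[of "\<lambda>_. 1"] by (simp flip: of_nat_sum)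
    then show ?thesis using True * by simp
  qed (use * in simp)
qed

text \<open>Of two partitions let \<nu> have the smaller element sum of its row content, or an equal
  one. In the permutation character of that content \<nu> has multiplicity 1, and \<mu> has
  multiplicity 0 unless the row contents agree.\<close>

lemma specht_char_inj: "inj_on specht_char (partitions_of n)"
proof (rule inj_onI)
  have *: "\<mu> = \<nu>" if \<mu>: "\<mu> \<in> partitions_of n" and \<nu>: "\<nu> \<in> partitions_of n"
    and eq: "specht_char \<mu> = specht_char \<nu>"
    and le: "sum_mset (row_content \<nu>) \<le> sum_mset (row_content \<mu>)" for \<mu> \<nu>
  proof -
    have "specht_mult n \<mu> (row_content \<nu>) = specht_mult n \<nu> (row_content \<nu>)"
      by (simp add: specht_mult_def eq)
    also have "\<dots> = 1" using specht_mult_content[OF \<nu>] by simp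
    finally have "row_content \<nu> = row_content \<mu>"
      using specht_mult_content[OF \<mu> le] by (simp split: if_splits)
    then show ?thesis using row_content_inj[OF \<mu> \<nu>] by simp
  qed
  fix \<mu> \<nu> assume "\<mu> \<in> partitions_of n" "\<nu> \<in> partitions_of n" "specht_char \<mu> = specht_char \<nu>"
  then show "\<mu> = \<nu>" using *[of \<mu> \<nu>] *[of \<nu> \<mu>] by (metis nle_le)
qed

lemma specht_char_orthogonal:
  assumes \<mu>: "\<mu> \<in> partitions_of n" and \<nu>: "\<nu> \<in> partitions_of n"
  shows "(\<Sum>w\<in>carrier (sym_group n). specht_char \<mu> w * specht_char \<nu> w) = (if \<mu> = \<nu> then fact n else 0)"
proof -
  have "(\<Sum>w\<in>carrier (sym_group n). specht_char \<mu> w * specht_char \<nu> w)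
      = (\<Sum>w\<in>carrier (sym_group n). specht_char \<mu> w * specht_char \<nu> (inv\<^bsub>sym_group n\<^esub> w))"
    using class_function_inv[OF class_function_specht_char[OF \<nu>]] by (intro sum.cong) auto
  also have "\<dots> = (if specht_char \<mu> = specht_char \<nu> then of_nat (card (carrier (sym_group n))) else 0)"
    by (rule irr_chars_orthogonal[OF sym_group_is_group specht_char_irr[OF \<mu>] specht_char_irr[OF \<nu>]])
  also have "\<dots> = (if \<mu> = \<nu> then fact n else 0)"
    using inj_on_eq_iff[OF specht_char_inj \<mu> \<nu>] by (simp add: card_sym_group)
  finally show ?thesis .
qed

lemma specht_expansion:
  assumes "class_function (sym_group n) f" "w \<in> carrier (sym_group n)"
  shows "f w = (\<Sum>\<mu>\<in>partitions_of n.
    (\<Sum>v\<in>carrier (sym_group n). f v * specht_char \<mu> v) / fact n * specht_char \<mu> w)"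
  by (rule class_function_expansion[OF class_function_specht_char specht_char_orthogonal assms])

lemma coloring_char_expansion:
  assumes "w \<in> carrier (sym_group n)"
  shows "coloring_char n m w = (\<Sum>\<mu>\<in>partitions_of n. specht_mult n \<mu> m * specht_char \<mu> w)"
  unfolding specht_mult_def by (rule specht_expansion[OF class_function_coloring_char assms])

text \<open>Young's rule: both sides are unitriangular, and by the numerical form of the RSK correspondence
  both have the numbers of contingency tables as Gram matrix.\<close>

lemma specht_mult_eq_kostka:
  assumes \<mu>: "\<mu> \<in> partitions_of n" and m: "size m = n"
  shows "specht_mult n \<mu> m = of_nat (kostka (row_len \<mu>) m)"
proof (rule unitriangular_gram_unique[where I = "partitions_of n" and C = row_content
      and X = "{m. size m = n}" and N = "\<lambda>\<mu>. sum_mset (row_content \<mu>)"])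
  fix \<mu> assume \<mu>: "\<mu> \<in> partitions_of n"
  show "row_content \<mu> \<in> {m. size m = n}" using \<mu> by (simp add: partitions_of_def)
  show "specht_mult n \<mu> (row_content \<mu>) = 1" by (simp add: specht_mult_content[OF \<mu>])
  show "of_nat (kostka (row_len \<mu>) (row_content \<mu>)) = (1 :: complex)"
    by (simp add: kostka_row_content_self[OF \<mu>])
  fix \<nu> assume \<nu>: "\<nu> \<in> partitions_of n"
  show "\<mu> = \<nu> \<or> sum_mset (row_content \<mu>) < sum_mset (row_content \<nu>)"
    if "specht_mult n \<mu> (row_content \<nu>) \<noteq> 0"
  proof (rule disjCI)
    assume "\<not> sum_mset (row_content \<mu>) < sum_mset (row_content \<nu>)"
    then have "sum_mset (row_content \<nu>) \<le> sum_mset (row_content \<mu>)" by simp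
    from specht_mult_content[OF \<mu> this] that have "row_content \<nu> = row_content \<mu>"
      by (simp split: if_splits)
    then show "\<mu> = \<nu>" using row_content_inj[OF \<mu> \<nu>] by simp
  qed
  show "\<mu> = \<nu> \<or> sum_mset (row_content \<mu>) < sum_mset (row_content \<nu>)"
    if "of_nat (kostka (row_len \<mu>) (row_content \<nu>)) \<noteq> (0 :: complex)"
    using that kostka_nonzero_imp[OF \<mu> \<nu>] by simp
next
  fix \<nu> and m' :: "nat multiset" assume \<nu>: "\<nu> \<in> partitions_of n" and "m' \<in> {m. size m = n}"
  then have m': "size m' = n" by simp
  let ?m = "row_content \<nu>" and ?G = "carrier (sym_group n)" and ?I = "partitions_of n"
  have sz: "size ?m = n" using \<nu> by (simp add: partitions_of_def)
  \<comment> \<open>Only the second factor is unfolded; the first then completes the expansion of a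
    permutation character, so the Gram entry becomes a pairing of two permutation
    characters.\<close>
  have "(\<Sum>\<mu>\<in>?I. specht_mult n \<mu> ?m * specht_mult n \<mu> m')
      = (\<Sum>\<mu>\<in>?I. \<Sum>w\<in>?G. specht_mult n \<mu> ?m * specht_char \<mu> w * (coloring_char n m' w / fact n))"
    by (intro sum.cong refl)
      (simp add: specht_mult_def[of n _ m'] sum_distrib_left sum_divide_distrib mult_ac)
  also have "\<dots> = (\<Sum>w\<in>?G. (\<Sum>\<mu>\<in>?I. specht_mult n \<mu> ?m * specht_char \<mu> w) * (coloring_char n m' w / fact n))"
    by (subst sum.swap) (simp add: sum_distrib_right sum_divide_distrib)
  also have "\<dots> = (\<Sum>w\<in>?G. coloring_char n ?m w * (coloring_char n m' w / fact n))"
    by (intro sum.cong refl) (simp only: coloring_char_expansion[symmetric])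
  also have "\<dots> = of_nat (\<Sum>w | w permutes {1..n}. card (fixed_colorings {1..n} ?m w) * card (fixed_colorings {1..n} m' w)) / fact n"
    by (simp add: coloring_char_def sym_group_simps(1) sum_divide_distrib)
  also have "\<dots> = of_nat (card (contingency ?m m'))"
    using sum_card_fixed_colorings_prod[of "{1..n}" ?m m'] sz by simp
  also have "\<dots> = (\<Sum>\<mu>\<in>?I. of_nat (kostka (row_len \<mu>) ?m) * of_nat (kostka (row_len \<mu>) m'))"
    using sum_schur_coeff_prod[OF sz, of m'] by (simp flip: of_nat_mult of_nat_sum)
  finally show "(\<Sum>\<mu>\<in>?I. specht_mult n \<mu> ?m * specht_mult n \<mu> m')
      = (\<Sum>\<mu>\<in>?I. of_nat (kostka (row_len \<mu>) ?m) * of_nat (kostka (row_len \<mu>) m'))" .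
qed (use \<mu> m in auto)

section \<open>Frobenius' formula and the coefficients of word maps\<close>

lemma coloring_char_frobenius:
  assumes w: "w \<in> carrier (sym_group n)"
  shows "coloring_char n m w = (\<Sum>\<mu>\<in>partitions_of n. of_nat (kostka (row_len \<mu>) m) * specht_char \<mu> w)"
proof (cases "size m = n")
  case True
  have "coloring_char n m w = (\<Sum>\<mu>\<in>partitions_of n. specht_mult n \<mu> m * specht_char \<mu> w)"
    by (rule coloring_char_expansion[OF w])
  then show ?thesis using specht_mult_eq_kostka[OF _ True] by simp
next
  \<comment> \<open>In the wrong degree there are neither colourings nor tableaux with content
    \<open>m\<close>.\<close>
  case False
  have "fixed_colorings {1..n} m w = {}"
    using False colorings_size[of "{1..n}" _ m] by (auto simp: fixed_colorings_def)
  moreover have "kostka (row_len \<mu>) m = 0" if "\<mu> \<in> partitions_of n" for \<mu>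
    using that False by (intro kostka_eq_0 row_len_shape) (auto simp: partitions_of_def shape_size_row_len)
  ultimately show ?thesis by (simp add: coloring_char_def)
qed

lemma specht_chars_span:
  assumes f: "class_function (sym_group n) f"
  shows "\<exists>a. \<forall>w\<in>carrier (sym_group n). f w = (\<Sum>\<chi>\<in>specht_char ` partitions_of n. a \<chi> * \<chi> w)"
proof (intro exI ballI)
  fix w assume w: "w \<in> carrier (sym_group n)"
  show "f w = (\<Sum>\<chi>\<in>specht_char ` partitions_of n.
      (\<Sum>v\<in>carrier (sym_group n). f v * \<chi> v) / fact n * \<chi> w)"
    unfolding sum.reindex[OF specht_char_inj] comp_def by (rule specht_expansion[OF f w])
qed

lemma irr_chars_sym_group: "irr_chars (sym_group n) = specht_char ` partitions_of n"
  by (rule irr_chars_eqI[OF sym_group_is_group finite_sym_group _ _ specht_chars_span])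
    (auto intro: specht_char_irr)

text \<open>The solution count is a class function, hence a combination of Specht characters: this
  is the existence that \<open>char_coeffs_eq\<close> asks for. The inverse disappears because
  permutations are conjugate to their inverses.\<close>

lemma word_coeff_specht_char:
  assumes \<gamma>: "set \<gamma> \<subseteq> {1..r} \<times> UNIV" and \<mu>: "\<mu> \<in> partitions_of n"
  shows "word_coeff (sym_group n) r \<gamma> (specht_char \<mu>)
    = (\<Sum>w\<in>carrier (sym_group n). of_nat (word_count (sym_group n) r \<gamma> w) * specht_char \<mu> w) / fact n"
proof -
  let ?G = "sym_group n" and ?f = "\<lambda>w. of_nat (word_count (sym_group n) r \<gamma> w) :: complex"
  have f: "class_function ?G ?f"
    using class_function_word_count[OF sym_group_is_group \<gamma>, of n] by (simp add: class_function_def)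
  have "\<exists>a. \<forall>w\<in>carrier ?G. ?f w = (\<Sum>\<chi>\<in>irr_chars ?G. a \<chi> * \<chi> w)"
    unfolding irr_chars_sym_group by (rule specht_chars_span[OF f])
  then have "word_coeff ?G r \<gamma> (specht_char \<mu>)
      = (\<Sum>w\<in>carrier ?G. ?f w * specht_char \<mu> (inv\<^bsub>?G\<^esub> w)) / of_nat (card (carrier ?G))"
    unfolding word_coeff_def
    by (intro char_coeffs_eq sym_group_is_group finite_sym_group specht_char_irr[OF \<mu>])
      (simp_all add: irr_chars_sym_group)
  also have "(\<Sum>w\<in>carrier ?G. ?f w * specht_char \<mu> (inv\<^bsub>?G\<^esub> w)) = (\<Sum>w\<in>carrier ?G. ?f w * specht_char \<mu> w)"
    using class_function_inv[OF class_function_specht_char[OF \<mu>]] by (intro sum.cong) auto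
  finally show ?thesis by (simp add: card_sym_group)
qed

lemma mfps_coeff_const_mult: "mfps_coeff (mfps_const c * f) m = c * mfps_coeff f m"
proof -
  have "mfps_coeff (mfps_const c * f) m
      = (\<Sum>x\<in>msplits m. if x = ({#}, m) then c * mfps_coeff f m else 0)"
    unfolding times_mfps.rep_eq mfps_const.rep_eq
    by (rule sum.cong) (auto simp: msplits_def split: if_splits)
  moreover have "({#}, m) \<in> msplits m" by (simp add: msplits_def)
  ultimately show ?thesis by simp
qed

lemma mfps_coeff_sum: "mfps_coeff (\<Sum>a\<in>A. f a) m = (\<Sum>a\<in>A. mfps_coeff (f a) m)"
  by (induction A rule: infinite_finite_induct) (simp_all add: zero_mfps.rep_eq plus_mfps.rep_eq)

theorem theorem4:
  fixes n r :: nat and \<gamma> :: "letter list"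
  assumes "0 < n" and "0 < r"
    and "\<gamma> \<in> carrier (free_group r)"
  shows "mfps_const (1 / fact n) *
      (\<Sum>u\<in>{1..r} \<rightarrow>\<^sub>E carrier (sym_group n).
        power_sum (cycle_type n (word_eval (sym_group n) u \<gamma>)))
    = (\<Sum>\<mu>\<in>partitions_of n.
        mfps_const (word_coeff (sym_group n) r \<gamma> (specht_char \<mu>)) * schur \<mu>)"
proof (rule mfps_eqI)
  fix m
  let ?G = "sym_group n"
  let ?U = "{1..r} \<rightarrow>\<^sub>E carrier ?G" and ?I = "partitions_of n"
  let ?f = "\<lambda>w. of_nat (word_count ?G r \<gamma> w) :: complex"
  interpret G: group ?G by (rule sym_group_is_group)
  have \<gamma>: "set \<gamma> \<subseteq> {1..r} \<times> UNIV" using assms(3) by (simp add: free_group_def)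
  have finU: "finite ?U" by (simp add: finite_PiE)
  have ev: "word_eval ?G u \<gamma> \<in> carrier ?G" if "u \<in> ?U" for u
    using that \<gamma> by (intro G.word_eval_closed[of _ r]) (auto simp: PiE_def)
  have "(\<Sum>u\<in>?U. mfps_coeff (power_sum (cycle_type n (word_eval ?G u \<gamma>))) m)
      = (\<Sum>u\<in>?U. coloring_char n m (word_eval ?G u \<gamma>))"
    using ev by (intro sum.cong refl) (simp add: coloring_char_def sym_group_carrier mfps_coeff_power_sum_cycle_type)
  \<comment> \<open>Tuples are grouped by the value of the word; the summand depends only on that
    value, so each group contributes its size, which is the solution count.\<close>
  also have "\<dots> = (\<Sum>w\<in>carrier ?G. \<Sum>u | u \<in> ?U \<and> word_eval ?G u \<gamma> = w. coloring_char n m (word_eval ?G u \<gamma>))"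
    using finU ev by (intro sum.group[symmetric]) auto
  also have "\<dots> = (\<Sum>w\<in>carrier ?G. ?f w * coloring_char n m w)"
    by (intro sum.cong refl) (simp add: word_count_def)
  also have "\<dots> = (\<Sum>w\<in>carrier ?G. \<Sum>\<mu>\<in>?I. ?f w * specht_char \<mu> w * of_nat (kostka (row_len \<mu>) m))"
    by (intro sum.cong refl) (simp add: coloring_char_frobenius sum_distrib_left mult_ac)
  also have "\<dots> = (\<Sum>\<mu>\<in>?I. (\<Sum>w\<in>carrier ?G. ?f w * specht_char \<mu> w) * of_nat (kostka (row_len \<mu>) m))"
    by (subst sum.swap) (simp add: sum_distrib_right)
  \<comment> \<open>The inner sum is \<open>fact n\<close> times the coefficient at the Specht
    character, which the prefactor on the left-hand side cancels.\<close>
  also have "\<dots> = fact n * (\<Sum>\<mu>\<in>?I. word_coeff ?G r \<gamma> (specht_char \<mu>) * mfps_coeff (schur \<mu>) m)"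
    unfolding sum_distrib_left
    by (intro sum.cong refl) (simp add: word_coeff_specht_char[OF \<gamma>] mfps_coeff_schur)
  finally show "mfps_coeff (mfps_const (1 / fact n) *
        (\<Sum>u\<in>?U. power_sum (cycle_type n (word_eval ?G u \<gamma>)))) m
      = mfps_coeff (\<Sum>\<mu>\<in>?I. mfps_const (word_coeff ?G r \<gamma> (specht_char \<mu>)) * schur \<mu>) m"
    by (simp add: mfps_coeff_const_mult mfps_coeff_sum)
qed

end
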